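(* Let $q\ge 1$, $s\ge 1$, $d\ge 0$ be integers and let $a_0(x),\dots,a_{s-1}(x)\in\mathbb{Z}[x]$ be polynomials of degree at most $d$. Let $\{K_n=\mathbb{Q}(\sqrt{f(n)})\}_{n\in\mathbb{N}}$ be a family of real quadratic fields, where $f(n)$ is a positive square-free integer for each $n$. For each $n$ let $\mathfrak{b}_n$ be an integral ideal of $K_n$ relatively prime to $q$ such that $\mathfrak{b}_n^{-1}=[1,\delta(n)]$, and assume that $\delta(n)-1$ has the purely periodic continued fraction expansion $\delta(n)-1=[[a_0(n),a_1(n),\dots,a_{s-1}(n)]]$ of period $s$, with $s$ independent of $n$. Suppose that, for $0\le C,D\le q-1$ with $(C,D)\ne(0,0)$, the residue of $N_{K_n}(\mathfrak{b}_n(C+D\delta(n)))$ modulo $q$ depends only on $C$, $D$ and $r$, where $n=qk+r$ with $0\le r<q$. Let $\chi$ be a Dirichlet character modulo $q$ and let $\chi_n=\chi\circ N_{K_n}$ be the associated ray class character modulo $q$ of $K_n$. Then $n\mapsto L_{K_n}(0,\chi_n,\mathfrak{b}_n)$ is a quasi-polynomial of degree $d$ and period $q$, and for each $i=0,\dots,d$ the values of its $i$-th coefficient function lie in $\frac{1}{12q^{i+2}}\mathbb{Z}[\chi(1),\chi(2),\dots,\chi(q)]$.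
   Context: $[1,\delta]$ denotes $\mathbb{Z}+\mathbb{Z}\delta$, and $K_n$ is regarded as a subfield of $\mathbb{R}$. $[[a_0,\dots,a_{s-1}]]$ is the purely periodic simple continued fraction $[a_0,\dots,a_{s-1},a_0,\dots,a_{s-1},\dots]$, where $[a_0,a_1,\dots]=a_0+\cfrac{1}{a_1+\cdots}$ (partial quotients positive integers); "period $s$" means minimal period length $s$. $N_K$ of an ideal is its absolute norm. Partial Hecke $L$-function: $L_K(s,\chi,\mathfrak{b})=\sum_{\mathfrak{c}\sim\mathfrak{b}}\chi(\mathfrak{c})N(\mathfrak{c})^{-s}$ for $\mathrm{Re}(s)>1$, the sum over integral ideals $\mathfrak{c}=\alpha\mathfrak{b}$ with $\alpha\in K$ totally positive, where $\chi(\mathfrak{c})=0$ if $\mathfrak{c}$ is not relatively prime to $q$; the value at $s=0$ is that of the meromorphic continuation. A quasi-polynomial of degree $d$ and period $q$ is a function of the form $f(n)=c_d(n)n^d+\cdots+c_0(n)$ where each $c_k(n)$ is periodic in $n$ with period $q$ ($c_d$ is not required to be nonzero); $c_k$ is called the $k$-th coefficient function. *)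

theory Defs
  imports
    "HOL-Algebra.QuotRing"
    "HOL-Algebra.Generated_Rings"
    "HOL-Complex_Analysis.Complex_Analysis"
    "HOL-Computational_Algebra.Squarefree"
begin

definition ring_on :: "'a :: comm_ring_1 set \<Rightarrow> 'a ring" where
  "ring_on A = \<lparr>carrier = A, monoid.mult = (*), one = 1, ring.zero = 0, add = (+)\<rparr>"

text \<open>Throughout, the field \<open>\<rat>(\<surd>D)\<close> is represented by the radicand \<open>D\<close>, which in the
  intended use is square-free and greater than 1.\<close>

definition quad_field :: "nat \<Rightarrow> real set" where
  "quad_field D = {x + y * sqrt (real D) |x y. x \<in> \<rat> \<and> y \<in> \<rat>}"

definition quad_ints :: "nat \<Rightarrow> real ring" where
  "quad_ints D = ring_on {x \<in> quad_field D. algebraic_int x}"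

definition totally_positive :: "nat \<Rightarrow> real \<Rightarrow> bool" where
  "totally_positive D \<alpha> \<longleftrightarrow>
     (\<exists>x\<in>\<rat>. \<exists>y\<in>\<rat>. \<alpha> = x + y * sqrt (real D) \<and>
        x + y * sqrt (real D) > 0 \<and> x - y * sqrt (real D) > 0)"

definition integral_ideal :: "nat \<Rightarrow> real set \<Rightarrow> bool" where
  "integral_ideal D I \<longleftrightarrow> ideal I (quad_ints D) \<and> I \<noteq> {0}"

definition coprime_to :: "nat \<Rightarrow> nat \<Rightarrow> real set \<Rightarrow> bool" where
  "coprime_to D q I \<longleftrightarrow>
     I <+>\<^bsub>quad_ints D\<^esub> (PIdl\<^bsub>quad_ints D\<^esub> (of_nat q)) = carrier (quad_ints D)"

definition inverse_ideal :: "nat \<Rightarrow> real set \<Rightarrow> real set" where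
  "inverse_ideal D I = {x \<in> quad_field D. \<forall>y\<in>I. x * y \<in> carrier (quad_ints D)}"

definition scale_ideal :: "real \<Rightarrow> real set \<Rightarrow> real set" where
  "scale_ideal \<alpha> I = (\<lambda>x. \<alpha> * x) ` I"

definition ideal_norm :: "nat \<Rightarrow> real set \<Rightarrow> nat" where
  "ideal_norm D I = Coset.order (quad_ints D Quot I)"

definition unit_lattice :: "real \<Rightarrow> real set" where
  "unit_lattice \<delta> = {of_int m + of_int n * \<delta> |m n. True}"

definition dirichlet_character :: "nat \<Rightarrow> (int \<Rightarrow> complex) \<Rightarrow> bool" where
  "dirichlet_character q chi \<longleftrightarrow>
     chi 1 = 1 \<and> (\<forall>m n. chi (m * n) = chi m * chi n) \<and>
     (\<forall>m. chi (m + int q) = chi m) \<and> (\<forall>m. chi m = 0 \<longleftrightarrow> \<not> coprime m (int q))"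

definition norm_character :: "nat \<Rightarrow> nat \<Rightarrow> (int \<Rightarrow> complex) \<Rightarrow> real set \<Rightarrow> complex" where
  "norm_character D q chi I = (if coprime_to D q I then chi (int (ideal_norm D I)) else 0)"

definition narrow_class :: "nat \<Rightarrow> real set \<Rightarrow> real set set" where
  "narrow_class D I =
     {J. integral_ideal D J \<and> (\<exists>\<alpha>. totally_positive D \<alpha> \<and> J = scale_ideal \<alpha> I)}"

definition hecke_series :: "nat \<Rightarrow> complex \<Rightarrow> (real set \<Rightarrow> complex) \<Rightarrow> real set \<Rightarrow> complex" where
  "hecke_series D z \<psi> I =
     (\<Sum>\<^sub>\<infinity>J\<in>narrow_class D I. \<psi> J * of_nat (ideal_norm D J) powr (- z))"

text \<open>The meromorphic continuation is unique as a function since a nicely meromorphic function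
  is determined at every point by its values on a half-plane (it is 0 at its poles).\<close>

definition partial_hecke_L :: "nat \<Rightarrow> complex \<Rightarrow> (real set \<Rightarrow> complex) \<Rightarrow> real set \<Rightarrow> complex" where
  "partial_hecke_L D z \<psi> I =
     (THE g. g nicely_meromorphic_on UNIV \<and>
        (\<forall>w. Re w > 1 \<longrightarrow> g w = hecke_series D w \<psi> I)) z"

fun cfrac_convergent :: "(nat \<Rightarrow> int) \<Rightarrow> nat \<Rightarrow> real" where
  "cfrac_convergent a 0 = of_int (a 0)"
| "cfrac_convergent a (Suc n) = of_int (a 0) + 1 / cfrac_convergent (\<lambda>i. a (Suc i)) n"

definition has_cfrac :: "real \<Rightarrow> (nat \<Rightarrow> int) \<Rightarrow> bool" where
  "has_cfrac x a \<longleftrightarrow> (\<forall>i. a i > 0) \<and> cfrac_convergent a \<longlonglongrightarrow> x"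

text \<open>Only the entries \<open>a 0, \<dots>, a (s - 1)\<close> matter, and \<open>s\<close> is the minimal period.\<close>

definition has_periodic_cfrac :: "real \<Rightarrow> nat \<Rightarrow> (nat \<Rightarrow> int) \<Rightarrow> bool" where
  "has_periodic_cfrac x s a \<longleftrightarrow>
     s > 0 \<and> has_cfrac x (\<lambda>j. a (j mod s)) \<and>
     (\<forall>t. 0 < t \<and> t < s \<longrightarrow> (\<exists>j. a ((j + t) mod s) \<noteq> a (j mod s)))"

text \<open>\<open>c k\<close> is the \<open>k\<close>-th coefficient function; the leading one may vanish.\<close>

definition quasi_polynomial ::
    "nat \<Rightarrow> nat \<Rightarrow> (nat \<Rightarrow> nat \<Rightarrow> complex) \<Rightarrow> (nat \<Rightarrow> complex) \<Rightarrow> bool" where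
  "quasi_polynomial d q c F \<longleftrightarrow>
     (\<forall>k\<le>d. \<forall>n. c k (n + q) = c k n) \<and>
     (\<forall>n. F n = (\<Sum>k\<le>d. c k n * of_nat n ^ k))"

definition character_ring :: "nat \<Rightarrow> (int \<Rightarrow> complex) \<Rightarrow> complex set" where
  "character_ring q chi = generate_ring (ring_on UNIV) (chi ` {1..int q})"

end

theory Submission
  imports Defs "HOL-Real_Asymp.Real_Asymp"
begin

text \<open>
  Every class is a sum over the totally positive elements of the lattice \<open>[1, \<delta>]\<close>, the inverse of \<open>b\<close>, modulo
  totally positive units. The even vectors attached to the continued fraction of \<open>\<delta> - 1\<close>,
  together with the points between them, decompose a fundamental domain for the units into
  unimodular cones. On each cone, Euler--Maclaurin summation continues the zeta function of the
  norm form and gives its value at 0 in terms of Bernoulli polynomials. When the cones between two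
  consecutive even vectors are added, everything telescopes to an expression that is linear in the
  partial quotients, with coefficients in \<open>1 / (12 q\<^sup>2) \<int>\<close> depending on them only modulo
  \<open>q\<close>. Since the partial quotients are integer polynomials in \<open>n\<close>, the claim follows.
\<close>

subsection \<open>Euler--Maclaurin summation\<close>

text \<open>The number of cones between consecutive even vectors is a partial quotient, so it grows
  with \<open>n\<close>, and the value of one cone at 0 contains ratios of coefficients of its norm
  form, whose denominators are not controlled by \<open>q\<close>. Both obstacles disappear
  together: consecutive vectors \<open>u i j\<close> differ by the same odd vector
  \<open>e (2 * i + 1)\<close>, so these ratios are \<open>2 + \<tau>\<close> at one generator and
  \<open>2 - \<tau>\<close> at the other for a trace \<open>\<tau>\<close>, and in the sum over the
  cones only the end terms in \<open>\<tau>\<close> remain. There the trace \<open>TW\<close> of a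
  complete quotient multiplies a sum over residues modulo \<open>q\<close>. A unimodular change of
  basis shows that both sides of an even vector give the same sum, so around the even period only
  integer multiples of Bernoulli values survive. The 12 is the denominator of half of the second
  Bernoulli polynomial, and \<open>q ^ 2\<close> comes from its evaluation at fractions with
  denominator \<open>q\<close>. That no ideal is counted twice requires that no totally positive
  unit of the lattice has a slope strictly between those of 1 and \<open>\<eta>\<close>; this rests
  on the minimality of the period.\<close>

definition poly_antideriv :: "real poly \<Rightarrow> real poly" where
  "poly_antideriv p = (\<Sum>i\<le>degree p. monom (coeff p i / real (Suc i)) (Suc i))"

lemma pderiv_poly_antideriv [simp]: "pderiv (poly_antideriv p) = p"
proof -
  have "pderiv (poly_antideriv p) = (\<Sum>i\<le>degree p. monom (coeff p i) i)"
    unfolding poly_antideriv_def higher_pderiv_sum[of 1, simplified] by (intro sum.cong refl) (simp add: pderiv_monom)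
  then show ?thesis by (simp add: poly_as_sum_of_monoms)
qed

lemma poly_antideriv_0 [simp]: "poly (poly_antideriv p) 0 = 0"
  by (simp add: poly_antideriv_def poly_sum poly_monom)

text \<open>\<open>bernp k\<close> is the Bernoulli polynomial \<open>B\<^sub>k\<close> divided by \<open>k!\<close>.\<close>

primrec bernp :: "nat \<Rightarrow> real poly" where
  "bernp 0 = 1"
| "bernp (Suc k) = poly_antideriv (bernp k)
     - [:poly (poly_antideriv (poly_antideriv (bernp k))) 1:]"

lemma bernp_deriv: "(poly (bernp (Suc k)) has_field_derivative poly (bernp k) x) (at x within S)"
proof -
  have "pderiv (bernp (Suc k)) = bernp k"
    by (simp add: pderiv_diff pderiv_pCons)
  then show ?thesis
    by (metis DERIV_subset poly_DERIV subset_UNIV)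
qed

lemma bernp_1: "poly (bernp 1) x = x - 1/2"
proof -
  have p: "poly_antideriv 1 = [:0, 1:]" by (simp add: poly_antideriv_def monom_Suc monom_0)
  have "poly_antideriv [:0, 1:] = [:0, 0, 1/2:]" by (simp add: poly_antideriv_def monom_Suc monom_0)
  then show ?thesis using p by simp
qed

lemma bernp_2: "poly (bernp 2) x = (x\<^sup>2 - x + 1/6) / 2"
proof -
  have p: "poly_antideriv 1 = [:0, 1:]" by (simp add: poly_antideriv_def monom_Suc monom_0)
  have q: "poly_antideriv [:0, 1:] = [:0, 0, 1/2:]" by (simp add: poly_antideriv_def monom_Suc monom_0)
  have b1: "bernp 1 = [:-1/2, 1:]" by (simp add: p q)
  have r: "poly_antideriv [:-1/2, 1:] = [:0, -1/2, 1/2:]"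
    by (simp add: poly_antideriv_def monom_Suc monom_0)
  have s: "poly_antideriv [:0, -1/2, 1/2:] = [:0, 0, -1/4, 1/6:]"
    by (simp add: poly_antideriv_def monom_Suc monom_0 numeral_2_eq_2)
  have "bernp 2 = poly_antideriv (bernp 1) - [:poly (poly_antideriv (poly_antideriv (bernp 1))) 1:]"
    by (simp add: numeral_2_eq_2)
  also have "\<dots> = [:1/12, -1/2, 1/2:]"
    unfolding b1 r s by simp
  finally show ?thesis by (simp add: power2_eq_square field_simps)
qed

text \<open>The difference is the integral of \<open>bernp k\<close> over the unit interval. It
  vanishes for \<open>k > 0\<close> because the constant in the recursion gives every later
  polynomial the mean 0.\<close>

lemma bernp_endpoints: "poly (bernp (Suc k)) 1 - poly (bernp (Suc k)) 0 = (if k = 0 then 1 else 0)"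
proof (cases k)
  case 0
  then show ?thesis using bernp_1[of 1] bernp_1[of 0] by (simp del: bernp.simps)
next
  case (Suc j)
  define p where "p = poly_antideriv (poly_antideriv (bernp j))"
  \<comment> \<open>\<open>H\<close> is the antiderivative of \<open>bernp k\<close> that vanishes
    at both 0 and 1.\<close>
  define H where "H = (\<lambda>t. poly p t - t * poly p 1)"
  have "(poly (bernp (Suc k)) has_field_derivative poly (bernp (Suc j)) t) (at t)" for t
    using bernp_deriv Suc by metis
  moreover have "(H has_field_derivative poly (bernp (Suc j)) t) (at t)" for t
  proof -
    have "(poly p has_field_derivative poly (poly_antideriv (bernp j)) t) (at t)"
      using poly_DERIV[of p t] by (simp add: p_def)
    then show ?thesis
      unfolding H_def by (auto intro!: derivative_eq_intros simp: p_def)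
  qed
  ultimately have "((\<lambda>t. poly (bernp (Suc k)) t - H t) has_field_derivative 0) (at t)" for t
    by (metis DERIV_diff diff_self)
  then have "poly (bernp (Suc k)) 1 - H 1 = poly (bernp (Suc k)) 0 - H 0"
    by (intro DERIV_isconst_all) auto
  then show ?thesis using Suc by (simp add: H_def p_def)
qed

lemma vector_differentiable_bound:
  fixes f :: "real \<Rightarrow> 'a::real_normed_vector"
  assumes "convex S" and d: "\<And>t. t \<in> S \<Longrightarrow> (f has_vector_derivative f' t) (at t within S)"
    and b: "\<And>t. t \<in> S \<Longrightarrow> norm (f' t) \<le> B" and "x \<in> S" "y \<in> S"
  shows "norm (f x - f y) \<le> B * norm (x - y)"
proof (rule differentiable_bound[OF \<open>convex S\<close> _ _ \<open>x \<in> S\<close> \<open>y \<in> S\<close>])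
  show "(f has_derivative (\<lambda>x. x *\<^sub>R f' t)) (at t within S)" if "t \<in> S" for t
    using d[OF that] by (simp add: has_vector_derivative_def)
  show "onorm (\<lambda>x. x *\<^sub>R f' t) \<le> B" if "t \<in> S" for t
    using mult_left_mono[OF b[OF that] abs_ge_zero] by (intro onorm_le) (simp add: mult.commute)
qed

text \<open>\<open>D\<close> is complex valued, so despite its mean 0 it need not have a zero.
  Instead, every value is within \<open>B\<close> of \<open>D x\<close>; integrating this over the
  interval replaces \<open>D t\<close> by its mean 0 and leaves \<open>D x\<close>.\<close>

lemma mean_zero_bound:
  fixes D H :: "real \<Rightarrow> complex"
  assumes H: "\<And>t. t \<in> {0..1} \<Longrightarrow> (H has_vector_derivative D t) (at t within {0..1})"
    and D: "\<And>t. t \<in> {0..1} \<Longrightarrow> (D has_vector_derivative D' t) (at t within {0..1})"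
    and bnd: "\<And>t. t \<in> {0..1} \<Longrightarrow> norm (D' t) \<le> B"
    and mean: "H 1 = H 0" and x: "x \<in> {0..1}"
  shows "norm (D x) \<le> B"
proof -
  have B0: "B \<ge> 0" using bnd[of 0] by (meson atLeastAtMost_iff le_numeral_extra(3) norm_ge_zero order_trans zero_le_one)
  have lip: "norm (D t - D x) \<le> B" if t: "t \<in> {0..1}" for t
  proof -
    have "norm (D t - D x) \<le> B * norm (t - x)"
      by (rule vector_differentiable_bound[where S = "{0..1}" and f' = D'])
        (use D bnd t x in auto)
    also have "\<dots> \<le> B * 1" using t x B0 by (intro mult_left_mono) auto
    finally show ?thesis by simp
  qed
  have "norm ((H 1 - 1 *\<^sub>R D x) - (H 0 - 0 *\<^sub>R D x)) \<le> B * norm (1 - (0::real))"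
    by (rule vector_differentiable_bound[where S = "{0..1}" and f = "\<lambda>t. H t - t *\<^sub>R D x" and f' = "\<lambda>t. D t - D x"])
      (use H lip in \<open>auto intro!: derivative_eq_intros simp: has_vector_derivative_def algebra_simps\<close>)
  then show ?thesis using mean by simp
qed

text \<open>The error of order \<open>K + 1\<close> for \<open>\<phi>\<close> has mean zero, and its derivative is the error of
  order \<open>K\<close> for the shifted sequence; so the bound is inherited along the induction on \<open>K\<close>.\<close>

lemma euler_maclaurin_unit:
  fixes \<phi> :: "nat \<Rightarrow> real \<Rightarrow> complex"
  assumes "\<And>k t. k \<le> Suc K \<Longrightarrow> t \<in> {0..1} \<Longrightarrow> (\<phi> k has_vector_derivative \<phi> (Suc k) t) (at t within {0..1})"
    and "\<And>t. t \<in> {0..1} \<Longrightarrow> norm (\<phi> (K + 2) t) \<le> B" and "x \<in> {0..1}"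
  shows "norm (\<phi> 1 x - (\<Sum>k\<le>K. of_real (poly (bernp k) x) * (\<phi> k 1 - \<phi> k 0))) \<le> B"
  using assms
proof (induction K arbitrary: \<phi> x)
  case 0
  show ?case
  proof (rule mean_zero_bound[where D' = "\<phi> 2"
        and D = "\<lambda>x. \<phi> 1 x - (\<Sum>k\<le>0. of_real (poly (bernp k) x) * (\<phi> k 1 - \<phi> k 0))" and H = "\<lambda>t. \<phi> 0 t - t *\<^sub>R (\<phi> 0 1 - \<phi> 0 0)"])
    show "((\<lambda>t. \<phi> 0 t - t *\<^sub>R (\<phi> 0 1 - \<phi> 0 0)) has_vector_derivative
        (\<phi> 1 t - (\<Sum>k\<le>0. of_real (poly (bernp k) t) * (\<phi> k 1 - \<phi> k 0)))) (at t within {0..1})"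
      if "t \<in> {0..1}" for t
      using 0(1)[of 0 t] that
      by (auto intro!: derivative_eq_intros simp: has_vector_derivative_def algebra_simps)
    show "((\<lambda>t. \<phi> 1 t - (\<Sum>k\<le>0. of_real (poly (bernp k) t) * (\<phi> k 1 - \<phi> k 0)))
        has_vector_derivative \<phi> 2 t) (at t within {0..1})" if "t \<in> {0..1}" for t
      using 0(1)[of 1 t] that
      by (auto intro!: derivative_eq_intros simp: has_vector_derivative_def numeral_2_eq_2)
  qed (use 0 in \<open>auto simp: numeral_2_eq_2\<close>)
next
  case (Suc K)
  define \<Delta> where "\<Delta> k = \<phi> k 1 - \<phi> k 0" for k
  have bv: "((\<lambda>t. complex_of_real (poly (bernp (Suc k)) t)) has_vector_derivative
      complex_of_real (poly (bernp k) t)) (at t within S)" for k t S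
    using bernp_deriv has_vector_derivative_of_real has_real_derivative_iff_has_vector_derivative by blast
  have sumeq: "(\<Sum>k\<le>Suc K. complex_of_real (poly (bernp k) t) * \<Delta> k)
      = \<Delta> 0 + (\<Sum>k\<le>K. of_real (poly (bernp (Suc k)) t) * \<Delta> (Suc k))" for t
    by (subst sum.atMost_Suc_shift) simp
  show ?case
  proof (rule mean_zero_bound[where
        D = "\<lambda>x. \<phi> 1 x - (\<Sum>k\<le>Suc K. of_real (poly (bernp k) x) * (\<phi> k 1 - \<phi> k 0))"
        and D' = "\<lambda>x. \<phi> 2 x - (\<Sum>k\<le>K. of_real (poly (bernp k) x) * (\<phi> (Suc k) 1 - \<phi> (Suc k) 0))"
        and H = "\<lambda>t. \<phi> 0 t - (\<Sum>k\<le>Suc K. of_real (poly (bernp (Suc k)) t) * \<Delta> k)"])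
    fix t :: real assume t: "t \<in> {0..1}"
    show "((\<lambda>t. \<phi> 0 t - (\<Sum>k\<le>Suc K. of_real (poly (bernp (Suc k)) t) * \<Delta> k)) has_vector_derivative
        (\<phi> 1 t - (\<Sum>k\<le>Suc K. of_real (poly (bernp k) t) * (\<phi> k 1 - \<phi> k 0)))) (at t within {0..1})"
      unfolding \<Delta>_def[symmetric] using Suc.prems(1)[of 0 t] t
      by (intro has_vector_derivative_diff has_vector_derivative_sum
          has_vector_derivative_mult_left bv) auto
    show "((\<lambda>t. \<phi> 1 t - (\<Sum>k\<le>Suc K. of_real (poly (bernp k) t) * (\<phi> k 1 - \<phi> k 0))) has_vector_derivative
        (\<phi> 2 t - (\<Sum>k\<le>K. of_real (poly (bernp k) t) * (\<phi> (Suc k) 1 - \<phi> (Suc k) 0)))) (at t within {0..1})"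
      unfolding \<Delta>_def[symmetric] sumeq
    proof (intro has_vector_derivative_diff)
      show "(\<phi> 1 has_vector_derivative \<phi> 2 t) (at t within {0..1})"
        using Suc.prems(1)[of 1 t] t by (simp add: numeral_2_eq_2)
      have "((\<lambda>t. \<Delta> 0 + (\<Sum>k\<le>K. of_real (poly (bernp (Suc k)) t) * \<Delta> (Suc k))) has_vector_derivative
          0 + (\<Sum>k\<le>K. of_real (poly (bernp k) t) * \<Delta> (Suc k))) (at t within {0..1})"
        by (intro has_vector_derivative_add has_vector_derivative_const has_vector_derivative_sum
            has_vector_derivative_mult_left bv)
      then show "((\<lambda>t. \<Delta> 0 + (\<Sum>k\<le>K. of_real (poly (bernp (Suc k)) t) * \<Delta> (Suc k))) has_vector_derivative
          (\<Sum>k\<le>K. of_real (poly (bernp k) t) * \<Delta> (Suc k))) (at t within {0..1})" by simp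
    qed
    show "norm (\<phi> 2 t - (\<Sum>k\<le>K. of_real (poly (bernp k) t) * (\<phi> (Suc k) 1 - \<phi> (Suc k) 0))) \<le> B"
      using Suc.IH[of "\<lambda>k. \<phi> (Suc k)" t] Suc.prems t by (simp add: numeral_2_eq_2)
  next
    \<comment> \<open>By \<open>bernp_endpoints\<close> only the term for \<open>k = 0\<close>
      survives, and it equals \<open>\<phi> 0 1 - \<phi> 0 0\<close>; so the error has mean
      0.\<close>
    have "(\<Sum>k\<le>Suc K. of_real (poly (bernp (Suc k)) 1) * \<Delta> k)
        - (\<Sum>k\<le>Suc K. of_real (poly (bernp (Suc k)) 0) * \<Delta> k)
      = (\<Sum>k\<le>Suc K. of_real (poly (bernp (Suc k)) 1 - poly (bernp (Suc k)) 0) * \<Delta> k)"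
      by (simp add: sum_subtractf[symmetric] left_diff_distrib del: bernp.simps sum.atMost_Suc)
    also have "\<dots> = (\<Sum>k\<le>Suc K. if k = 0 then \<Delta> k else 0)"
      unfolding bernp_endpoints by (intro sum.cong) auto
    also have "\<dots> = \<Delta> 0" by simp
    finally show "\<phi> 0 1 - (\<Sum>k\<le>Suc K. of_real (poly (bernp (Suc k)) 1) * \<Delta> k)
        = \<phi> 0 0 - (\<Sum>k\<le>Suc K. of_real (poly (bernp (Suc k)) 0) * \<Delta> k)"
      by (simp add: \<Delta>_def[of 0] algebra_simps del: bernp.simps sum.atMost_Suc)
  qed (use Suc.prems in auto)
qed

lemma euler_maclaurin:
  fixes \<phi> :: "nat \<Rightarrow> real \<Rightarrow> complex"
  assumes d: "\<And>k t. k \<le> Suc K \<Longrightarrow> t \<in> {c..c+1} \<Longrightarrow> (\<phi> k has_vector_derivative \<phi> (Suc k) t) (at t within {c..c+1})"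
    and b: "\<And>t. t \<in> {c..c+1} \<Longrightarrow> norm (\<phi> (K + 2) t) \<le> B" and x: "x \<in> {0..1}"
  shows "norm (\<phi> 1 (c + x) - (\<Sum>k\<le>K. of_real (poly (bernp k) x) * (\<phi> k (c + 1) - \<phi> k c))) \<le> B"
proof -
  have im: "(\<lambda>t. c + t) ` {0..1} = {c..c+1}" by auto
  have "((\<lambda>t. \<phi> k (c + t)) has_vector_derivative \<phi> (Suc k) (c + t)) (at t within {0..1})"
    if "k \<le> Suc K" "t \<in> {0..1}" for k t
  proof -
    have "(\<phi> k \<circ> (\<lambda>t. c + t) has_vector_derivative (1 *\<^sub>R \<phi> (Suc k) (c + t))) (at t within {0..1})"
      by (rule vector_diff_chain_within)
        (use d[of k "c + t"] that in \<open>auto intro!: derivative_eq_intros simp: im has_vector_derivative_def add.commute\<close>)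
    then show ?thesis by (simp add: o_def)
  qed
  from euler_maclaurin_unit[of K "\<lambda>k t. \<phi> k (c + t)", OF this, of B x] show ?thesis
    using b x by simp
qed

section \<open>Locally uniform convergence of infinite sums and bounds for complex powers\<close>

lemma holomorphic_on_infsum:
  fixes f :: "'a \<Rightarrow> complex \<Rightarrow> complex"
  assumes S: "open S" and hol: "\<And>i. i \<in> A \<Longrightarrow> f i holomorphic_on S"
    and bnd: "\<And>z. z \<in> S \<Longrightarrow> \<exists>r>0. \<exists>M. M summable_on A \<and> (\<forall>i\<in>A. \<forall>w\<in>cball z r \<inter> S. norm (f i w) \<le> M i)"
  shows "(\<lambda>z. \<Sum>\<^sub>\<infinity>i\<in>A. f i z) holomorphic_on S"
proof -
  have "\<exists>r>0. (\<lambda>z. \<Sum>\<^sub>\<infinity>i\<in>A. f i z) holomorphic_on ball z r" if z: "z \<in> S" for z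
  proof -
    obtain r1 M where r1: "r1 > 0" "M summable_on A" "\<forall>i\<in>A. \<forall>w\<in>cball z r1 \<inter> S. norm (f i w) \<le> M i"
      using bnd[OF z] by blast
    obtain r2 where r2: "r2 > 0" "cball z r2 \<subseteq> S" using S z open_contains_cball by blast
    define r where "r = min r1 r2"
    have r: "r > 0" "cball z r \<subseteq> cball z r1 \<inter> S" using r1 r2 by (auto simp: r_def)
    \<comment> \<open>The M-test runs along the net of finite subsets of \<open>A\<close>, so pairs
      can serve as indices without being enumerated.\<close>
    have ul: "uniform_limit (cball z r) (\<lambda>X z. \<Sum>i\<in>X. f i z) (\<lambda>z. \<Sum>\<^sub>\<infinity>i\<in>A. f i z) (finite_subsets_at_top A)"
      by (rule Weierstrass_m_test_general[where M = M]) (use r1 r in blast)+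
    have "\<forall>\<^sub>F X in finite_subsets_at_top A. continuous_on (cball z r) (\<lambda>z. \<Sum>i\<in>X. f i z)
        \<and> (\<lambda>z. \<Sum>i\<in>X. f i z) holomorphic_on ball z r"
    proof (rule eventually_finite_subsets_at_top_weakI)
      fix X assume X: "finite X" "X \<subseteq> A"
      then have "(\<lambda>z. \<Sum>i\<in>X. f i z) holomorphic_on S"
        using hol by (intro holomorphic_intros) auto
      then show "continuous_on (cball z r) (\<lambda>z. \<Sum>i\<in>X. f i z)
        \<and> (\<lambda>z. \<Sum>i\<in>X. f i z) holomorphic_on ball z r"
        using r ball_subset_cball by (meson holomorphic_on_imp_continuous_on holomorphic_on_subset inf.boundedE order_trans)
    qed
    then show ?thesis
      using holomorphic_uniform_limit[OF _ ul] r(1) by (metis finite_subsets_at_top_neq_bot)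
  qed
  then have "(\<lambda>z. \<Sum>\<^sub>\<infinity>i\<in>A. f i z) analytic_on S"
    by (auto simp: analytic_on_def)
  then show ?thesis by (rule analytic_imp_holomorphic)
qed

lemma norm_of_real_powr: "t > 0 \<Longrightarrow> norm (complex_of_real t powr a) = t powr Re a"
  by (simp add: norm_powr_real_powr)

lemma has_vector_derivative_of_real_powr:
  assumes "(f has_real_derivative f') (at t within S)" "f t > 0"
  shows "((\<lambda>t. complex_of_real (f t) powr a) has_vector_derivative
      a * of_real f' * of_real (f t) powr (a - 1)) (at t within S)"
proof -
  have "((\<lambda>z. z powr a) has_field_derivative a * of_real (f t) powr (a - 1)) (at (complex_of_real (f t)))"
    using assms by (intro has_field_derivative_powr) auto
  moreover have "((\<lambda>t. complex_of_real (f t)) has_vector_derivative of_real f') (at t within S)"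
    using assms has_vector_derivative_of_real has_real_derivative_iff_has_vector_derivative by blast
  ultimately have "((\<lambda>z. z powr a) \<circ> (\<lambda>t. complex_of_real (f t)) has_vector_derivative
      of_real f' * (a * of_real (f t) powr (a - 1))) (at t within S)"
    by (intro field_vector_diff_chain_within) (auto intro: has_field_derivative_at_within)
  then show ?thesis by (simp add: o_def mult_ac)
qed

text \<open>The base is split into \<open>c \<le> 1\<close> and \<open>N \<ge> 1\<close> because the
  worst exponent is \<open>e1\<close> for the first factor and \<open>e2\<close> for the second. One
  majorant then serves all exponents occurring in a disc.\<close>

lemma powr_le_dominated:
  fixes c N t e :: real
  assumes "0 < c" "c \<le> 1" "N \<ge> 1" "c * N \<le> t" "e1 \<le> e" "e \<le> e2" "e2 \<le> 0"
  shows "t powr e \<le> c powr e1 * N powr e2"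
proof -
  have "t powr e \<le> (c * N) powr e"
    using assms by (intro powr_mono2') auto
  also have "\<dots> = c powr e * N powr e" using assms by (simp add: powr_mult)
  also have "\<dots> \<le> c powr e1 * N powr e2"
    using assms by (intro mult_mono powr_mono' powr_mono) auto
  finally show ?thesis .
qed

lemma cball_Re_bounds:
  assumes "w \<in> cball z r"
  shows "Re z - Re w \<le> r" "Re w - Re z \<le> r"
proof -
  have "\<bar>Re (z - w)\<bar> \<le> norm (z - w)" by (rule abs_Re_le_cmod)
  also have "norm (z - w) \<le> r" using assms by (simp add: dist_norm)
  finally show "Re z - Re w \<le> r" "Re w - Re z \<le> r" by (auto simp: abs_le_iff)
qed

lemma bounded_on_cball:
  fixes g :: "complex \<Rightarrow> complex"
  assumes "continuous_on UNIV g"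
  obtains B where "B \<ge> 0" "\<And>w. w \<in> cball z r \<Longrightarrow> norm (g w) \<le> B"
proof -
  have "bounded (g ` cball z r)"
    using assms by (intro compact_imp_bounded compact_continuous_image) (auto intro: continuous_on_subset)
  then obtain B where "\<forall>x\<in>g ` cball z r. norm x \<le> B" unfolding bounded_iff by blast
  then have "\<And>w. w \<in> cball z r \<Longrightarrow> norm (g w) \<le> max 0 B" by force
  then show ?thesis using that[of "max 0 B"] by auto
qed

lemma summable_on_Suc_powr: "e < -1 \<Longrightarrow> (\<lambda>m::nat. real (Suc m) powr e) summable_on UNIV"
proof -
  assume "e < -1"
  then have "summable (\<lambda>m::nat. real m powr e)" by (simp add: summable_real_powr_iff)
  then have "summable (\<lambda>m::nat. real (Suc m) powr e)"
    using summable_Suc_iff[of "\<lambda>m. real m powr e"] by simp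
  then show ?thesis by (intro norm_summable_imp_summable_on) simp
qed

lemma powr_shift_tendsto_0:
  assumes "Re a < 0"
  shows "(\<lambda>m. complex_of_real (real m + x) powr a) \<longlonglongrightarrow> 0"
proof (rule Lim_null_comparison)
  have "\<forall>\<^sub>F m in sequentially. real m + x > 0" by real_asymp
  then show "\<forall>\<^sub>F m in sequentially. norm (complex_of_real (real m + x) powr a) \<le> (real m + x) powr Re a"
    by eventually_elim (simp add: norm_powr_real_powr)
  show "(\<lambda>m. (real m + x) powr Re a) \<longlonglongrightarrow> 0"
    using assms by real_asymp
qed

subsection \<open>The Hurwitz zeta function\<close>

text \<open>The \<open>k\<close>-th derivative of \<open>t powr v\<close>.\<close>

definition ffp :: "complex \<Rightarrow> nat \<Rightarrow> real \<Rightarrow> complex" where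
  "ffp v k t = (\<Prod>i<k. (v - of_nat i)) * of_real t powr (v - of_nat k)"

lemma ffp_deriv:
  "t > 0 \<Longrightarrow> (ffp v k has_vector_derivative ffp v (Suc k) t) (at t within S)"
proof -
  assume t: "t > 0"
  have "((\<lambda>t. complex_of_real t powr (v - of_nat k)) has_vector_derivative
      (v - of_nat k) * of_real 1 * of_real t powr (v - of_nat k - 1)) (at t within S)"
    using t by (intro has_vector_derivative_of_real_powr) (auto intro!: derivative_eq_intros)
  from has_vector_derivative_mult_right[OF this, of "\<Prod>i<k. (v - of_nat i)"]
  show ?thesis unfolding ffp_def by (simp add: algebra_simps)
qed

lemma ffp_holomorphic: "t > 0 \<Longrightarrow> (\<lambda>w. ffp (1 - w) k t) holomorphic_on S"
  unfolding ffp_def by (intro holomorphic_intros) auto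

lemma prod_diff_of_nat_eq_0: "j < k \<Longrightarrow> (\<Prod>i<k. (of_nat j - of_nat i :: complex)) = 0"
  by (intro prod_zero) auto

text \<open>Here \<open>h w = (w - 1) \<zeta>(w, x)\<close>. Summing the function \<open>t powr (1 - w)\<close>, whose derivative is
  \<open>(1 - w) t powr (- w)\<close>, avoids the pole at 1; at \<open>w = 1, 0, - 1\<close> it is a polynomial in \<open>t\<close>,
  so that the Euler--Maclaurin errors vanish and the values can be read off.\<close>

lemma hurwitz_zeta_continuation:
  fixes x :: real
  assumes x: "0 < x" "x \<le> 1" and K: "K \<ge> 2"
  obtains h where "h holomorphic_on {w. Re w > - real K}"
    "\<And>w. Re w > 1 \<Longrightarrow> ((\<lambda>m. complex_of_real (real m + x) powr (-w)) has_sum h w / (w - 1)) UNIV"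
    "h 1 = 1" "h 0 = of_real (x - 1/2)" "h (-1) = of_real (x\<^sup>2 - x + 1/6)"
proof -
  define b where "b k = complex_of_real (poly (bernp k) 0)" for k
  define D where "D m w = ffp (1 - w) 1 (real m + x)
     - (\<Sum>k\<le>K. b k * (ffp (1 - w) k (real m + x + 1) - ffp (1 - w) k (real m + x)))" for m w
  define h where "h w = (\<Sum>k\<le>K. b k * ffp (1 - w) k x) - (\<Sum>\<^sub>\<infinity>m\<in>UNIV. D m w)" for w
  \<comment> \<open>The coefficient of the derivative of order \<open>K + 2\<close>, which bounds
    the errors. It vanishes when \<open>1 - w\<close> is one of \<open>0, ..., K + 1\<close>; this
    removes all errors at 1, 0 and -1.\<close>
  define G where "G w = (\<Prod>i<K+2. (1 - w - of_nat i :: complex))" for w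
  let ?S = "{w. Re w > - real K}"
  have Dbound: "norm (D m w) \<le> norm (G w) * (real m + x) powr (- Re w - real K - 1)"
    if "w \<in> ?S" for m w
  proof -
    have "norm (ffp (1-w) 1 (real m + x + 0) - (\<Sum>k\<le>K. of_real (poly (bernp k) 0) *
         (ffp (1-w) k (real m + x + 1) - ffp (1-w) k (real m + x))))
      \<le> norm (G w) * (real m + x) powr (- Re w - real K - 1)"
    proof (rule euler_maclaurin)
      fix t assume t: "t \<in> {real m + x..real m + x + 1}"
      then have t0: "t > 0" using x by auto
      have "norm (ffp (1-w) (K+2) t) = norm (G w) * t powr (- Re w - real K - 1)"
      proof -
        have "Re (1 - w - of_nat (K + 2)) = - Re w - real K - 1" by simp
        then show ?thesis
          by (simp only: ffp_def G_def norm_mult norm_of_real_powr[OF t0])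
      qed
      also have "\<dots> \<le> norm (G w) * (real m + x) powr (- Re w - real K - 1)"
        using t x that by (intro mult_left_mono powr_mono2') auto
      finally show "norm (ffp (1-w) (K+2) t) \<le> norm (G w) * (real m + x) powr (- Re w - real K - 1)" .
    qed (use x in \<open>auto intro!: ffp_deriv\<close>)
    then show ?thesis by (simp add: D_def b_def)
  qed
  have loc: "\<exists>r>0. \<exists>M. M summable_on UNIV \<and> (\<forall>m\<in>UNIV. \<forall>w\<in>cball z r \<inter> ?S. norm (D m w) \<le> M m)"
    if z: "z \<in> ?S" for z
  proof -
    \<comment> \<open>Half the distance to the boundary line: on this disc the exponent of the error
      stays below \<open>- 1 - r\<close>, hence the majorant is summable.\<close>
    define r where "r = (Re z + real K) / 2"
    have r: "r > 0" using z by (simp add: r_def)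
    have "continuous_on UNIV G" unfolding G_def by (intro continuous_intros)
    then obtain B where B: "B \<ge> 0" "\<And>w. w \<in> cball z r \<Longrightarrow> norm (G w) \<le> B"
      using bounded_on_cball by metis
    define M where "M m = B * (x powr (- Re z - r - real K - 1) * real (Suc m) powr (-1 - r))" for m
    have "M summable_on UNIV" unfolding M_def
      using r by (intro summable_on_cmult_right summable_on_Suc_powr) auto
    moreover have "norm (D m w) \<le> M m" if w: "w \<in> cball z r \<inter> ?S" for m w
    proof -
      have re: "Re z - Re w \<le> r" "Re w - Re z \<le> r" using w by (auto intro: cball_Re_bounds)
      have "norm (D m w) \<le> norm (G w) * (real m + x) powr (- Re w - real K - 1)"
        using Dbound w by auto
      also have "(real m + x) powr (- Re w - real K - 1)
          \<le> x powr (- Re z - r - real K - 1) * real (Suc m) powr (-1 - r)"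
      proof (rule powr_le_dominated)
        show "x * real (Suc m) \<le> real m + x" using x by (simp add: algebra_simps mult_left_le_one_le)
        show "- Re w - real K - 1 \<le> - 1 - r" using re unfolding r_def by argo
      qed (use x re r in auto)
      also have "norm (G w) * (x powr (- Re z - r - real K - 1) * real (Suc m) powr (-1 - r)) \<le> M m"
        unfolding M_def using B(2)[of w] w by (intro mult_right_mono) auto
      finally show ?thesis using mult_left_mono norm_ge_zero by blast
    qed
    ultimately show ?thesis using r by blast
  qed
  have oS: "open ?S" by (simp add: open_halfspace_Re_gt)
  have Dhol: "D m holomorphic_on ?S" for m
    unfolding D_def using x by (intro holomorphic_intros ffp_holomorphic) auto
  have hol: "h holomorphic_on ?S"
    unfolding h_def using x loc
    by (intro holomorphic_intros ffp_holomorphic holomorphic_on_infsum oS Dhol) auto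
  have Dsum: "(\<lambda>m. D m w) summable_on UNIV" if w: "w \<in> ?S" for w
  proof -
    obtain r M where rM: "r > 0" "M summable_on UNIV" "\<forall>m. \<forall>v\<in>cball w r \<inter> ?S. norm (D m v) \<le> M m"
      using loc[OF w] by auto
    have "(\<lambda>m. norm (D m w)) summable_on UNIV"
      by (rule summable_on_comparison_test[OF rM(2)]) (use rM w in auto)
    then show ?thesis by (rule abs_summable_summable)
  qed
  have hs: "((\<lambda>m. complex_of_real (real m + x) powr (-w)) has_sum h w / (w - 1)) UNIV" if w: "Re w > 1" for w
  proof -
    have "(\<lambda>m. D m w) sums (\<Sum>\<^sub>\<infinity>m\<in>UNIV. D m w)"
      using Dsum w by (intro has_sum_imp_sums has_sum_infsum) auto
    moreover have "(\<lambda>m. \<Sum>k\<le>K. b k * (ffp (1 - w) k (real m + x + 1) - ffp (1 - w) k (real m + x)))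
        sums (\<Sum>k\<le>K. b k * (0 - ffp (1 - w) k x))"
    proof (intro sums_sum sums_mult)
      fix k
      have "(\<lambda>m. ffp (1 - w) k (real m + x)) \<longlonglongrightarrow> (\<Prod>i<k. (1 - w - of_nat i)) * 0"
        unfolding ffp_def using w by (intro tendsto_mult tendsto_const powr_shift_tendsto_0) auto
      then have "(\<lambda>m. ffp (1 - w) k (real (Suc m) + x) - ffp (1 - w) k (real m + x)) sums
          (0 - ffp (1 - w) k (real 0 + x))"
        by (intro telescope_sums) simp
      then show "(\<lambda>m. ffp (1 - w) k (real m + x + 1) - ffp (1 - w) k (real m + x)) sums (0 - ffp (1 - w) k x)"
        by (simp add: add_ac)
    qed
    ultimately have "(\<lambda>m. D m w + (\<Sum>k\<le>K. b k * (ffp (1 - w) k (real m + x + 1) - ffp (1 - w) k (real m + x))))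
       sums ((\<Sum>\<^sub>\<infinity>m\<in>UNIV. D m w) + (\<Sum>k\<le>K. b k * (0 - ffp (1 - w) k x)))"
      by (rule sums_add)
    then have "(\<lambda>m. ffp (1 - w) 1 (real m + x)) sums - h w"
      by (simp add: D_def h_def sum_negf)
    then have "(\<lambda>m. ffp (1 - w) 1 (real m + x) / (1 - w)) sums (- h w / (1 - w))"
      by (rule sums_divide)
    moreover have "w \<noteq> 1" using w by auto
    moreover have "- h w / (1 - w) = h w / (w - 1)" by (metis minus_diff_eq minus_divide_divide)
    ultimately have s: "(\<lambda>m. complex_of_real (real m + x) powr (-w)) sums (h w / (w - 1))"
      by (simp add: ffp_def)
    have "(\<lambda>m. norm (complex_of_real (real m + x) powr (-w))) summable_on UNIV"
    proof (rule summable_on_comparison_test)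
      show "(\<lambda>m. x powr (- Re w) * real (Suc m) powr (- Re w)) summable_on UNIV"
        using w by (intro summable_on_cmult_right summable_on_Suc_powr) auto
      fix m :: nat
      have "norm (complex_of_real (real m + x) powr (-w)) = (real m + x) powr (- Re w)"
        using x by (subst norm_of_real_powr) auto
      also have "\<dots> \<le> x powr (- Re w) * real (Suc m) powr (- Re w)"
        by (rule powr_le_dominated) (use x w in \<open>auto simp: algebra_simps mult_left_le_one_le\<close>)
      finally show "norm (complex_of_real (real m + x) powr (-w)) \<le> x powr (- Re w) * real (Suc m) powr (- Re w)" .
    qed auto
    then have "(\<lambda>m. complex_of_real (real m + x) powr (-w)) summable_on UNIV"
      by (rule abs_summable_summable)
    then show ?thesis using s by (metis has_sum_imp_sums has_sum_infsum sums_unique2)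
  qed
  have val: "h (1 - of_nat j) = (\<Sum>k\<le>2. b k * ffp (of_nat j) k x)" if "j \<le> 2" for j
  proof -
    have w: "1 - of_nat j \<in> ?S" using that K by auto
    have "G (1 - of_nat j) = 0"
      unfolding G_def using that K prod_diff_of_nat_eq_0[of j "K+2"] by (simp del: prod.lessThan_Suc)
    then have "D m (1 - of_nat j) = 0" for m
      using Dbound[OF w, of m] by simp
    then have "h (1 - of_nat j) = (\<Sum>k\<le>K. b k * ffp (of_nat j) k x)"
      by (simp add: h_def)
    also have "\<dots> = (\<Sum>k\<le>2. b k * ffp (of_nat j) k x)"
    proof (rule sum.mono_neutral_right)
      show "\<forall>k\<in>{..K} - {..2}. b k * ffp (of_nat j) k x = 0"
      proof
        fix k assume "k \<in> {..K} - {..2}"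
        then have "j < k" using that by auto
        then show "b k * ffp (of_nat j) k x = 0" by (simp add: ffp_def prod_diff_of_nat_eq_0)
      qed
    qed (use K in auto)
    finally show ?thesis .
  qed
  have b: "b 0 = 1" "b 1 = -1/2" "b 2 = 1/12"
    unfolding b_def bernp_1 bernp_2 by simp_all
  note b = this this(2)[unfolded One_nat_def] this(3)[unfolded numeral_2_eq_2]
  have 2: "{..2} = {0, 1, 2::nat}" by auto
  have xn: "complex_of_real x \<noteq> 0" using x by simp
  have pw: "complex_of_real x powr 1 = x" "complex_of_real x powr 2 = x^2"
    using x by (auto simp: powr_numeral)
  have "h 1 = 1" using val[of 0] xn by (simp add: 2 b ffp_def numeral_2_eq_2)
  moreover have "h 0 = of_real (x - 1/2)"
    using val[of 1] xn pw by (simp add: 2 b ffp_def numeral_2_eq_2)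
  moreover have "h (-1) = of_real (x\<^sup>2 - x + 1/6)"
    using val[of 2] xn pw by (simp add: 2 b ffp_def numeral_2_eq_2 algebra_simps)
  ultimately show ?thesis using that hol hs by blast
qed

lemma holomorphic_on_tendsto_at:
  fixes h :: "complex \<Rightarrow> complex"
  assumes "h holomorphic_on S" "open S" "a \<in> S"
  shows "(h \<longlongrightarrow> h a) (at a)"
proof -
  have "isCont h a"
    using assms continuous_on_eq_continuous_at[OF assms(2)] holomorphic_on_imp_continuous_on by blast
  then show ?thesis by (rule isContD)
qed

lemma summable_on_product_nonneg:
  fixes a b :: "nat \<Rightarrow> real"
  assumes "a summable_on UNIV" "b summable_on UNIV" "\<And>m. a m \<ge> 0" "\<And>n. b n \<ge> 0"
  shows "(\<lambda>(m, n). a m * b n) summable_on UNIV"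
proof -
  have "(\<lambda>(m, n). a m * b n) summable_on Sigma UNIV (\<lambda>_. UNIV)"
  proof (rule summable_on_SigmaI)
    show "((\<lambda>n. case (m, n) of (m, n) \<Rightarrow> a m * b n) has_sum a m * (\<Sum>\<^sub>\<infinity>n. b n)) UNIV" for m
      using has_sum_cmult_right[OF has_sum_infsum[OF assms(2)]] by simp
    show "(\<lambda>m. a m * (\<Sum>\<^sub>\<infinity>n. b n)) summable_on UNIV"
      using assms(1) by (rule summable_on_cmult_left)
  qed (use assms in auto)
  then show ?thesis by simp
qed

lemma has_sum_minus:
  fixes f g :: "'a \<Rightarrow> 'b :: real_normed_vector"
  assumes "(f has_sum a) A" "(g has_sum b) A"
  shows "((\<lambda>x. f x - g x) has_sum (a - b)) A"
  using has_sum_add[OF assms(1), of "\<lambda>x. - g x" "- b"] assms(2) by (simp add: has_sum_uminus)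

lemma has_sum_sum:
  fixes f :: "'i \<Rightarrow> 'a \<Rightarrow> 'b :: real_normed_vector"
  assumes "finite I" "\<And>i. i \<in> I \<Longrightarrow> (f i has_sum s i) A"
  shows "((\<lambda>x. \<Sum>i\<in>I. f i x) has_sum (\<Sum>i\<in>I. s i)) A"
  using assms by (induction I rule: finite_induct) (auto intro!: has_sum_add)

lemma norm_summable_slice:
  assumes "(\<lambda>mn. norm (f mn)) summable_on UNIV"
  shows "(\<lambda>n. norm (f (m, n))) summable_on UNIV"
proof -
  have "(\<lambda>mn. norm (f mn)) summable_on UNIV \<times> UNIV" using assms by simp
  from iffD1[OF Infinite_Sum.abs_summable_on_Sigma_iff this] show ?thesis by simp
qed

subsection \<open>Zeta functions of positive binary quadratic forms\<close>

locale posquad =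
  fixes A B C :: real
  assumes pos: "A > 0" "B > 0" "C > 0"
begin

definition q :: "real \<Rightarrow> real" where "q t = A + B * t + C * t\<^sup>2"

text \<open>Chosen so that \<open>lb * (1 + t)\<^sup>2\<close> is below \<open>q t\<close>
  coefficient by coefficient; this uses that the middle coefficient is positive, too. The cap at 1
  is what \<open>powr_le_dominated\<close> requires.\<close>

definition lb :: real where "lb = min 1 (min A (min (B / 2) C))"

lemma lb: "0 < lb" "lb \<le> 1" "lb \<le> A" "2 * lb \<le> B" "lb \<le> C"
  using pos by (auto simp: lb_def min_def)

lemma q_ge: "t \<ge> 0 \<Longrightarrow> lb * (1 + t)\<^sup>2 \<le> q t"
proof -
  assume t: "t \<ge> 0"
  have "lb * 1 \<le> A" "(2 * lb) * t \<le> B * t" "lb * t\<^sup>2 \<le> C * t\<^sup>2"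
    using lb t by (auto intro!: mult_right_mono)
  then show ?thesis by (simp add: q_def power2_eq_square algebra_simps)
qed

lemma q_pos: "t \<ge> 0 \<Longrightarrow> q t > 0"
  using q_ge[of t] lb by (smt (verit) mult_pos_pos zero_less_power)

lemma q_deriv: "(q has_real_derivative (B + 2 * C * t)) (at t within S)"
  unfolding q_def by (auto intro!: derivative_eq_intros)

lemma q_continuous [continuous_intros]: "continuous_on S q"
  unfolding q_def by (intro continuous_intros)

definition F :: "complex \<Rightarrow> real \<Rightarrow> complex" where
  "F s T = integral {0..T} (\<lambda>t. of_real (q t) powr (-s))"

lemma q_powr_continuous: "S \<subseteq> {0..} \<Longrightarrow> continuous_on S (\<lambda>t. complex_of_real (q t) powr (-s))"
  by (intro continuous_intros) (use q_pos in \<open>force simp: complex_nonpos_Reals_iff\<close>)+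

lemma F_deriv:
  assumes "0 \<le> a" "t \<in> {a..b}"
  shows "(F s has_vector_derivative of_real (q t) powr (-s)) (at t within {a..b})"
proof -
  have "(F s has_vector_derivative of_real (q t) powr (-s)) (at t within {0..b})"
    unfolding F_def
    by (rule integral_has_vector_derivative) (use assms in \<open>auto intro!: q_powr_continuous\<close>)
  then show ?thesis using assms by (auto intro: has_vector_derivative_within_subset)
qed

lemma F_0 [simp]: "F s 0 = 0" by (simp add: F_def)

lemma F_diff_bound:
  assumes "0 \<le> a" "a \<le> b" "e1 \<le> - Re s" "- Re s \<le> e2" "e2 \<le> 0"
  shows "norm (F s b - F s a) \<le> (lb powr e1 * (1 + a) powr (2 * e2)) * (b - a)"
proof -
  have "norm (F s b - F s a) \<le> (lb powr e1 * (1 + a) powr (2 * e2)) * norm (b - a)"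
  proof (rule vector_differentiable_bound)
    fix t assume t: "t \<in> {a..b}"
    show "(F s has_vector_derivative of_real (q t) powr (-s)) (at t within {a..b})"
      using assms t by (intro F_deriv)
    have "norm (complex_of_real (q t) powr (-s)) = q t powr (- Re s)"
      using q_pos[of t] assms t by (subst norm_of_real_powr) auto
    also have "\<dots> \<le> lb powr e1 * ((1 + a)\<^sup>2) powr e2"
    proof (rule powr_le_dominated)
      have "lb * (1 + a)\<^sup>2 \<le> lb * (1 + t)\<^sup>2"
        using assms t lb by (intro mult_left_mono power_mono) auto
      also have "\<dots> \<le> q t" using q_ge assms t by auto
      finally show "lb * (1 + a)\<^sup>2 \<le> q t" .
    qed (use assms lb in auto)
    also have "((1 + a)\<^sup>2) powr e2 = (1 + a) powr (2 * e2)"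
      using assms by (simp add: powr_powr flip: powr_numeral)
    finally show "norm (complex_of_real (q t) powr (-s)) \<le> lb powr e1 * (1 + a) powr (2 * e2)" .
  qed (use assms in auto)
  then show ?thesis using assms by simp
qed

lemma F_holomorphic: "T \<ge> 0 \<Longrightarrow> (\<lambda>s. F s T) holomorphic_on S"
proof -
  assume T: "T \<ge> 0"
  have "(\<lambda>s. integral (cbox 0 T) (\<lambda>t. of_real (q t) powr (-s))) holomorphic_on UNIV"
  proof (rule leibniz_rule_holomorphic)
    fix s t assume "t \<in> cbox 0 T"
    then have "q t > 0" using q_pos by auto
    then show "((\<lambda>s. complex_of_real (q t) powr (-s)) has_field_derivative
        - (of_real (ln (q t)) * of_real (q t) powr (-s))) (at s within UNIV)"
      by (auto intro!: derivative_eq_intros simp: powr_def Ln_of_real)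
  next
    show "(\<lambda>t. complex_of_real (q t) powr (-s)) integrable_on cbox 0 T" for s
      by (intro integrable_continuous q_powr_continuous) auto
    show "continuous_on (UNIV \<times> cbox 0 T) (\<lambda>(s, t). - (complex_of_real (ln (q t)) * of_real (q t) powr (- s)))"
      unfolding case_prod_unfold
    proof (intro continuous_intros)
      show "continuous_on (UNIV \<times> cbox 0 T) (\<lambda>x::complex \<times> real. q (snd x))"
        unfolding q_def by (intro continuous_intros)
      then show "continuous_on (UNIV \<times> cbox 0 T) (\<lambda>x::complex \<times> real. q (snd x))" .
    qed (use q_pos in \<open>force simp: complex_nonpos_Reals_iff\<close>)+
  qed auto
  then show ?thesis
    unfolding F_def by (auto intro: holomorphic_on_subset)
qed

text \<open>The improper integral of \<open>q t powr (- s)\<close> over the positive half-line.\<close>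

definition I :: "complex \<Rightarrow> complex" where
  "I s = (\<Sum>\<^sub>\<infinity>n\<in>UNIV. F s (real (Suc n)) - F s (real n))"

text \<open>The integrand decays like \<open>t\<close> to the power \<open>- 2 * Re s\<close>, which
  is where the bound 1/2 comes from. The radius \<open>r\<close> keeps this exponent below -1 on the
  whole disc.\<close>

lemma F_incr_dominated:
  assumes "Re z > 1/2"
  shows "\<exists>r>0. \<exists>M. M summable_on UNIV \<and>
    (\<forall>n\<in>UNIV. \<forall>s\<in>cball z r \<inter> {s. Re s > 1/2}. norm (F s (real (Suc n)) - F s (real n)) \<le> M n)"
proof -
  define r where "r = (Re z - 1/2) / 2"
  have r: "r > 0" using assms by (simp add: r_def)
  define M where "M n = lb powr (- Re z - r) * real (Suc n) powr (2 * (r - Re z))" for n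
  have "2 * (r - Re z) < -1" using assms unfolding r_def by argo
  then have "M summable_on UNIV"
    unfolding M_def by (intro summable_on_cmult_right summable_on_Suc_powr)
  moreover have "norm (F s (real (Suc n)) - F s (real n)) \<le> M n"
    if s: "s \<in> cball z r \<inter> {s. Re s > 1/2}" for s n
  proof -
    have re: "Re z - Re s \<le> r" "Re s - Re z \<le> r" using s by (auto intro: cball_Re_bounds)
    have "norm (F s (real (Suc n)) - F s (real n))
      \<le> (lb powr (- Re z - r) * (1 + real n) powr (2 * (r - Re z))) * (real (Suc n) - real n)"
    proof (rule F_diff_bound)
      show "- Re z - r \<le> - Re s" "- Re s \<le> r - Re z" "r - Re z \<le> 0"
        using re assms unfolding r_def by argo+
    qed auto
    then show ?thesis by (simp add: M_def add.commute)
  qed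
  ultimately show ?thesis using r by blast
qed

lemma I_holomorphic: "I holomorphic_on {s. Re s > 1/2}"
  unfolding I_def
  by (intro holomorphic_on_infsum holomorphic_intros F_holomorphic open_halfspace_Re_gt F_incr_dominated)
    auto

lemma F_tendsto_I:
  assumes s: "Re s > 1/2"
  shows "(F s \<longlongrightarrow> I s) at_top"
proof -
  obtain r M where rM: "r > 0" "M summable_on UNIV"
    "\<forall>n. \<forall>w\<in>cball s r \<inter> {s. Re s > 1/2}. norm (F w (real (Suc n)) - F w (real n)) \<le> M n"
    using F_incr_dominated[OF s] by auto
  have "(\<lambda>n. norm (F s (real (Suc n)) - F s (real n))) summable_on UNIV"
    by (rule summable_on_comparison_test[OF rM(2)]) (use rM s in auto)
  then have "(\<lambda>n. F s (real (Suc n)) - F s (real n)) summable_on UNIV"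
    by (rule abs_summable_summable)
  then have "(\<lambda>n. F s (real (Suc n)) - F s (real n)) sums I s"
    unfolding I_def by (intro has_sum_imp_sums has_sum_infsum)
  then have seq: "(\<lambda>n. F s (real n)) \<longlonglongrightarrow> I s"
    by (simp add: sums_def sum_lessThan_telescope[of "\<lambda>n. F s (real n)"] del: of_nat_Suc)
  have "filterlim (\<lambda>T::real. nat \<lfloor>T\<rfloor>) sequentially at_top"
    by (rule filterlim_compose[OF filterlim_nat_sequentially filterlim_floor_sequentially])
  from filterlim_compose[OF seq this]
  have 1: "((\<lambda>T::real. F s (real (nat \<lfloor>T\<rfloor>))) \<longlongrightarrow> I s) at_top" .
  \<comment> \<open>The limit along the integers extends to real \<open>T\<close>: the remaining
    interval has length at most 1 and the integrand on it tends to 0.\<close>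
  have 2: "((\<lambda>T::real. F s T - F s (real (nat \<lfloor>T\<rfloor>))) \<longlongrightarrow> 0) at_top"
  proof (rule Lim_null_comparison)
    show "\<forall>\<^sub>F T in at_top. norm (F s T - F s (real (nat \<lfloor>T\<rfloor>))) \<le> lb powr (- Re s) * T powr (2 * (- Re s))"
      using eventually_ge_at_top[of 1]
    proof eventually_elim
      case (elim T)
      define a where "a = real (nat \<lfloor>T\<rfloor>)"
      have a: "0 \<le> a" "a \<le> T" "T \<le> 1 + a" using elim by (auto simp: a_def) linarith+
      have "norm (F s T - F s a) \<le> (lb powr (- Re s) * (1 + a) powr (2 * (- Re s))) * (T - a)"
        by (rule F_diff_bound) (use a s in auto)
      also have "\<dots> \<le> (lb powr (- Re s) * (1 + a) powr (2 * (- Re s))) * 1"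
        using a by (intro mult_left_mono) auto
      also have "\<dots> \<le> lb powr (- Re s) * T powr (2 * (- Re s)) * 1"
        using a s elim by (intro mult_right_mono mult_left_mono powr_mono2') auto
      finally show ?case by (simp add: a_def)
    qed
    show "((\<lambda>T. lb powr (- Re s) * T powr (2 * (- Re s))) \<longlongrightarrow> 0) at_top"
      using s by real_asymp
  qed
  from tendsto_add[OF 1 2] show ?thesis by simp
qed

text \<open>Integrates the derivative of \<open>q' t * q t powr (- s)\<close>, using
  \<open>q'\<^sup>2 = 4 C q + (B\<^sup>2 - 4 A C)\<close>. In the limit this continues \<open>I\<close> to the left.\<close>

lemma F_recursion:
  fixes s :: complex
  assumes T: "T \<ge> 0"
  shows "of_real (B + 2 * C * T) * of_real (q T) powr (-s) =
    2 * C * (1 - 2 * s) * F s T - s * (B\<^sup>2 - 4 * A * C) * F (s + 1) T + B * of_real A powr (-s)"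
proof -
  define G where "G t = of_real (B + 2 * C * t) * of_real (q t) powr (-s)
     - (2 * C * (1 - 2 * s) * F s t - s * (B\<^sup>2 - 4 * A * C) * F (s + 1) t)" for t
  have "(G has_vector_derivative 0) (at t within {0..T})" if t: "t \<in> {0..T}" for t
  proof -
    have qt: "q t > 0" using t q_pos by auto
    have l: "((\<lambda>t. complex_of_real (B + 2 * C * t)) has_vector_derivative of_real (2 * C)) (at t within {0..T})"
      by (intro has_vector_derivative_of_real) (auto intro!: derivative_eq_intros simp flip: has_real_derivative_iff_has_vector_derivative)
    have p: "((\<lambda>t. complex_of_real (q t) powr (-s)) has_vector_derivative
       (-s) * of_real (B + 2 * C * t) * of_real (q t) powr (-s - 1)) (at t within {0..T})"
      by (intro has_vector_derivative_of_real_powr q_deriv qt)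
    have e: "complex_of_real (q t) powr (-s) = of_real (q t) * of_real (q t) powr (-s - 1)"
      using qt powr_add[of "complex_of_real (q t)" 1 "-s-1"] by simp
    have e2: "complex_of_real (q t) powr (-(s + 1)) = of_real (q t) powr (-s - 1)" by simp
    have sq: "complex_of_real (B + 2 * C * t)^2 = 4 * C * of_real (q t) + (B\<^sup>2 - 4 * A * C)"
      by (simp add: q_def power2_eq_square algebra_simps)
    have "(G has_vector_derivative
       (of_real (B + 2 * C * t) * ((-s) * of_real (B + 2 * C * t) * of_real (q t) powr (-s - 1))
         + of_real (2 * C) * of_real (q t) powr (-s))
       - (2 * C * (1 - 2 * s) * of_real (q t) powr (-s)
         - s * (B\<^sup>2 - 4 * A * C) * of_real (q t) powr (-(s + 1)))) (at t within {0..T})"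
      unfolding G_def using t
      by (intro has_vector_derivative_diff has_vector_derivative_mult[OF l p]
          has_vector_derivative_mult_right F_deriv) auto
    moreover have "(of_real (B + 2 * C * t) * ((-s) * of_real (B + 2 * C * t) * of_real (q t) powr (-s - 1))
         + of_real (2 * C) * of_real (q t) powr (-s))
       - (2 * C * (1 - 2 * s) * of_real (q t) powr (-s)
         - s * (B\<^sup>2 - 4 * A * C) * of_real (q t) powr (-(s + 1)))
      = (- s * (complex_of_real (B + 2 * C * t)^2) + 4 * C * s * of_real (q t)
          + s * (B\<^sup>2 - 4 * A * C)) * of_real (q t) powr (-s - 1)"
      unfolding e2 e by (simp add: power2_eq_square algebra_simps)
    ultimately show ?thesis unfolding sq by (simp add: algebra_simps)
  qed
  then have "norm (G T - G 0) \<le> 0 * norm (T - 0)"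
    by (intro vector_differentiable_bound[where S = "{0..T}" and f' = "\<lambda>_. 0"]) (use T in auto)
  then have "G T = G 0" by simp
  then show ?thesis by (simp add: G_def q_def algebra_simps)
qed

text \<open>The left side of \<open>F_recursion\<close> grows like \<open>T\<close> to the power
  \<open>1 - 2 * s\<close>, so it vanishes in the limit for \<open>Re s > 1/2\<close>. The identity
  left over expresses \<open>I s\<close> by \<open>I (s + 1)\<close>.\<close>

lemma I_recursion:
  fixes s :: complex
  assumes s: "Re s > 1/2"
  shows "2 * C * (1 - 2 * s) * I s = s * (B\<^sup>2 - 4 * A * C) * I (s + 1) - B * of_real A powr (-s)"
proof -
  have "((\<lambda>T. 2 * C * (1 - 2 * s) * F s T - s * (B\<^sup>2 - 4 * A * C) * F (s + 1) T + B * of_real A powr (-s))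
      \<longlongrightarrow> 2 * C * (1 - 2 * s) * I s - s * (B\<^sup>2 - 4 * A * C) * I (s + 1) + B * of_real A powr (-s)) at_top"
    using s by (intro tendsto_intros F_tendsto_I) auto
  moreover have "((\<lambda>T. 2 * C * (1 - 2 * s) * F s T - s * (B\<^sup>2 - 4 * A * C) * F (s + 1) T + B * of_real A powr (-s))
      \<longlongrightarrow> 0) at_top"
  proof (rule Lim_null_comparison)
    show "\<forall>\<^sub>F T in at_top. norm (2 * C * (1 - 2 * s) * F s T - s * (B\<^sup>2 - 4 * A * C) * F (s + 1) T + B * of_real A powr (-s))
       \<le> (B + 2 * C * T) * (A + B * T + C * T\<^sup>2) powr (- Re s)"
      using eventually_ge_at_top[of 0]
    proof eventually_elim
      case (elim T)
      have "B + 2 * C * T \<ge> 0" using elim pos by simp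
      then show ?case
        using q_pos[OF elim] unfolding F_recursion[OF elim, symmetric] norm_mult
        by (subst norm_of_real_powr) (auto simp: q_def simp del: of_real_add of_real_mult)
    qed
    show "((\<lambda>T. (B + 2 * C * T) * (A + B * T + C * T\<^sup>2) powr (- Re s)) \<longlongrightarrow> 0) at_top"
      using s pos by real_asymp
  qed
  ultimately have "2 * C * (1 - 2 * s) * I s - s * (B\<^sup>2 - 4 * A * C) * I (s + 1) + B * of_real A powr (-s) = 0"
    using tendsto_unique trivial_limit_at_top_linorder by blast
  moreover have "a - b + c = 0 \<Longrightarrow> a = b - c" for a b c :: complex
    by (drule arg_cong[of _ _ "\<lambda>x. x + (b - c)"]) simp
  ultimately show ?thesis by blast
qed

text \<open>Every use of the recursion moves the half-plane to the left by 1; dividing by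
  \<open>1 - 2 * s\<close> only introduces a pole. At 0 the factor \<open>s\<close> kills the term
  with \<open>I (s + 1)\<close>, since \<open>I\<close> is finite at 1, and
  \<open>- B / (2 * C)\<close> remains.\<close>

lemma I_continuation:
  obtains J where "J meromorphic_on {s. Re s > - real R}"
    "\<And>s. Re s > 1/2 \<Longrightarrow> J s = I s" "(J \<longlongrightarrow> - of_real (B / (2 * C))) (at 0)"
proof -
  have "\<exists>J. J meromorphic_on {s. Re s > 1/2 - real R} \<and> (\<forall>s. Re s > 1/2 \<longrightarrow> J s = I s)
     \<and> (R \<ge> 1 \<longrightarrow> (J \<longlongrightarrow> - of_real (B / (2 * C))) (at 0))" for R
  proof (induction R)
    case 0
    have "I meromorphic_on {s. Re s > 1/2}"
      using I_holomorphic analytic_on_open[OF open_halfspace_Re_gt] analytic_on_imp_meromorphic_on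
      by blast
    then show ?case by auto
  next
    case (Suc R)
    then obtain J where J: "J meromorphic_on {s. Re s > 1/2 - real R}" "\<And>s. Re s > 1/2 \<Longrightarrow> J s = I s"
      by blast
    define J' where "J' s = (s * (B\<^sup>2 - 4 * A * C) * J (s + 1) - B * of_real A powr (-s)) / (2 * C * (1 - 2 * s))" for s :: complex
    have "(\<lambda>s. J (s + 1)) meromorphic_on {s. Re s > 1/2 - real (Suc R)}"
      by (rule meromorphic_on_compose[OF J(1)]) (auto intro!: analytic_intros)
    moreover have "(\<lambda>s. of_real A powr (-s)) meromorphic_on {s. Re s > 1/2 - real (Suc R)}"
      using pos by (intro analytic_on_imp_meromorphic_on analytic_intros) auto
    ultimately have "J' meromorphic_on {s. Re s > 1/2 - real (Suc R)}"
      unfolding J'_def by (intro meromorphic_intros)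
    moreover have "J' s = I s" if "Re s > 1/2" for s
    proof -
      have "1 - 2 * s \<noteq> 0" using that by (auto simp: complex_eq_iff)
      then have nz: "2 * C * (1 - 2 * s) \<noteq> 0" using pos by simp
      have "J (s + 1) = I (s + 1)" using that by (intro J(2)) auto
      then have "J' s = (2 * C * (1 - 2 * s) * I s) / (2 * C * (1 - 2 * s))"
        unfolding J'_def I_recursion[OF that] by simp
      then show ?thesis using nz by simp
    qed
    moreover have "(J' \<longlongrightarrow> - of_real (B / (2 * C))) (at 0)"
    proof -
      have "\<forall>x\<in>{s. Re s > 1/2}. isCont I x"
        using holomorphic_on_imp_continuous_on[OF I_holomorphic]
          continuous_on_eq_continuous_at[OF open_halfspace_Re_gt] by blast
      from bspec[OF this, of 1] have "isCont I 1" by simp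
      moreover have "((\<lambda>s::complex. s + 1) \<longlongrightarrow> 1) (at 0)" by (auto intro!: tendsto_eq_intros)
      ultimately have "((\<lambda>s. I (s + 1)) \<longlongrightarrow> I 1) (at 0)"
        by (rule isCont_tendsto_compose)
      moreover have "\<forall>\<^sub>F s in at 0. I (s + 1) = J (s + 1)"
      proof -
        have "\<forall>\<^sub>F s in at 0. s \<in> {s. Re s > (-1/2::real)}"
          by (rule eventually_at_in_open') (auto simp: open_halfspace_Re_gt)
        then show ?thesis by eventually_elim (simp add: J(2))
      qed
      ultimately have lJ: "((\<lambda>s. J (s + 1)) \<longlongrightarrow> I 1) (at 0)"
        by (rule Lim_transform_eventually)
      have lA: "((\<lambda>s. complex_of_real A powr (-s)) \<longlongrightarrow> of_real A powr (-(0::complex))) (at 0)"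
        by (rule isContD, intro continuous_intros) (use pos in auto)
      have "(J' \<longlongrightarrow> ((0::complex) * (B\<^sup>2 - 4 * A * C) * I 1 - B * of_real A powr (-(0::complex))) / (2 * C * (1 - 2 * (0::complex)))) (at 0)"
        unfolding J'_def
        by (rule tendsto_divide[OF tendsto_diff[OF
              tendsto_mult[OF tendsto_mult[OF tendsto_ident_at tendsto_const] lJ]
              tendsto_mult[OF tendsto_const lA]]
            tendsto_mult[OF tendsto_const tendsto_diff[OF tendsto_const
              tendsto_mult[OF tendsto_const tendsto_ident_at]]]]) (use pos in auto)
      then show ?thesis using pos by simp
    qed
    ultimately show ?case by blast
  qed
  from this[of "Suc R"] obtain J where J: "J meromorphic_on {s. Re s > 1/2 - real (Suc R)}"
    "\<And>s. Re s > 1/2 \<Longrightarrow> J s = I s" "(J \<longlongrightarrow> - of_real (B / (2 * C))) (at 0)"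
    by auto
  have "J meromorphic_on {s. Re s > - real R}"
    by (rule meromorphic_on_subset[OF J(1)]) auto
  then show ?thesis using that J by blast
qed

section \<open>Derivatives of powers of the form and their growth\<close>

definition qc :: "complex poly" where "qc = [:of_real A, of_real B, of_real C:]"

lemma poly_qc: "poly qc (of_real t) = of_real (q t)"
  by (simp add: qc_def q_def power2_eq_square algebra_simps)

lemma poly_pderiv_qc: "poly (pderiv qc) (of_real t) = of_real (B + 2 * C * t)"
  by (simp add: qc_def pderiv_pCons algebra_simps)

text \<open>\<open>P k s\<close> is chosen such that the \<open>k\<close>-th derivative of \<open>q t powr (- s)\<close> is
  \<open>P k s * q t powr (- s - k)\<close>.\<close>

primrec P :: "nat \<Rightarrow> complex \<Rightarrow> complex poly" where
  "P 0 s = 1"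
| "P (Suc k) s = qc * pderiv (P k s) - smult (s + of_nat k) (pderiv qc * P k s)"

lemma coeff_P_holomorphic: "(\<lambda>s. coeff (P k s) i) holomorphic_on S"
proof (induction k arbitrary: i)
  case (Suc k)
  then show ?case
    by (auto simp: coeff_mult coeff_pderiv intro!: holomorphic_intros)
qed auto

lemma degree_P: "degree (P k s) \<le> k"
proof (induction k)
  case (Suc k)
  have qc: "degree qc \<le> 2" "degree (pderiv qc) \<le> 1"
    by (auto simp: qc_def degree_pderiv)
  have "degree (qc * pderiv (P k s)) \<le> Suc k"
  proof (cases "k = 0")
    case True
    then show ?thesis by simp
  next
    case False
    have "degree (qc * pderiv (P k s)) \<le> degree qc + degree (pderiv (P k s))" by (rule degree_mult_le)
    also have "\<dots> \<le> 2 + (k - 1)" using Suc qc by (auto simp: degree_pderiv)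
    finally show ?thesis using False by simp
  qed
  moreover have "degree (smult (s + of_nat k) (pderiv qc * P k s)) \<le> Suc k"
  proof -
    have "degree (pderiv qc * P k s) \<le> 1 + k"
      using degree_mult_le[of "pderiv qc" "P k s"] Suc qc by linarith
    from order_trans[OF degree_smult_le this] show ?thesis by simp
  qed
  ultimately show ?case by (simp add: degree_diff_le)
qed auto

text \<open>At \<open>s = 0\<close> the function being differentiated is constant.\<close>

lemma P_at_0: "P (Suc k) 0 = 0"
  by (induction k) auto

text \<open>The factor \<open>s\<close> displayed here is the one that cancels the pole of the
  Hurwitz zeta function at \<open>2 * s + 1 = 1\<close>.\<close>

lemma coeff_P_1: "coeff (P (Suc 0) s) 0 = - s * of_real B"
  by (simp add: qc_def pderiv_pCons)

definition Pn :: "nat \<Rightarrow> complex \<Rightarrow> real" where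
  "Pn k s = (\<Sum>i\<le>k. norm (coeff (P k s) i))"

lemma Pn_nonneg: "Pn k s \<ge> 0"
  unfolding Pn_def by (intro sum_nonneg) auto

lemma norm_poly_P_le:
  assumes "t \<ge> 0"
  shows "norm (poly (P k s) (of_real t)) \<le> Pn k s * (1 + t) ^ k"
proof -
  have "poly (P k s) (of_real t) = (\<Sum>i\<le>k. coeff (P k s) i * of_real t ^ i)"
    unfolding poly_altdef using degree_P[of k s]
    by (intro sum.mono_neutral_left) (auto simp: coeff_eq_0)
  also have "norm \<dots> \<le> (\<Sum>i\<le>k. norm (coeff (P k s) i) * (1 + t) ^ k)"
  proof (intro sum_norm_le)
    fix i assume i: "i \<in> {..k}"
    have "t ^ i \<le> (1 + t) ^ i" using assms by (intro power_mono) auto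
    also have "\<dots> \<le> (1 + t) ^ k" using i assms by (intro power_increasing) auto
    finally show "norm (coeff (P k s) i * of_real t ^ i) \<le> norm (coeff (P k s) i) * (1 + t) ^ k"
      using assms by (simp add: norm_mult norm_power mult_left_mono)
  qed
  finally show ?thesis by (simp add: Pn_def sum_distrib_right)
qed

definition g :: "nat \<Rightarrow> complex \<Rightarrow> real \<Rightarrow> complex" where
  "g k s t = poly (P k s) (of_real t) * of_real (q t) powr (-s - of_nat k)"

lemma g_deriv:
  assumes t: "t \<ge> 0"
  shows "(g k s has_vector_derivative g (Suc k) s t) (at t within S)"
proof -
  have qt: "q t > 0" using q_pos[OF t] .
  have p: "((\<lambda>t. poly (P k s) (complex_of_real t)) has_vector_derivative
      poly (pderiv (P k s)) (of_real t)) (at t within S)"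
    by (intro has_vector_derivative_real_field poly_DERIV)
  have r: "((\<lambda>t. complex_of_real (q t) powr (-s - of_nat k)) has_vector_derivative
       (-s - of_nat k) * of_real (B + 2 * C * t) * of_real (q t) powr (-s - of_nat k - 1)) (at t within S)"
    by (intro has_vector_derivative_of_real_powr q_deriv qt)
  have e: "complex_of_real (q t) powr (-s - of_nat k) = of_real (q t) * of_real (q t) powr (-s - of_nat k - 1)"
    using qt powr_add[of "complex_of_real (q t)" 1 "-s - of_nat k - 1"] by simp
  have e2: "- s - of_nat (Suc k) = -s - of_nat k - 1" by simp
  have "g (Suc k) s t = poly (P k s) (of_real t) *
     ((-s - of_nat k) * of_real (B + 2 * C * t) * of_real (q t) powr (-s - of_nat k - 1))
      + poly (pderiv (P k s)) (of_real t) * of_real (q t) powr (-s - of_nat k)"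
    unfolding g_def e e2 by (simp add: poly_qc poly_pderiv_qc algebra_simps del: of_real_add of_real_mult)
  then show ?thesis
    unfolding g_def[of k] using has_vector_derivative_mult[OF p r] by simp
qed

text \<open>By homogeneity \<open>\<phi> X s (Suc k)\<close> is the \<open>k\<close>-th derivative of \<open>Y \<mapsto> Qf X Y powr (- s)\<close>, and
  \<open>\<phi> X s 0\<close> is an antiderivative of that function.\<close>

definition \<phi> :: "real \<Rightarrow> complex \<Rightarrow> nat \<Rightarrow> real \<Rightarrow> complex" where
  "\<phi> X s k Y = (case k of 0 \<Rightarrow> of_real X powr (1 - 2 * s) * F s (Y / X)
     | Suc j \<Rightarrow> of_real X powr (- 2 * s - of_nat j) * g j s (Y / X))"

lemma \<phi>_deriv:
  assumes X: "X > 0" and "0 \<le> a" "Y \<in> {a..b}"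
  shows "(\<phi> X s k has_vector_derivative \<phi> X s (Suc k) Y) (at Y within {a..b})"
proof -
  have im: "(\<lambda>Y. Y / X) ` {a..b} \<subseteq> {a / X..b / X}" using X by (auto simp: divide_right_mono)
  have l: "((\<lambda>Y. Y / X) has_vector_derivative 1 / X) (at Y within {a..b})"
    using X by (auto intro!: derivative_eq_intros simp flip: has_real_derivative_iff_has_vector_derivative)
  have YX: "Y / X \<in> {a / X..b / X}" using assms by (auto simp: divide_right_mono)
  have aX: "a / X \<ge> 0" using assms by auto
  have pw: "complex_of_real X powr (u - 1) = of_real X powr u / of_real X" for u
    using X by (simp add: powr_diff)
  show ?thesis
  proof (cases k)
    case 0
    have "(F s has_vector_derivative of_real (q (Y / X)) powr (-s)) (at (Y / X) within (\<lambda>Y. Y / X) ` {a..b})"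
      using has_vector_derivative_within_subset[OF F_deriv[OF aX YX] im] .
    from vector_diff_chain_within[OF l this]
    have "((\<lambda>Y. of_real X powr (1 - 2 * s) * F s (Y / X)) has_vector_derivative
       of_real X powr (1 - 2 * s) * ((1 / X) *\<^sub>R (of_real (q (Y / X)) powr (-s)))) (at Y within {a..b})"
      unfolding o_def by (rule has_vector_derivative_mult_right)
    moreover have "of_real X powr (1 - 2 * s) * ((1 / X) *\<^sub>R (of_real (q (Y / X)) powr (-s))) = \<phi> X s (Suc 0) Y"
      using pw[of "1 - 2 * s"] by (simp add: \<phi>_def g_def scaleR_conv_of_real)
    ultimately show ?thesis using 0 by (simp add: \<phi>_def[of _ _ 0, abs_def])
  next
    case (Suc j)
    have "Y / X \<ge> 0" using assms by auto
    from vector_diff_chain_within[OF l g_deriv[OF this]]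
    have "((\<lambda>Y. of_real X powr (- 2 * s - of_nat j) * g j s (Y / X)) has_vector_derivative
       of_real X powr (- 2 * s - of_nat j) * ((1 / X) *\<^sub>R g (Suc j) s (Y / X))) (at Y within {a..b})"
      unfolding o_def by (rule has_vector_derivative_mult_right)
    moreover have "of_real X powr (- 2 * s - of_nat j) * ((1 / X) *\<^sub>R g (Suc j) s (Y / X)) = \<phi> X s (Suc (Suc j)) Y"
      using pw[of "- 2 * s - of_nat j"] by (simp add: \<phi>_def scaleR_conv_of_real diff_diff_eq add.commute)
    ultimately show ?thesis using Suc by (simp add: \<phi>_def[of _ _ "Suc j", abs_def])
  qed
qed

text \<open>By homogeneity only \<open>t = Y / X\<close> has to be considered. The polynomial
  contributes at most \<open>(1 + t) ^ k\<close> and the power of \<open>q t\<close> the exponent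
  \<open>- 2 * Re s - 2 * k\<close>; together they give the homogeneous degree
  \<open>- 2 * Re s - k\<close>.\<close>

lemma norm_\<phi>_le:
  assumes X: "X > 0" and Y: "Y \<ge> 0" and s: "Re s + real k \<ge> 0"
  shows "norm (\<phi> X s (Suc k) Y) \<le> Pn k s * lb powr (- Re s - real k) * (X + Y) powr (- 2 * Re s - real k)"
proof -
  define t where "t = Y / X"
  have t: "t \<ge> 0" using X Y by (simp add: t_def)
  have XY: "X + Y = X * (1 + t)" using X by (simp add: t_def algebra_simps)
  have re: "Re (- 2 * s - of_nat k) = - 2 * Re s - real k" "Re (- s - of_nat k) = - Re s - real k" by auto
  have "norm (\<phi> X s (Suc k) Y) = X powr (- 2 * Re s - real k) * (norm (poly (P k s) (of_real t)) * q t powr (- Re s - real k))"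
    unfolding \<phi>_def g_def t_def[symmetric] nat.case norm_mult
    by (simp only: norm_of_real_powr[OF X] norm_of_real_powr[OF q_pos[OF t]] re)
  also have "\<dots> \<le> X powr (- 2 * Re s - real k) * ((Pn k s * (1 + t) ^ k) * (lb powr (- Re s - real k) * ((1 + t)\<^sup>2) powr (- Re s - real k)))"
  proof (intro mult_left_mono mult_mono norm_poly_P_le t)
    show "q t powr (- Re s - real k) \<le> lb powr (- Re s - real k) * ((1 + t)\<^sup>2) powr (- Re s - real k)"
      by (rule powr_le_dominated) (use lb q_ge[OF t] t s in auto)
  qed (use t Pn_nonneg in auto)
  also have "((1 + t)\<^sup>2) powr (- Re s - real k) = (1 + t) powr (- 2 * Re s - 2 * real k)"
    using t by (simp add: powr_powr algebra_simps flip: powr_numeral)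
  also have "X powr (- 2 * Re s - real k) * ((Pn k s * (1 + t) ^ k) * (lb powr (- Re s - real k) * (1 + t) powr (- 2 * Re s - 2 * real k)))
     = Pn k s * lb powr (- Re s - real k) * (X powr (- 2 * Re s - real k) * ((1 + t) powr real k * (1 + t) powr (- 2 * Re s - 2 * real k)))"
    using t by (simp add: powr_realpow mult_ac)
  also have "(1 + t) powr real k * (1 + t) powr (- 2 * Re s - 2 * real k) = (1 + t) powr (- 2 * Re s - real k)"
  proof -
    have "real k + (- 2 * Re s - 2 * real k) = - 2 * Re s - real k" by simp
    then show ?thesis by (simp only: powr_add[symmetric])
  qed
  also have "X powr (- 2 * Re s - real k) * (1 + t) powr (- 2 * Re s - real k) = (X + Y) powr (- 2 * Re s - real k)"
    unfolding XY using X t by (simp add: powr_mult)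
  finally show ?thesis .
qed

definition Qf :: "real \<Rightarrow> real \<Rightarrow> real" where
  "Qf X Y = A * X\<^sup>2 + B * X * Y + C * Y\<^sup>2"

lemma \<phi>_1: 
  assumes "X > 0" "Y \<ge> 0"
  shows "\<phi> X s (Suc 0) Y = of_real (Qf X Y) powr (-s)"
proof -
  have q: "q (Y / X) > 0" using assms q_pos by simp
  have e: "Qf X Y = X powr 2 * q (Y / X)"
    using assms by (simp add: Qf_def q_def field_simps power2_eq_square powr_numeral)
  have "complex_of_real (X powr 2 * q (Y / X)) powr (-s) = of_real (X powr 2) powr (-s) * of_real (q (Y / X)) powr (-s)"
    using q assms by (simp add: powr_times_real)
  also have "complex_of_real (X powr 2) powr (-s) = of_real X powr (- 2 * s)"
    using assms by (simp add: powr_def Ln_of_real ln_powr mult_ac)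
  finally show ?thesis unfolding e by (simp add: \<phi>_def g_def)
qed

lemma \<phi>_holomorphic: "X > 0 \<Longrightarrow> Y \<ge> 0 \<Longrightarrow> (\<lambda>s. \<phi> X s k Y) holomorphic_on S"
proof -
  assume *: "X > 0" "Y \<ge> 0"
  have q: "q (Y / X) > 0" using * q_pos by simp
  have "(\<lambda>s. poly (P j s) z) holomorphic_on S" for j z
  proof -
    have "(\<lambda>s. \<Sum>i\<le>j. coeff (P j s) i * z ^ i) holomorphic_on S"
      by (intro holomorphic_intros coeff_P_holomorphic)
    moreover have "poly (P j s) z = (\<Sum>i\<le>j. coeff (P j s) i * z ^ i)" for s
      unfolding poly_altdef using degree_P[of j s]
      by (intro sum.mono_neutral_left) (auto simp: coeff_eq_0)
    ultimately show ?thesis by simp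
  qed
  then show ?thesis
    unfolding \<phi>_def g_def using * q
    by (cases k) (auto intro!: holomorphic_intros F_holomorphic)
qed

text \<open>The square of \<open>m + x + n\<close> is at least
  \<open>x\<^sup>2 * (m + 1) * (n + 1)\<close>, so a double series is dominated by a product of two
  single ones.\<close>

lemma pair_dominated:
  fixes x e e1 e2 :: real
  assumes "0 < x" "x \<le> 1" "e1 \<le> e" "e \<le> e2" "e2 \<le> 0"
  shows "(real m + x + real n) powr (2 * e) \<le> (x\<^sup>2) powr e1 * (real (Suc m) powr e2 * real (Suc n) powr e2)"
proof -
  have "(real m + x + real n) powr (2 * e) = ((real m + x + real n)\<^sup>2) powr e"
    using assms by (simp add: powr_powr flip: powr_numeral)
  also have "\<dots> \<le> (x\<^sup>2) powr e1 * (real (Suc m) * real (Suc n)) powr e2"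
  proof (rule powr_le_dominated)
    have "real (Suc m) * real (Suc n) \<le> (real m + 1 + real n)\<^sup>2"
      by (simp add: power2_eq_square algebra_simps)
    then have "x\<^sup>2 * (real (Suc m) * real (Suc n)) \<le> x\<^sup>2 * (real m + 1 + real n)\<^sup>2"
      by (intro mult_left_mono) auto
    also have "\<dots> = (x * (real m + 1 + real n))\<^sup>2" by (simp add: power_mult_distrib)
    also have "\<dots> \<le> (real m + x + real n)\<^sup>2"
    proof (rule power_mono)
      have "x * (real m + real n) \<le> 1 * (real m + real n)" using assms by (intro mult_right_mono) auto
      then show "x * (real m + 1 + real n) \<le> real m + x + real n" by (simp add: algebra_simps)
    qed (use assms in auto)
    finally show "x\<^sup>2 * (real (Suc m) * real (Suc n)) \<le> (real m + x + real n)\<^sup>2" .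
    show "1 \<le> real (Suc m) * real (Suc n)" by (simp add: algebra_simps)
  qed (use assms in \<open>auto simp: power_le_one\<close>)
  also have "(real (Suc m) * real (Suc n)) powr e2 = real (Suc m) powr e2 * real (Suc n) powr e2"
    by (simp add: powr_mult del: of_nat_Suc)
  finally show ?thesis .
qed

section \<open>Summation over the points of a cone\<close>

definition EM_error :: "real \<Rightarrow> real \<Rightarrow> nat \<Rightarrow> complex \<Rightarrow> nat \<times> nat \<Rightarrow> complex" where
  "EM_error x y K s mn = (case mn of (m, n) \<Rightarrow> \<phi> (real m + x) s 1 (real n + y)
     - (\<Sum>k\<le>K. of_real (poly (bernp k) y) * (\<phi> (real m + x) s k (real n + 1) - \<phi> (real m + x) s k (real n))))"

text \<open>The error is bounded by the derivative of order \<open>K + 1\<close> of the summand,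
  which decays with exponent \<open>2 * Re s + K + 1\<close> in \<open>m + n\<close>. This exceeds
  2, as summability over pairs requires, exactly on the half-plane in the assumption.\<close>

lemma norm_EM_error_le:
  assumes x: "0 < x" and y: "0 \<le> y" "y \<le> 1" and s: "Re s > (1 - real K) / 2"
  shows "norm (EM_error x y K s (m, n)) \<le>
    Pn (Suc K) s * lb powr (- Re s - real (Suc K)) * (real m + x + real n) powr (- 2 * Re s - real (Suc K))"
  unfolding EM_error_def prod.case
proof (rule euler_maclaurin)
  have X: "real m + x > 0" using x by simp
  have s': "Re s + real (Suc K) \<ge> 0" "- 2 * Re s - real (Suc K) \<le> 0" using s by (auto simp: field_simps)
  fix Y assume Y: "Y \<in> {real n..real n + 1}"
  have "norm (\<phi> (real m + x) s (K + 2) Y) \<le>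
     Pn (Suc K) s * lb powr (- Re s - real (Suc K)) * (real m + x + Y) powr (- 2 * Re s - real (Suc K))"
    using norm_\<phi>_le[OF X _ s'(1), of Y] Y by (simp add: numeral_2_eq_2)
  also have "\<dots> \<le> Pn (Suc K) s * lb powr (- Re s - real (Suc K)) * (real m + x + real n) powr (- 2 * Re s - real (Suc K))"
    using X Y s' Pn_nonneg[of "Suc K" s] by (intro mult_left_mono powr_mono2' mult_nonneg_nonneg) auto
  finally show "norm (\<phi> (real m + x) s (K + 2) Y) \<le> Pn (Suc K) s * lb powr (- Re s - real (Suc K)) * (real m + x + real n) powr (- 2 * Re s - real (Suc K))" .
qed (use x y in \<open>auto intro!: \<phi>_deriv\<close>)

lemma EM_error_dominated:
  assumes x: "0 < x" "x \<le> 1" and y: "0 \<le> y" "y \<le> 1" and z: "Re z > (1 - real K) / 2"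
  shows "\<exists>r>0. \<exists>M. M summable_on UNIV \<and>
    (\<forall>mn\<in>UNIV. \<forall>s\<in>cball z r \<inter> {s. Re s > (1 - real K) / 2}. norm (EM_error x y K s mn) \<le> M mn)"
proof -
  define r where "r = (Re z - (1 - real K) / 2) / 2"
  have r: "r > 0" using z by (simp add: r_def)
  have "\<exists>Bd. \<forall>s\<in>cball z r. Pn (Suc K) s \<le> Bd"
  proof -
    have "continuous_on (cball z r) (Pn (Suc K))"
      unfolding Pn_def using coeff_P_holomorphic
      by (intro continuous_intros) (auto intro: holomorphic_on_imp_continuous_on simp del: P.simps)
    then have "bounded (Pn (Suc K) ` cball z r)"
      by (intro compact_imp_bounded compact_continuous_image) auto
    then show ?thesis unfolding bounded_iff by (metis abs_le_D1 imageI real_norm_def)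
  qed
  then obtain Bd where Bd: "\<And>s. s \<in> cball z r \<Longrightarrow> Pn (Suc K) s \<le> Bd" by blast
  have Bd0: "Bd \<ge> 0" using Bd[of z] Pn_nonneg[of "Suc K" z] r by auto
  define e1 where "e1 = - (Re z + r) - real (Suc K) / 2"
  define e2 where "e2 = - (Re z - r) - real (Suc K) / 2"
  define L where "L = lb powr (- (Re z + r) - real (Suc K))"
  define M where "M = (\<lambda>(m, n). Bd * L * ((x\<^sup>2) powr e1 * (real (Suc m) powr e2 * real (Suc n) powr e2)))"
  have e2: "e2 < -1" using z by (simp add: e2_def r_def field_simps)
  have "(\<lambda>(m, n). real (Suc m) powr e2 * real (Suc n) powr e2) summable_on UNIV"
    by (intro summable_on_product_nonneg summable_on_Suc_powr e2) auto
  then have "(\<lambda>mn. (Bd * L * (x\<^sup>2) powr e1) * (case mn of (m, n) \<Rightarrow> real (Suc m) powr e2 * real (Suc n) powr e2)) summable_on UNIV"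
    by (rule summable_on_cmult_right)
  then have "M summable_on UNIV"
    by (simp add: M_def case_prod_unfold mult_ac)
  moreover have "norm (EM_error x y K s (m, n)) \<le> M (m, n)"
    if s: "s \<in> cball z r \<inter> {s. Re s > (1 - real K) / 2}" for s m n
  proof -
    have re: "Re z - Re s \<le> r" "Re s - Re z \<le> r" using s by (auto intro: cball_Re_bounds)
    have "norm (EM_error x y K s (m, n)) \<le>
      Pn (Suc K) s * lb powr (- Re s - real (Suc K)) * (real m + x + real n) powr (2 * (- Re s - real (Suc K) / 2))"
    proof -
      have e: "2 * (- Re s - real (Suc K) / 2) = - 2 * Re s - real (Suc K)" by (simp add: field_simps)
      show ?thesis unfolding e by (rule norm_EM_error_le) (use x y s in auto)
    qed
    also have "\<dots> \<le> Bd * L * ((x\<^sup>2) powr e1 * (real (Suc m) powr e2 * real (Suc n) powr e2))"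
    proof (intro mult_mono)
      show "Pn (Suc K) s \<le> Bd" using Bd s by auto
      show "lb powr (- Re s - real (Suc K)) \<le> L"
        unfolding L_def using lb re by (intro powr_mono') auto
      show "(real m + x + real n) powr (2 * (- Re s - real (Suc K) / 2))
        \<le> (x\<^sup>2) powr e1 * (real (Suc m) powr e2 * real (Suc n) powr e2)"
      proof (rule pair_dominated)
        show "e2 \<le> 0" using e2 by simp
      qed (use x re in \<open>auto simp: e1_def e2_def\<close>)
    qed (use Bd0 in \<open>auto simp: L_def intro!: mult_nonneg_nonneg\<close>)
    finally show ?thesis by (simp add: M_def)
  qed
  ultimately show ?thesis using r by (intro exI[of _ r] conjI exI[of _ M]) auto
qed

lemma EM_error_holomorphic:
  assumes x: "0 < x" and y: "0 \<le> y"
  shows "(\<lambda>s. EM_error x y K s mn) holomorphic_on S"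
  unfolding EM_error_def using assms
  by (cases mn) (auto intro!: holomorphic_intros \<phi>_holomorphic)

definition EM_sum :: "real \<Rightarrow> real \<Rightarrow> nat \<Rightarrow> complex \<Rightarrow> complex" where
  "EM_sum x y K s = (\<Sum>\<^sub>\<infinity>mn\<in>UNIV. EM_error x y K s mn)"

lemma EM_sum_holomorphic:
  assumes "0 < x" "x \<le> 1" "0 \<le> y" "y \<le> 1"
  shows "EM_sum x y K holomorphic_on {s. Re s > (1 - real K) / 2}"
  unfolding EM_sum_def using assms
  by (intro holomorphic_on_infsum EM_error_holomorphic open_halfspace_Re_gt EM_error_dominated) auto

lemma EM_error_summable:
  assumes "0 < x" "x \<le> 1" "0 \<le> y" "y \<le> 1" "Re s > (1 - real K) / 2"
  shows "(\<lambda>mn. norm (EM_error x y K s mn)) summable_on UNIV"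
proof -
  obtain r M where rM: "r > 0" "M summable_on UNIV"
    "\<forall>mn\<in>UNIV. \<forall>w\<in>cball s r \<inter> {s. Re s > (1 - real K) / 2}. norm (EM_error x y K w mn) \<le> M mn"
    using EM_error_dominated[OF assms] by auto
  show ?thesis
    by (rule summable_on_comparison_test[OF rM(2)]) (use rM assms in auto)
qed

text \<open>The error bound carries the factor \<open>Pn (Suc K) 0\<close>, which is 0 by
  \<open>P_at_0\<close>.\<close>

lemma EM_sum_0:
  assumes "0 < x" "x \<le> 1" "0 \<le> y" "y \<le> 1" "K \<ge> 2"
  shows "EM_sum x y K 0 = 0"
proof -
  have "EM_error x y K 0 (m, n) = 0" for m n
    using norm_EM_error_le[of x y K 0 m n] assms by (simp add: Pn_def P_at_0 del: P.simps)
  then have "EM_error x y K 0 mn = 0" for mn by (cases mn) auto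
  then show ?thesis by (simp add: EM_sum_def)
qed

lemma Q_powr_summable:
  assumes x: "0 < x" "x \<le> 1" and y: "0 \<le> y" and s: "Re s > 1"
  shows "(\<lambda>mn. norm (case mn of (m, n) \<Rightarrow> complex_of_real (Qf (real m + x) (real n + y)) powr (-s))) summable_on UNIV"
proof -
  define M where "M = (\<lambda>(m, n). lb powr (- Re s) * ((x\<^sup>2) powr (- Re s) * (real (Suc m) powr (- Re s) * real (Suc n) powr (- Re s))))"
  have "(\<lambda>(m, n). real (Suc m) powr (- Re s) * real (Suc n) powr (- Re s)) summable_on UNIV"
    using s by (intro summable_on_product_nonneg summable_on_Suc_powr) auto
  then have "(\<lambda>mn. (lb powr (- Re s) * (x\<^sup>2) powr (- Re s)) * (case mn of (m, n) \<Rightarrow> real (Suc m) powr (- Re s) * real (Suc n) powr (- Re s))) summable_on UNIV"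
    by (rule summable_on_cmult_right)
  then have M: "M summable_on UNIV"
    by (simp add: M_def case_prod_unfold mult_ac)
  show ?thesis
  proof (rule summable_on_comparison_test[OF M])
    fix mn :: "nat \<times> nat"
    obtain m n where mn: "mn = (m, n)" by (cases mn)
    have X: "real m + x > 0" using x by simp
    have "norm (complex_of_real (Qf (real m + x) (real n + y)) powr (-s)) = norm (\<phi> (real m + x) s (Suc 0) (real n + y))"
      using X y by (simp add: \<phi>_1)
    also have "\<dots> \<le> lb powr (- Re s) * (real m + x + (real n + y)) powr (- 2 * Re s)"
      using norm_\<phi>_le[OF X, of "real n + y" s 0] y s by (simp add: Pn_def)
    also have "\<dots> \<le> lb powr (- Re s) * (real m + x + real n) powr (2 * - Re s)"
      using X y s by (intro mult_left_mono) (auto intro!: powr_mono2')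
    also have "\<dots> \<le> M mn"
      unfolding M_def mn prod.case
      by (intro mult_left_mono pair_dominated) (use x s in auto)
    finally show "norm (case mn of (m, n) \<Rightarrow> complex_of_real (Qf (real m + x) (real n + y)) powr (-s)) \<le> M mn"
      by (simp add: mn)
  qed auto
qed

text \<open>For fixed \<open>m\<close> the Euler--Maclaurin differences telescope over
  \<open>n\<close>. The antiderivative (\<open>k = 0\<close>) contributes the integral over the
  half-line, every other term minus its value at \<open>Y = 0\<close>; these terms are powers of
  \<open>X\<close>, ready for the summation over \<open>m\<close>.\<close>

lemma slice_sum:
  assumes X: "X = real m + x" and x: "0 < x" "x \<le> 1" and y: "0 \<le> y" "y \<le> 1" and s: "Re s > 1"
  shows "((\<lambda>n. complex_of_real (Qf X (real n + y)) powr (-s)) has_sum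
     ((\<Sum>\<^sub>\<infinity>n. EM_error x y K s (m, n)) + of_real X powr (1 - 2 * s) * I s
      - (\<Sum>k<K. of_real (poly (bernp (Suc k)) y) * (of_real X powr (- 2 * s - of_nat k) * g k s 0)))) UNIV"
proof -
  have X0: "X > 0" using X x by simp
  define b where "b k = complex_of_real (poly (bernp k) y)" for k
  have "(\<lambda>n. norm (EM_error x y K s (m, n))) summable_on UNIV"
  proof (rule norm_summable_slice, rule EM_error_summable[OF x y])
    have "(1 - real K) / 2 \<le> 1 / 2" by simp
    then show "(1 - real K) / 2 < Re s" using s by linarith
  qed
  then have 1: "(\<lambda>n. EM_error x y K s (m, n)) sums (\<Sum>\<^sub>\<infinity>n. EM_error x y K s (m, n))"
    by (rule has_sum_imp_sums[OF has_sum_infsum[OF abs_summable_summable]])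
  have 2: "(\<lambda>n. \<Sum>k\<le>K. b k * (\<phi> X s k (real n + 1) - \<phi> X s k (real n))) sums
      (\<Sum>k\<le>K. b k * ((if k = 0 then of_real X powr (1 - 2 * s) * I s else 0) - \<phi> X s k 0))"
  proof (intro sums_sum sums_mult)
    fix k
    have "(\<lambda>n. \<phi> X s k (real n)) \<longlonglongrightarrow> (if k = 0 then of_real X powr (1 - 2 * s) * I s else 0)"
    proof (cases k)
      case 0
      have "filterlim (\<lambda>n. real n / X) at_top sequentially"
        using X0 by real_asymp
      moreover have "(F s \<longlongrightarrow> I s) at_top" using s by (intro F_tendsto_I) simp
      ultimately have "(\<lambda>n. F s (real n / X)) \<longlonglongrightarrow> I s"
        by (rule filterlim_compose[rotated])
      then have "(\<lambda>n. of_real X powr (1 - 2 * s) * F s (real n / X)) \<longlonglongrightarrow> of_real X powr (1 - 2 * s) * I s"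
        by (rule tendsto_mult_left)
      then show ?thesis using 0 by (simp add: \<phi>_def)
    next
      case (Suc j)
      have "(\<lambda>n. \<phi> X s (Suc j) (real n)) \<longlonglongrightarrow> 0"
      proof (rule Lim_null_comparison)
        show "\<forall>\<^sub>F n in sequentially. norm (\<phi> X s (Suc j) (real n)) \<le>
            Pn j s * lb powr (- Re s - real j) * (X + real n) powr (- 2 * Re s - real j)"
          using X0 s by (intro always_eventually allI norm_\<phi>_le) auto
        have "(\<lambda>n. (X + real n) powr (- 2 * Re s - real j)) \<longlonglongrightarrow> 0"
          by (rule tendsto_neg_powr) (use s in simp, real_asymp)
        then show "(\<lambda>n. Pn j s * lb powr (- Re s - real j) * (X + real n) powr (- 2 * Re s - real j)) \<longlonglongrightarrow> 0"
          by (rule tendsto_mult_right_zero)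
      qed
      then show ?thesis using Suc by simp
    qed
    from telescope_sums[OF this] show "(\<lambda>n. \<phi> X s k (real n + 1) - \<phi> X s k (real n)) sums
      ((if k = 0 then of_real X powr (1 - 2 * s) * I s else 0) - \<phi> X s k 0)"
      by (simp add: add.commute)
  qed
  have val: "(\<Sum>k\<le>K. b k * ((if k = 0 then of_real X powr (1 - 2 * s) * I s else 0) - \<phi> X s k 0))
    = of_real X powr (1 - 2 * s) * I s - (\<Sum>k<K. b (Suc k) * (of_real X powr (- 2 * s - of_nat k) * g k s 0))"
  proof -
    have "(\<Sum>k\<le>K. b k * ((if k = 0 then of_real X powr (1 - 2 * s) * I s else 0) - \<phi> X s k 0))
      = b 0 * (of_real X powr (1 - 2 * s) * I s - \<phi> X s 0 0)
        + (\<Sum>k<K. b (Suc k) * (0 - \<phi> X s (Suc k) 0))"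
      by (subst sum.atMost_shift) simp
    then show ?thesis by (simp add: b_def \<phi>_def sum_negf)
  qed
  have "(\<lambda>n. EM_error x y K s (m, n) + (\<Sum>k\<le>K. b k * (\<phi> X s k (real n + 1) - \<phi> X s k (real n)))) sums
     ((\<Sum>\<^sub>\<infinity>n. EM_error x y K s (m, n)) + (of_real X powr (1 - 2 * s) * I s
      - (\<Sum>k<K. b (Suc k) * (of_real X powr (- 2 * s - of_nat k) * g k s 0))))"
    using sums_add[OF 1 2] unfolding val .
  moreover have "EM_error x y K s (m, n) + (\<Sum>k\<le>K. b k * (\<phi> X s k (real n + 1) - \<phi> X s k (real n)))
     = complex_of_real (Qf X (real n + y)) powr (-s)" for n
    using \<phi>_1[OF X0, of "real n + y" s] y by (simp add: EM_error_def X b_def)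
  ultimately have S: "(\<lambda>n. complex_of_real (Qf X (real n + y)) powr (-s)) sums
     ((\<Sum>\<^sub>\<infinity>n. EM_error x y K s (m, n)) + of_real X powr (1 - 2 * s) * I s
      - (\<Sum>k<K. b (Suc k) * (of_real X powr (- 2 * s - of_nat k) * g k s 0)))"
    by (simp add: add_diff_eq)
  have "(\<lambda>n. norm (complex_of_real (Qf X (real n + y)) powr (-s))) summable_on UNIV"
    using norm_summable_slice[OF Q_powr_summable[OF x y(1) s], of m] by (simp only: X prod.case)
  from has_sum_infsum[OF abs_summable_summable[OF this]]
  have hs: "((\<lambda>n. complex_of_real (Qf X (real n + y)) powr (-s)) has_sum
      (\<Sum>\<^sub>\<infinity>n. complex_of_real (Qf X (real n + y)) powr (-s))) UNIV" .
  then show ?thesis using sums_unique2[OF has_sum_imp_sums[OF hs] S] by (simp add: b_def)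
qed

text \<open>Euler--Maclaurin summation over \<open>n\<close> leaves Hurwitz zeta functions at \<open>2 s - 1, 2 s, 2 s + 1, \<dots>\<close>
  in the summation over \<open>m\<close>. At 0 the first term contributes \<open>I(0) \<zeta>(- 1, x)\<close>, the second
  \<open>B\<^sub>1(x) B\<^sub>1(y)\<close>, and in the third the pole of \<open>\<zeta>(2 s + 1, x)\<close> cancels a factor \<open>s\<close>.\<close>

theorem cone_zeta_continuation:
  assumes x: "0 < x" "x \<le> 1" and y: "0 \<le> y" "y \<le> 1"
  obtains Z where "Z meromorphic_on {s. Re s > - real R}" "Z holomorphic_on {s. Re s > 1}"
    "\<And>s. Re s > 1 \<Longrightarrow> ((\<lambda>(m, n). complex_of_real (Qf (real m + x) (real n + y)) powr (-s)) has_sum Z s) UNIV"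
    "(Z \<longlongrightarrow> of_real ((x - 1/2) * (y - 1/2) + B / (4 * C) * (x\<^sup>2 - x + 1/6) + B / (4 * A) * (y\<^sup>2 - y + 1/6))) (at 0)"
proof -
  \<comment> \<open>With this \<open>K\<close> the error sum is holomorphic for
    \<open>Re s > - R - 1/2\<close>, and \<open>2 * s - 1\<close> stays in the half-plane of
    \<open>h\<close> when \<open>Re s > - R\<close>. The summand 2 also makes
    \<open>K \<ge> 2\<close>.\<close>
  define K where "K = 2 * R + 2"
  have K2: "K \<ge> 2" by (simp add: K_def)
  obtain h where h: "h holomorphic_on {w. Re w > - real K}"
    "\<And>w. Re w > 1 \<Longrightarrow> ((\<lambda>m. complex_of_real (real m + x) powr (-w)) has_sum h w / (w - 1)) UNIV"
    "h 1 = 1" "h 0 = of_real (x - 1/2)" "h (-1) = of_real (x\<^sup>2 - x + 1/6)"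
    by (rule hurwitz_zeta_continuation[OF x K2]) blast
  obtain J where J: "J meromorphic_on {s. Re s > - real R}" "\<And>s. Re s > 1/2 \<Longrightarrow> J s = I s"
    "(J \<longlongrightarrow> - of_real (B / (2 * C))) (at 0)"
    by (rule I_continuation[of R]) blast
  define b where "b k = complex_of_real (poly (bernp k) y)" for k
  define trm where "trm k s = b (Suc k) * (g k s 0 * (h (2 * s + of_nat k) / (2 * s + of_nat k - 1)))" for k s
  define Z where "Z s = EM_sum x y K s + J s * (h (2 * s - 1) / (2 * s - 2)) - (\<Sum>k<K. trm k s)" for s
  have g0: "g k s 0 = coeff (P k s) 0 * of_real A powr (- s - of_nat k)" for k s
    by (simp add: g_def q_def poly_0_coeff_0)
  have ghol: "(\<lambda>s. g k s 0) holomorphic_on S" for k S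
    unfolding g0 using pos by (intro holomorphic_intros coeff_P_holomorphic) auto
  have hcomp: "(\<lambda>s. h (2 * s + c)) holomorphic_on {s. Re s > - real R}" if "Re c \<ge> -1" for c
  proof -
    have "(h \<circ> (\<lambda>s. 2 * s + c)) holomorphic_on {s. Re s > - real R}"
    proof (rule holomorphic_on_compose_gen[OF _ h(1)])
      show "(\<lambda>s. 2 * s + c) holomorphic_on {s. Re s > - real R}" by (intro holomorphic_intros)
      show "(\<lambda>s. 2 * s + c) ` {s. Re s > - real R} \<subseteq> {w. Re w > - real K}"
        using that by (auto simp: K_def)
    qed
    then show ?thesis by (simp add: o_def)
  qed
  have hcomp1: "(\<lambda>s. h (2 * s - 1)) holomorphic_on {s. Re s > - real R}"
    using hcomp[of "-1"] by simp
  have ana: "f meromorphic_on {s. Re s > - real R}" if "f holomorphic_on {s. Re s > - real R}" for f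
    using that by (intro analytic_on_imp_meromorphic_on) (simp only: analytic_on_open open_halfspace_Re_gt)
  have EMhol: "EM_sum x y K holomorphic_on {s. Re s > - real R}"
    by (rule holomorphic_on_subset[OF EM_sum_holomorphic[OF x y]]) (auto simp: K_def field_simps)
  have mero: "Z meromorphic_on {s. Re s > - real R}"
    unfolding Z_def trm_def
    by (intro meromorphic_on_add meromorphic_on_diff meromorphic_on_sum meromorphic_on_mult meromorphic_on_divide
        J(1) ana EMhol ghol hcomp hcomp1 holomorphic_intros) auto
  have sub: "{s. Re s > 1} \<subseteq> {s. Re s > - real R}" by auto
  have Jhol: "J holomorphic_on {s. Re s > 1}"
    by (rule holomorphic_transform[OF holomorphic_on_subset[OF I_holomorphic]]) (auto simp: J(2))
  have hol: "Z holomorphic_on {s. Re s > 1}"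
    unfolding Z_def trm_def
    by (intro holomorphic_intros Jhol holomorphic_on_subset[OF EMhol sub] ghol
        holomorphic_on_subset[OF hcomp sub] holomorphic_on_subset[OF hcomp1 sub])
      (auto simp: complex_eq_iff)
  have sum: "((\<lambda>(m, n). complex_of_real (Qf (real m + x) (real n + y)) powr (-s)) has_sum Z s) UNIV"
    if s: "Re s > 1" for s
  proof -
    define S where "S m = (\<Sum>\<^sub>\<infinity>n. EM_error x y K s (m, n)) + of_real (real m + x) powr (1 - 2 * s) * I s
      - (\<Sum>k<K. b (Suc k) * (of_real (real m + x) powr (- 2 * s - of_nat k) * g k s 0))" for m
    have abs: "(\<lambda>mn. norm (EM_error x y K s mn)) summable_on UNIV"
      using s by (intro EM_error_summable x y) auto
    have e: "((\<lambda>m. \<Sum>\<^sub>\<infinity>n. EM_error x y K s (m, n)) has_sum EM_sum x y K s) UNIV"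
    proof (rule has_sum_SigmaD)
      show "(EM_error x y K s has_sum EM_sum x y K s) (Sigma UNIV (\<lambda>_. UNIV))"
        unfolding EM_sum_def using has_sum_infsum[OF abs_summable_summable[OF abs]] by simp
      show "((\<lambda>n. EM_error x y K s (m, n)) has_sum (\<Sum>\<^sub>\<infinity>n. EM_error x y K s (m, n))) UNIV" for m
        by (rule has_sum_infsum[OF abs_summable_summable[OF norm_summable_slice[OF abs]]])
    qed
    have hz: "((\<lambda>m. complex_of_real (real m + x) powr (- 2 * s - c)) has_sum h (2 * s + c) / (2 * s + c - 1)) UNIV"
      if "Re c \<ge> -1" for c
      using h(2)[of "2 * s + c"] that s by simp
    have hz1: "((\<lambda>m. complex_of_real (real m + x) powr (1 - 2 * s)) has_sum h (2 * s - 1) / (2 * s - 2)) UNIV"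
      using hz[of "-1"] by (simp add: diff_diff_eq)
    have "(S has_sum (EM_sum x y K s + h (2 * s - 1) / (2 * s - 2) * I s
        - (\<Sum>k<K. b (Suc k) * (h (2 * s + of_nat k) / (2 * s + of_nat k - 1) * g k s 0)))) UNIV"
      unfolding S_def
      by (intro has_sum_minus has_sum_add e has_sum_cmult_left has_sum_sum has_sum_cmult_right hz hz1) auto
    moreover have "EM_sum x y K s + h (2 * s - 1) / (2 * s - 2) * I s
        - (\<Sum>k<K. b (Suc k) * (h (2 * s + of_nat k) / (2 * s + of_nat k - 1) * g k s 0)) = Z s"
      using s J(2)[of s] by (simp add: Z_def trm_def mult_ac)
    ultimately have SZ: "(S has_sum Z s) UNIV" by simp
    have tot: "((\<lambda>(m, n). complex_of_real (Qf (real m + x) (real n + y)) powr (-s)) has_sum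
        (\<Sum>\<^sub>\<infinity>(m, n). complex_of_real (Qf (real m + x) (real n + y)) powr (-s))) (Sigma UNIV (\<lambda>_. UNIV))"
      (is "(?f has_sum ?T) _")
      using has_sum_infsum[OF abs_summable_summable[OF Q_powr_summable[OF x y(1) s]]] by simp
    have "(S has_sum ?T) UNIV"
      by (rule has_sum_SigmaD[OF tot])
        (use slice_sum[OF refl x y s, of _ K] in \<open>simp add: S_def b_def\<close>)
    then have "?T = Z s" using SZ has_sum_unique by blast
    then show ?thesis using tot by simp
  qed
  have op: "open {s. Re s > - real K}" by (rule open_halfspace_Re_gt)
  have ht: "((\<lambda>s. h (2 * s + c)) \<longlongrightarrow> h c) (at 0)" if "Re c > - real K" for c
  proof -
    have "\<forall>x\<in>{w. Re w > - real K}. isCont h x"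
      using continuous_on_eq_continuous_at[OF op] holomorphic_on_imp_continuous_on[OF h(1)] by blast
    with that have "isCont h c" by blast
    moreover have "((\<lambda>s::complex. 2 * s + c) \<longlongrightarrow> c) (at 0)" by (auto intro!: tendsto_eq_intros)
    ultimately show ?thesis by (rule isCont_tendsto_compose)
  qed
  have gt: "((\<lambda>s. g k s 0) \<longlongrightarrow> g k 0 0) (at 0)" for k
    by (rule holomorphic_on_tendsto_at[OF ghol, of UNIV]) auto
  \<comment> \<open>The limits of the terms at 0. For \<open>k = 0\<close> it comes from the zeta
    value at 0, for \<open>k = 1\<close> from the residue of the pole against the factor
    \<open>s\<close>; for larger \<open>k\<close> the derivative vanishes at 0 and there is no pole
    to compensate.\<close>
  define L where "L k = (if k = 0 then - b 1 * of_real (x - 1/2)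
     else if k = 1 then - b 2 * of_real (B / (2 * A)) else 0)" for k :: nat
  have b12: "b 1 = of_real (y - 1/2)" "b 2 = of_real ((y\<^sup>2 - y + 1/6) / 2)"
    unfolding b_def bernp_1 bernp_2 by simp_all
  have termt: "(trm k \<longlongrightarrow> L k) (at 0)" for k
  proof (cases "k = 1")
    case True
    have l: "((\<lambda>s. b 2 * ((- of_real B / 2) * of_real A powr (- s - 1) * h (2 * s + 1))) \<longlongrightarrow>
        b 2 * ((- of_real B / 2) * of_real A powr (- 0 - 1) * h 1)) (at 0)"
    proof (intro tendsto_mult tendsto_const ht)
      show "((\<lambda>s. complex_of_real A powr (- s - 1)) \<longlongrightarrow> of_real A powr (- 0 - 1)) (at 0)"
        by (rule isContD, intro continuous_intros) (use pos in auto)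
    qed auto
    have eL: "b 2 * ((- of_real B / 2) * of_real A powr (- 0 - 1) * h 1) = L 1"
      using pos by (simp add: L_def h(3) powr_minus_divide)
    have "\<forall>\<^sub>F s in at 0. b 2 * ((- of_real B / 2) * of_real A powr (- s - 1) * h (2 * s + 1)) = trm 1 s"
      using eventually_at_ball'[of 1 0 UNIV, OF zero_less_one]
    proof eventually_elim
      case (elim s)
      then have "s \<noteq> 0" by auto
      then show ?case unfolding trm_def g0 using coeff_P_1[of s] by (simp add: numeral_2_eq_2 del: P.simps)
    qed
    from Lim_transform_eventually[OF l this] have "(trm 1 \<longlongrightarrow> L 1) (at 0)"
      unfolding eL .
    then show ?thesis using True by simp
  next
    case False
    have ck: "of_nat k - 1 \<noteq> (0::complex)" using False by (metis eq_iff_diff_eq_0 of_nat_1 of_nat_eq_iff)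
    have "(trm k \<longlongrightarrow> b (Suc k) * (g k 0 0 * (h (of_nat k) / (2 * 0 + of_nat k - 1)))) (at 0)"
      unfolding trm_def
      by (intro tendsto_mult tendsto_const gt tendsto_divide tendsto_diff tendsto_add tendsto_ident_at ht)
        (use ck in \<open>auto simp: K_def\<close>)
    moreover have "b (Suc k) * (g k 0 0 * (h (of_nat k) / (2 * 0 + of_nat k - 1))) = L k"
    proof (cases k)
      case 0
      then show ?thesis using pos by (simp add: L_def g0 h(4) algebra_simps)
    next
      case (Suc j)
      then show ?thesis using False by (simp add: L_def g0 P_at_0 del: P.simps)
    qed
    ultimately show ?thesis by simp
  qed
  have "(Z \<longlongrightarrow> EM_sum x y K 0 + - of_real (B / (2 * C)) * (h (-1) / (2 * 0 - 2)) - (\<Sum>k<K. L k)) (at 0)"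
    unfolding Z_def
  proof (intro tendsto_add tendsto_diff tendsto_mult tendsto_sum tendsto_divide tendsto_const tendsto_ident_at termt J(3))
    show "(EM_sum x y K \<longlongrightarrow> EM_sum x y K 0) (at 0)"
      by (rule holomorphic_on_tendsto_at[OF EM_sum_holomorphic[OF x y] open_halfspace_Re_gt])
        (simp add: K_def)
    show "((\<lambda>s. h (2 * s - 1)) \<longlongrightarrow> h (-1)) (at 0)" using ht[of "-1"] by (simp add: K_def)
  qed auto
  moreover have "EM_sum x y K 0 + - of_real (B / (2 * C)) * (h (-1) / (2 * 0 - 2)) - (\<Sum>k<K. L k)
     = of_real ((x - 1/2) * (y - 1/2) + B / (4 * C) * (x\<^sup>2 - x + 1/6) + B / (4 * A) * (y\<^sup>2 - y + 1/6))"
  proof -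
    have "(\<Sum>k<K. L k) = (\<Sum>k\<in>{0, 1}. L k)"
      by (rule sum.mono_neutral_right) (auto simp: K_def L_def)
    then have "EM_sum x y K 0 + - of_real (B / (2 * C)) * (h (-1) / (2 * 0 - 2)) - (\<Sum>k<K. L k)
      = of_real (B / (2 * C) * ((x\<^sup>2 - x + 1/6) / 2)
        - (- (y - 1/2) * (x - 1/2) - ((y\<^sup>2 - y + 1/6) / 2) * (B / (2 * A))))"
      by (simp add: EM_sum_0[OF x y K2] L_def h(5) b12 del: One_nat_def)
    also have "B / (2 * C) * ((x\<^sup>2 - x + 1/6) / 2)
        - (- (y - 1/2) * (x - 1/2) - ((y\<^sup>2 - y + 1/6) / 2) * (B / (2 * A)))
       = (x - 1/2) * (y - 1/2) + B / (4 * C) * (x\<^sup>2 - x + 1/6) + B / (4 * A) * (y\<^sup>2 - y + 1/6)"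
      by (simp add: field_simps)
    finally show ?thesis .
  qed
  ultimately show ?thesis using that mero hol sum by simp
qed

end

subsection \<open>Values of a meromorphic continuation\<close>

text \<open>After removal of singularities the difference is 0 on all of \<open>S\<close>, so both
  functions agree near every point. At the point itself they agree because their value is either the
  limit or, at a pole, 0.\<close>

lemma nicely_meromorphic_eqI:
  assumes f: "f nicely_meromorphic_on S" and g: "g nicely_meromorphic_on S"
    and S: "open S" "connected S" and U: "open U" "U \<subseteq> S" "z0 \<in> U"
    and eq: "\<And>z. z \<in> U \<Longrightarrow> f z = g z" and z: "z \<in> S"
  shows "f z = g z"
proof -
  define d where "d = (\<lambda>z. f z - g z)"
  have fm: "f meromorphic_on S" and gm: "g meromorphic_on S"
    using f g by (auto simp: nicely_meromorphic_on_def)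
  have dm: "d meromorphic_on S" unfolding d_def using fm gm by (intro meromorphic_intros)
  have mero_at: "d meromorphic_on {w}" if "w \<in> S" for w
    by (rule meromorphic_on_subset[OF dm]) (use that in simp)
  have ev: "\<forall>\<^sub>F v in at w. remove_sings d v = d v" if "w \<in> S" for w
    using mero_at[OF that] by (intro eventually_remove_sings_eq_at) (simp add: meromorphic_at_iff)
  have "\<forall>\<^sub>F v in at z0. v \<in> U" by (rule eventually_at_in_open') (use U in auto)
  with ev[of z0] have "\<forall>\<^sub>F v in at z0. remove_sings d v = 0"
    using U by (auto elim!: eventually_elim2 simp: d_def eq)
  then have fr: "\<exists>\<^sub>F v in at z0. remove_sings d v = 0"
    by (intro eventually_frequently) auto
  have zero: "remove_sings d w = 0" if "w \<in> S" for w
    by (rule frequently_eq_meromorphic_imp_constant[OF fr remove_sings_nicely_meromorphic[OF dm] S])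
      (use U that in auto)
  have "\<forall>\<^sub>F v in at z. v \<in> S" by (rule eventually_at_in_open') (use S z in auto)
  with ev[OF z] have fg: "\<forall>\<^sub>F v in at z. f v = g v"
    by eventually_elim (use zero in \<open>auto simp: d_def\<close>)
  consider "is_pole f z" "f z = 0" | "(f \<longlongrightarrow> f z) (at z)"
    using f z by (auto simp: nicely_meromorphic_on_def)
  then show ?thesis
  proof cases
    case 1
    then have "is_pole g z" using is_pole_cong[OF fg refl] by simp
    then have "g z = 0"
      using g z not_tendsto_and_filterlim_at_infinity[of "at z" g]
      by (auto simp: nicely_meromorphic_on_def is_pole_def)
    then show ?thesis using 1 by simp
  next
    case 2
    then have l: "(g \<longlongrightarrow> f z) (at z)" by (rule Lim_transform_eventually[OF _ fg])
    then have "\<not> is_pole g z"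
      using not_tendsto_and_filterlim_at_infinity[of "at z" g] by (auto simp: is_pole_def)
    then have "(g \<longlongrightarrow> g z) (at z)" using g z by (auto simp: nicely_meromorphic_on_def)
    then show ?thesis using l tendsto_unique[of "at z"] by auto
  qed
qed

text \<open>The description in the definition of the L-value asks for one function on the whole
  plane. It is glued from continuations to larger and larger half-planes, which agree by the
  identity theorem. Holomorphy for \<open>Re s > 1\<close> ensures that removing singularities keeps
  the values \<open>F s\<close> there.\<close>

lemma meromorphic_continuation_value:
  fixes F :: "complex \<Rightarrow> complex"
  assumes ex: "\<And>R::nat. \<exists>g. g meromorphic_on {s. Re s > - real R} \<and> g holomorphic_on {s. Re s > 1} \<and>
      (\<forall>s. Re s > 1 \<longrightarrow> g s = F s) \<and> (g \<longlongrightarrow> V) (at 0)"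
  shows "(THE g. g nicely_meromorphic_on UNIV \<and> (\<forall>s. Re s > 1 \<longrightarrow> g s = F s)) 0 = V"
proof -
  define H where "H R = {s. Re s > - real R}" for R :: nat
  obtain g where g: "\<And>R. g R meromorphic_on H R" "\<And>R. g R holomorphic_on {s. Re s > 1}"
    "\<And>R s. Re s > 1 \<Longrightarrow> g R s = F s" "\<And>R. (g R \<longlongrightarrow> V) (at 0)"
  proof -
    from choice[OF allI[OF ex]] obtain g where "\<forall>R. g R meromorphic_on {s. Re s > - real R} \<and>
      g R holomorphic_on {s. Re s > 1} \<and> (\<forall>s. Re s > 1 \<longrightarrow> g R s = F s) \<and> (g R \<longlongrightarrow> V) (at 0)" ..
    then show ?thesis by (intro that[of g]) (simp_all add: H_def)
  qed
  define r where "r R = remove_sings (g R)" for R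
  have oH: "open (H R)" "connected (H R)" for R
    unfolding H_def by (auto simp: open_halfspace_Re_gt intro!: convex_connected convex_halfspace_Re_gt)
  have rn: "r R nicely_meromorphic_on H R" for R
    unfolding r_def by (intro remove_sings_nicely_meromorphic g)
  have rF: "r R s = F s" if "Re s > 1" for R s
  proof -
    have "g R analytic_on {s. Re s > 1}"
      using g(2)[of R] by (simp only: analytic_on_open open_halfspace_Re_gt)
    then have "g R analytic_on {s}" by (rule analytic_on_subset) (use that in auto)
    then have "r R s = g R s" unfolding r_def by simp
    then show ?thesis by (simp only: g(3)[OF that])
  qed
  have agree0: "r R s = r R' s" if "s \<in> H R" "R \<le> R'" for R R' s
  proof (rule nicely_meromorphic_eqI[OF rn _ oH])
    show "r R' nicely_meromorphic_on H R"
      by (rule nicely_meromorphic_on_subset[OF rn]) (use that in \<open>auto simp: H_def\<close>)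
    show "open {s. Re s > 1}" by (rule open_halfspace_Re_gt)
    show "{s. Re s > 1} \<subseteq> H R" by (auto simp: H_def)
    show "2 \<in> {s. Re s > 1}" by simp
    show "r R z = r R' z" if "z \<in> {s. Re s > 1}" for z
      using that by (simp only: mem_Collect_eq rF)
  qed (rule that(1))
  have agree: "r R s = r R' s" if "s \<in> H R" "s \<in> H R'" for R R' s
  proof (cases "R \<le> R'")
    case True
    show ?thesis by (rule agree0[OF that(1) True])
  next
    case False
    then show ?thesis by (intro agree0[OF that(2), symmetric]) simp
  qed
  \<comment> \<open>The half-plane depends on the point; adding 1 puts the point strictly
    inside.\<close>
  define G where "G s = r (nat \<lceil>\<bar>Re s\<bar>\<rceil> + 1) s" for s
  have inH: "s \<in> H (nat \<lceil>\<bar>Re s\<bar>\<rceil> + 1)" for s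
  proof -
    have "\<bar>Re s\<bar> \<le> real (nat \<lceil>\<bar>Re s\<bar>\<rceil>)" by (rule real_nat_ceiling_ge)
    then have "- Re s < real (nat \<lceil>\<bar>Re s\<bar>\<rceil> + 1)" unfolding of_nat_add by linarith
    then show ?thesis by (simp add: H_def)
  qed
  have Gr: "G s = r R s" if "s \<in> H R" for s R
    unfolding G_def by (intro agree inH that)
  have Gn: "G nicely_meromorphic_on UNIV"
    unfolding nicely_meromorphic_on_def
  proof safe
    have mer: "G meromorphic_on {s}" for s
    proof -
      define R where "R = nat \<lceil>\<bar>Re s\<bar>\<rceil> + 1"
      have sH: "s \<in> H R" unfolding R_def by (rule inH)
      have "\<forall>\<^sub>F w in at s. w \<in> H R" by (rule eventually_at_in_open') (use oH sH in auto)
      then have "\<forall>\<^sub>F w in at s. G w = r R w" by eventually_elim (rule Gr)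
      moreover have "r R meromorphic_on {s}"
        using rn[of R] sH meromorphic_on_subset[of "r R" "H R" "{s}"] by (auto simp: nicely_meromorphic_on_def)
      ultimately show ?thesis
        using meromorphic_on_cong[of "{s}" G "r R" "{s}"] by simp
    qed
    show "G meromorphic_on UNIV"
      by (subst meromorphic_on_meromorphic_at) (simp add: mer)
    fix s assume nl: "\<not> G \<midarrow>s\<rightarrow> G s"
    define R where "R = nat \<lceil>\<bar>Re s\<bar>\<rceil> + 1"
    have sH: "s \<in> H R" unfolding R_def by (rule inH)
    have "\<forall>\<^sub>F w in at s. w \<in> H R" by (rule eventually_at_in_open') (use oH sH in auto)
    then have ev: "\<forall>\<^sub>F w in at s. r R w = G w" by eventually_elim (simp add: Gr)
    have "is_pole (r R) s \<and> r R s = 0 \<or> r R \<midarrow>s\<rightarrow> r R s"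
      using rn[of R] sH by (auto simp: nicely_meromorphic_on_def)
    moreover have "\<not> r R \<midarrow>s\<rightarrow> r R s"
    proof
      assume "r R \<midarrow>s\<rightarrow> r R s"
      from Lim_transform_eventually[OF this ev] nl Gr[OF sH] show False by simp
    qed
    ultimately have *: "is_pole (r R) s" "r R s = 0" by auto
    then show "is_pole G s" using is_pole_cong[OF ev refl] by simp
    show "G s = 0" using * Gr[OF sH] by simp
  qed
  have GF: "\<forall>s. Re s > 1 \<longrightarrow> G s = F s" using rF by (simp add: G_def)
  have uniq: "g = G" if g: "g nicely_meromorphic_on UNIV \<and> (\<forall>s. Re s > 1 \<longrightarrow> g s = F s)" for g
  proof
    fix z
    show "g z = G z"
    proof (rule nicely_meromorphic_eqI[of g UNIV G "{s. Re s > 1}" 2])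
      show "open {s. Re s > 1}" by (rule open_halfspace_Re_gt)
    qed (use g Gn GF in auto)
  qed
  have "(THE g. g nicely_meromorphic_on UNIV \<and> (\<forall>s. Re s > 1 \<longrightarrow> g s = F s)) = G"
    by (rule the_equality) (use Gn GF uniq in blast)+
  moreover have "G 0 = V"
    using Gr[of 0 1] remove_sings_eqI[OF g(4)] by (simp add: H_def r_def)
  ultimately show ?thesis by simp
qed

subsection \<open>Continued fractions\<close>

lemma cfrac_convergent_bounds:
  assumes "\<And>i. a i > 0"
  shows "of_int (a 0) \<le> cfrac_convergent a n \<and> cfrac_convergent a n \<le> of_int (a 0) + 1"
  using assms
proof (induction n arbitrary: a)
  case (Suc n)
  have "of_int (a (Suc 0)) \<le> cfrac_convergent (\<lambda>i. a (Suc i)) n"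
    using Suc.IH[of "\<lambda>i. a (Suc i)"] Suc.prems by auto
  moreover have "real_of_int (a (Suc 0)) \<ge> 1" using Suc.prems[of "Suc 0"] by linarith
  ultimately have "1 \<le> cfrac_convergent (\<lambda>i. a (Suc i)) n" by linarith
  then show ?case by (simp add: field_simps)
qed auto

text \<open>The convergents of the tail are at most \<open>a 1 + 1\<close>, so their reciprocals
  stay away from 0. Hence the limit exceeds \<open>a 0\<close> strictly, and reciprocals may be
  taken in the limit.\<close>

lemma has_cfrac_step_aux:
  assumes "has_cfrac x a"
  shows "x > of_int (a 0)" "has_cfrac (1 / (x - of_int (a 0))) (\<lambda>i. a (Suc i))"
proof -
  have pos: "\<And>i. a i > 0" and lim: "cfrac_convergent a \<longlonglongrightarrow> x"
    using assms by (auto simp: has_cfrac_def)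
  define y where "y = cfrac_convergent (\<lambda>i. a (Suc i))"
  have yb: "of_int (a (Suc 0)) \<le> y n \<and> y n \<le> of_int (a (Suc 0)) + 1" for n
    unfolding y_def using cfrac_convergent_bounds[of "\<lambda>i. a (Suc i)" n] pos by simp
  have a1: "real_of_int (a (Suc 0)) \<ge> 1" using pos[of "Suc 0"] by linarith
  have "(\<lambda>n. cfrac_convergent a (Suc n)) \<longlonglongrightarrow> x" using lim by (rule LIMSEQ_Suc)
  then have l: "(\<lambda>n. 1 / y n) \<longlonglongrightarrow> x - of_int (a 0)"
    using tendsto_diff[OF _ tendsto_const[of "of_int (a 0)"], of "\<lambda>n. cfrac_convergent a (Suc n)" x sequentially]
    by (simp add: y_def)
  have "1 / (of_int (a (Suc 0)) + 1) \<le> 1 / y n" for n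
    using yb[of n] a1 by (intro divide_left_mono) auto
  then have "1 / (of_int (a (Suc 0)) + 1) \<le> x - of_int (a 0)"
    using l by (intro LIMSEQ_le_const) auto
  moreover have "1 / (real_of_int (a (Suc 0)) + 1) > 0" using a1 by simp
  ultimately show xa: "x > of_int (a 0)" by linarith
  have "(\<lambda>n. 1 / (1 / y n)) \<longlonglongrightarrow> 1 / (x - of_int (a 0))"
    using l xa by (intro tendsto_intros) auto
  then show "has_cfrac (1 / (x - of_int (a 0))) (\<lambda>i. a (Suc i))"
    using pos by (simp add: has_cfrac_def y_def)
qed

text \<open>The strict upper bound is the strict lower bound for the next complete quotient, which
  exceeds its first entry and hence 1.\<close>

lemma has_cfrac_step:
  assumes "has_cfrac x a"
  shows "has_cfrac (1 / (x - of_int (a 0))) (\<lambda>i. a (Suc i))"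
    and "of_int (a 0) < x" "x < of_int (a 0) + 1"
proof -
  show s: "has_cfrac (1 / (x - of_int (a 0))) (\<lambda>i. a (Suc i))" and 1: "of_int (a 0) < x"
    using has_cfrac_step_aux[OF assms] by auto
  have "a (Suc 0) > 0" using assms by (auto simp: has_cfrac_def)
  then have "real_of_int (a (Suc 0)) \<ge> 1" by linarith
  moreover have "of_int (a (Suc 0)) < 1 / (x - of_int (a 0))"
    using has_cfrac_step_aux(1)[OF s] by simp
  ultimately have "1 < 1 / (x - of_int (a 0))" by linarith
  then show "x < of_int (a 0) + 1" using 1 by (simp add: field_simps)
qed

lemma has_cfrac_floor: "has_cfrac x a \<Longrightarrow> a 0 = \<lfloor>x\<rfloor>"
  using has_cfrac_step(2,3)[of x a] by (intro floor_unique[symmetric]) auto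

lemma has_cfrac_unique:
  assumes "has_cfrac x a" "has_cfrac x b"
  shows "a i = b i"
  using assms
proof (induction i arbitrary: x a b)
  case 0
  then show ?case using has_cfrac_floor by metis
next
  case (Suc i)
  have "a 0 = b 0" using Suc.prems has_cfrac_floor by metis
  then show ?case
    using Suc.IH[OF has_cfrac_step(1)[OF Suc.prems(1)], of "\<lambda>i. b (Suc i)"] has_cfrac_step(1)[OF Suc.prems(2)]
    by simp
qed

subsection \<open>Conjugation in a real quadratic field\<close>

locale quad_radicand =
  fixes D :: nat
  assumes D1: "D > 1" and sqf: "squarefree D"
begin

abbreviation \<rho> :: real where "\<rho> \<equiv> sqrt (real D)"

abbreviation K :: "real set" where "K \<equiv> quad_field D"

lemma rho_sq: "\<rho> * \<rho> = real D" by simp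

lemma rho_algebraic_int: "algebraic_int \<rho>"
  by (intro algebraic_int_sqrt int_imp_algebraic_int) auto

lemma rho_irrational: "\<rho> \<notin> \<rat>"
proof
  assume "\<rho> \<in> \<rat>"
  then have "\<rho> \<in> \<int>" using rho_algebraic_int rational_algebraic_int_is_int by blast
  then obtain k where k: "\<rho> = of_int k" by (auto elim: Ints_cases)
  have "real D = of_int k * of_int k" using rho_sq k by metis
  then have "real_of_int (int D) = of_int (\<bar>k\<bar> ^ 2)" by (simp add: power2_eq_square)
  then have "int D = \<bar>k\<bar> ^ 2" using of_int_eq_iff by blast
  then have "int D = int (nat \<bar>k\<bar> ^ 2)" by simp
  then have D: "D = nat \<bar>k\<bar> ^ 2" by (simp only: of_nat_eq_iff)
  then have "nat \<bar>k\<bar> ^ 2 dvd D" by simp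
  then have "nat \<bar>k\<bar> dvd 1" using sqf unfolding squarefree_def by blast
  then show False using D D1 by simp
qed

lemma rat_rho_eq:
  assumes "x \<in> \<rat>" "y \<in> \<rat>" "u \<in> \<rat>" "v \<in> \<rat>" "x + y * \<rho> = u + v * \<rho>"
  shows "x = u" "y = v"
proof -
  show yv: "y = v"
  proof (rule ccontr)
    assume "y \<noteq> v"
    then have "\<rho> = (x - u) / (v - y)" using assms(5) by (simp add: field_simps)
    then have "\<rho> \<in> \<rat>" using assms by auto
    then show False using rho_irrational by simp
  qed
  show "x = u" using assms(5) yv by simp
qed

text \<open>The field lies inside the reals, so conjugation is defined through the rational
  coordinates, which are unique by \<open>rat_rho_eq\<close>.\<close>

definition cj :: "real \<Rightarrow> real" where
  "cj z = (THE z'. \<exists>x\<in>\<rat>. \<exists>y\<in>\<rat>. z = x + y * \<rho> \<and> z' = x - y * \<rho>)"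

lemma cj_eq:
  assumes "x \<in> \<rat>" "y \<in> \<rat>"
  shows "cj (x + y * \<rho>) = x - y * \<rho>"
  unfolding cj_def
proof (rule the_equality)
  show "\<exists>x'\<in>\<rat>. \<exists>y'\<in>\<rat>. x + y * \<rho> = x' + y' * \<rho> \<and> x - y * \<rho> = x' - y' * \<rho>"
    using assms by (intro bexI[of _ x] bexI[of _ y]) auto
  fix z' assume "\<exists>x'\<in>\<rat>. \<exists>y'\<in>\<rat>. x + y * \<rho> = x' + y' * \<rho> \<and> z' = x' - y' * \<rho>"
  then obtain x' y' where *: "x' \<in> \<rat>" "y' \<in> \<rat>" "x + y * \<rho> = x' + y' * \<rho>" "z' = x' - y' * \<rho>"
    by blast
  then show "z' = x - y * \<rho>" using rat_rho_eq[OF assms *(1,2,3)] by simp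
qed

lemma K_E:
  assumes "z \<in> K"
  obtains x y where "x \<in> \<rat>" "y \<in> \<rat>" "z = x + y * \<rho>"
  using assms by (auto simp: quad_field_def)

lemma K_I: "x \<in> \<rat> \<Longrightarrow> y \<in> \<rat> \<Longrightarrow> x + y * \<rho> \<in> K"
  by (auto simp: quad_field_def)

lemma K_rat: "x \<in> \<rat> \<Longrightarrow> x \<in> K" using K_I[of x 0] by simp

lemma cj_rat: "x \<in> \<rat> \<Longrightarrow> cj x = x" using cj_eq[of x 0] by simp

lemma K_rho: "\<rho> \<in> K" using K_I[of 0 1] by simp

lemma cj_K: "z \<in> K \<Longrightarrow> cj z \<in> K"
  by (elim K_E) (use K_I[of _ "- _"] in \<open>force simp: cj_eq\<close>)

lemma K_add: "z \<in> K \<Longrightarrow> z' \<in> K \<Longrightarrow> z + z' \<in> K \<and> cj (z + z') = cj z + cj z'"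
proof (elim K_E)
  fix x y u v assume *: "x \<in> \<rat>" "y \<in> \<rat>" "z = x + y * \<rho>" "u \<in> \<rat>" "v \<in> \<rat>" "z' = u + v * \<rho>"
  have "z + z' = (x + u) + (y + v) * \<rho>" using * by (simp add: algebra_simps)
  moreover have r: "x + u \<in> \<rat>" "y + v \<in> \<rat>" using * by auto
  moreover have "cj z + cj z' = (x + u) - (y + v) * \<rho>" using * by (simp add: cj_eq algebra_simps)
  ultimately show ?thesis using K_I[OF r] cj_eq[OF r] by simp
qed

lemma K_mult: "z \<in> K \<Longrightarrow> z' \<in> K \<Longrightarrow> z * z' \<in> K \<and> cj (z * z') = cj z * cj z'"
proof (elim K_E)
  fix x y u v assume *: "x \<in> \<rat>" "y \<in> \<rat>" "z = x + y * \<rho>" "u \<in> \<rat>" "v \<in> \<rat>" "z' = u + v * \<rho>"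
  have yv: "y * \<rho> * (v * \<rho>) = y * v * real D" using rho_sq by (metis mult.assoc mult.left_commute)
  have e: "z * z' = (x * u + y * v * real D) + (x * v + y * u) * \<rho>"
    using * yv by (simp add: algebra_simps)
  have r: "x * u + y * v * real D \<in> \<rat>" "x * v + y * u \<in> \<rat>" using * by auto
  have "cj z * cj z' = (x * u + y * v * real D) - (x * v + y * u) * \<rho>"
    using * yv by (simp add: cj_eq algebra_simps)
  then show ?thesis using K_I[OF r] cj_eq[OF r] e by simp
qed

lemma K_uminus: "z \<in> K \<Longrightarrow> - z \<in> K \<and> cj (- z) = - cj z"
  using K_mult[of "-1" z] K_rat[of "-1"] cj_rat[of "-1"] by simp

lemma K_diff: "z \<in> K \<Longrightarrow> z' \<in> K \<Longrightarrow> z - z' \<in> K \<and> cj (z - z') = cj z - cj z'"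
  using K_add[of z "- z'"] K_uminus[of z'] by simp

lemma cj_eq_0_iff: "z \<in> K \<Longrightarrow> cj z = 0 \<longleftrightarrow> z = 0"
proof (elim K_E)
  fix x y assume *: "x \<in> \<rat>" "y \<in> \<rat>" "z = x + y * \<rho>"
  have "x - y * \<rho> = 0 \<longleftrightarrow> x = 0 \<and> y = 0" using rat_rho_eq[of x "-y" 0 0] * by auto
  moreover have "x + y * \<rho> = 0 \<longleftrightarrow> x = 0 \<and> y = 0" using rat_rho_eq[of x y 0 0] * by auto
  ultimately show ?thesis using * cj_eq by simp
qed

lemma cj_cj: "z \<in> K \<Longrightarrow> cj (cj z) = z"
proof (elim K_E)
  fix x y assume *: "x \<in> \<rat>" "y \<in> \<rat>" "z = x + y * \<rho>"
  then show ?thesis using cj_eq[of x y] cj_eq[of x "-y"] by simp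
qed

lemma norm_rat: "z \<in> K \<Longrightarrow> z * cj z \<in> \<rat>"
proof (elim K_E)
  fix x y assume *: "x \<in> \<rat>" "y \<in> \<rat>" "z = x + y * \<rho>"
  then have "z * cj z = x * x - y * y * (\<rho> * \<rho>)" by (simp add: cj_eq algebra_simps)
  then show ?thesis using * by (simp only: rho_sq) auto
qed

lemma K_inverse: "z \<in> K \<Longrightarrow> inverse z \<in> K \<and> cj (inverse z) = inverse (cj z)"
proof (cases "z = 0")
  case True
  then show ?thesis using K_rat[of 0] cj_rat[of 0] by simp
next
  case False
  assume z: "z \<in> K"
  have n: "z * cj z \<in> \<rat>" "z * cj z \<noteq> 0" using norm_rat[OF z] cj_eq_0_iff[OF z] False by auto
  have e: "inverse z = inverse (z * cj z) * cj z" using n by (simp add: field_simps)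
  have r: "inverse (z * cj z) \<in> \<rat>" using n(1) by (rule Rats_inverse)
  have m: "inverse (z * cj z) * cj z \<in> K" "cj (inverse (z * cj z) * cj z) = inverse (z * cj z) * z"
    using K_mult[OF K_rat[OF r] cj_K[OF z]] unfolding cj_rat[OF r] cj_cj[OF z] by blast+
  have "cj (inverse z) = inverse (z * cj z) * z" by (subst e) (rule m(2))
  also have "\<dots> = inverse (cj z)" using n by (simp add: field_simps)
  finally have "cj (inverse z) = inverse (cj z)" .
  moreover have "inverse z \<in> K" by (subst e) (rule m(1))
  ultimately show ?thesis by blast
qed

lemma K_divide: "z \<in> K \<Longrightarrow> z' \<in> K \<Longrightarrow> z / z' \<in> K \<and> cj (z / z') = cj z / cj z'"
  using K_mult[of z "inverse z'"] K_inverse[of z'] by (simp add: divide_inverse)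

lemmas K_closed = K_add[THEN conjunct1] K_mult[THEN conjunct1] K_diff[THEN conjunct1]
  K_divide[THEN conjunct1] K_uminus[THEN conjunct1] K_inverse[THEN conjunct1] cj_K

lemma K_int [simp]: "of_int m \<in> K" "of_nat n \<in> K" "numeral k \<in> K" "1 \<in> K" "0 \<in> K"
  by (intro K_rat; simp)+

lemma cj_int [simp]: "cj (of_int m) = of_int m" "cj (of_nat n) = of_nat n" "cj (numeral k) = numeral k"
    "cj 1 = 1" "cj 0 = 0"
  by (intro cj_rat; simp)+

lemma totally_positive_iff: "totally_positive D z \<longleftrightarrow> z \<in> K \<and> z > 0 \<and> cj z > 0"
proof
  assume "totally_positive D z"
  then obtain x y where "x \<in> \<rat>" "y \<in> \<rat>" "z = x + y * \<rho>" "x + y * \<rho> > 0" "x - y * \<rho> > 0"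
    unfolding totally_positive_def by blast
  then show "z \<in> K \<and> z > 0 \<and> cj z > 0" using K_I cj_eq by simp
next
  assume z: "z \<in> K \<and> z > 0 \<and> cj z > 0"
  then obtain x y where "x \<in> \<rat>" "y \<in> \<rat>" "z = x + y * \<rho>" using K_E by blast
  then show "totally_positive D z" unfolding totally_positive_def using z cj_eq by auto
qed

end

subsection \<open>Cones of the lattice attached to a periodic continued fraction\<close>

definition zlat :: "real \<Rightarrow> real \<Rightarrow> real set" where
  "zlat x y = {of_int m * x + of_int n * y |m n. True}"

lemma zlatI: "of_int m * x + of_int n * y \<in> zlat x y"
  by (auto simp: zlat_def)

lemma zlatE:
  assumes "z \<in> zlat x y"
  obtains m n where "z = of_int m * x + of_int n * y"
  using assms by (auto simp: zlat_def)

lemma zlat_add: "z \<in> zlat x y \<Longrightarrow> z' \<in> zlat x y \<Longrightarrow> z + z' \<in> zlat x y"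
proof (elim zlatE)
  fix m n m' n' assume "z = of_int m * x + of_int n * y" "z' = of_int m' * x + of_int n' * y"
  then have "z + z' = of_int (m + m') * x + of_int (n + n') * y" by (simp add: algebra_simps)
  then show ?thesis by (simp only: zlatI)
qed

lemma zlat_mult_int: "z \<in> zlat x y \<Longrightarrow> of_int k * z \<in> zlat x y"
proof (elim zlatE)
  fix m n assume "z = of_int m * x + of_int n * y"
  then have "of_int k * z = of_int (k * m) * x + of_int (k * n) * y" by (simp add: algebra_simps)
  then show ?thesis using zlatI[of "k * m" x "k * n" y] by simp
qed

lemma zlat_left: "x \<in> zlat x y" and zlat_right: "y \<in> zlat x y"
  using zlatI[of 1 x 0 y] zlatI[of 0 x 1 y] by auto

lemma zlat_subset: "x \<in> zlat x' y' \<Longrightarrow> y \<in> zlat x' y' \<Longrightarrow> zlat x y \<subseteq> zlat x' y'"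
  by (auto elim!: zlatE[of _ x y] intro!: zlat_add zlat_mult_int)

lemma zlat_scale: "(\<lambda>z. c * z) ` zlat x y = zlat (c * x) (c * y)"
proof (intro equalityI subsetI)
  fix z assume "z \<in> (\<lambda>z. c * z) ` zlat x y"
  then obtain m n where "z = c * (of_int m * x + of_int n * y)" by (auto simp: zlat_def)
  then have "z = of_int m * (c * x) + of_int n * (c * y)" by (simp add: algebra_simps)
  then show "z \<in> zlat (c * x) (c * y)" by (simp only: zlatI)
next
  fix z assume "z \<in> zlat (c * x) (c * y)"
  then obtain m n where "z = of_int m * (c * x) + of_int n * (c * y)" by (rule zlatE)
  then have "z = c * (of_int m * x + of_int n * y)" by (simp add: algebra_simps)
  then show "z \<in> (\<lambda>z. c * z) ` zlat x y" using zlatI by blast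
qed

lemma exists_step:
  fixes f :: "nat \<Rightarrow> real"
  assumes "f 0 \<le> x" "x < f n"
  shows "\<exists>i<n. f i \<le> x \<and> x < f (Suc i)"
  using assms(2)
proof (induction n)
  case 0
  then show ?case using assms(1) by simp
next
  case (Suc n)
  then show ?case by (cases "x < f n") (auto intro: less_SucI)
qed

lemma exists_powi_in_interval:
  fixes x \<sigma> :: real
  assumes "x > 0" "\<sigma> > 1"
  shows "\<exists>k::int. 1 \<le> x * \<sigma> powi k \<and> x * \<sigma> powi k < \<sigma>"
proof -
  define l where "l = \<lfloor>log \<sigma> x\<rfloor>"
  have p: "\<sigma> powi k = \<sigma> powr (of_int k)" for k
    using assms by (simp add: powr_real_of_int')
  have x: "x = \<sigma> powr (log \<sigma> x)" using assms by simp
  have "\<sigma> powr (log \<sigma> x - of_int l) = \<sigma> powr (log \<sigma> x) * \<sigma> powr (of_int (- l))"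
    by (simp flip: powr_add)
  then have "x * \<sigma> powi (-l) = \<sigma> powr (log \<sigma> x - of_int l)"
    by (simp only: p x[symmetric])
  moreover have "0 \<le> log \<sigma> x - of_int l" "log \<sigma> x - of_int l < 1" unfolding l_def by linarith+
  moreover have "1 \<le> \<sigma> powr t" if "0 \<le> t" for t using that assms by (simp add: ge_one_powr_ge_zero)
  moreover have "\<sigma> powr t < \<sigma>" if "t < 1" for t using that assms powr_less_cancel_iff[of \<sigma> t 1] by simp
  ultimately show ?thesis by (intro exI[of _ "-l"]) simp
qed

locale cf_lattice = quad_radicand +
  fixes w :: real and s :: nat and a0 :: "nat \<Rightarrow> int"
  assumes wK: "w \<in> K" and w_irr: "w \<notin> \<rat>" and per: "has_periodic_cfrac w s a0"
begin

definition a :: "nat \<Rightarrow> int" where "a k = a0 (k mod s)"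

lemma s_pos: "s > 0" using per by (simp add: has_periodic_cfrac_def)

lemma a_period: "a (k + m * s) = a k" by (simp add: a_def)

text \<open>\<open>W k\<close> are the complete quotients and \<open>t k\<close> their conjugates. The vectors
  \<open>e k = 1 / (W 1 \<cdots> W k)\<close> alternate between totally positive and mixed signature, and \<open>c k\<close> is
  the absolute value of the conjugate of \<open>e k\<close>.\<close>

primrec W :: "nat \<Rightarrow> real" where
  "W 0 = w"
| "W (Suc k) = 1 / (W k - of_int (a k))"

lemma W_cfrac: "has_cfrac (W k) (\<lambda>j. a (k + j))"
proof (induction k)
  case 0
  then show ?case using per by (simp add: has_periodic_cfrac_def a_def)
next
  case (Suc k)
  show ?case using has_cfrac_step(1)[OF Suc] by simp
qed

lemma a_pos: "a k \<ge> 1"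
proof -
  have "a k > 0" using W_cfrac[of k] unfolding has_cfrac_def by (metis add_0_right)
  then show ?thesis by simp
qed

lemma a_real: "real_of_int (a k) \<ge> 1" using a_pos[of k] by linarith

lemma W_bounds: "of_int (a k) < W k" "W k < of_int (a k) + 1"
  using has_cfrac_step(2,3)[OF W_cfrac[of k]] by auto

lemma W_gt_1: "W k > 1" using W_bounds[of k] a_real[of k] by linarith

lemma W_period: "W (k + m * s) = W k"
proof -
  have "has_cfrac (W (k + m * s)) (\<lambda>j. a (k + j))"
  proof -
    have "a (k + m * s + j) = a (k + j)" for j using a_period[of "k + j" m] by (simp add: add_ac)
    then show ?thesis using W_cfrac[of "k + m * s"] by simp
  qed
  then have 1: "cfrac_convergent (\<lambda>j. a (k + j)) \<longlonglongrightarrow> W (k + m * s)" by (simp only: has_cfrac_def)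
  have 2: "cfrac_convergent (\<lambda>j. a (k + j)) \<longlonglongrightarrow> W k" using W_cfrac[of k] by (simp only: has_cfrac_def)
  show ?thesis by (rule LIMSEQ_unique[OF 1 2])
qed

lemma W_K: "W k \<in> K"
proof (induction k)
  case (Suc k)
  then have "1 / (W k - of_int (a k)) \<in> K" by (intro K_closed K_int)
  then show ?case by simp
qed (simp add: wK)

lemma W_irr: "W k \<notin> \<rat>"
proof (induction k)
  case (Suc k)
  show ?case
  proof
    assume "W (Suc k) \<in> \<rat>"
    then have "1 / W (Suc k) + of_int (a k) \<in> \<rat>" by (intro Rats_add Rats_divide) auto
    moreover have "1 / W (Suc k) + of_int (a k) = W k" by simp
    ultimately show False using Suc by (simp del: W.simps)
  qed
qed (simp add: w_irr)

definition t :: "nat \<Rightarrow> real" where "t k = cj (W k)"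

lemma t_Suc: "t (Suc k) = 1 / (t k - of_int (a k))"
  unfolding t_def W.simps
  using K_divide[of 1 "W k - of_int (a k)"] K_diff[of "W k" "of_int (a k)"] W_K[of k] by simp

lemma t_ne_W: "t k \<noteq> W k"
proof
  assume *: "t k = W k"
  obtain x y where xy: "x \<in> \<rat>" "y \<in> \<rat>" "W k = x + y * \<rho>" using W_K K_E by metis
  then have "x - y * \<rho> = x + y * \<rho>" using * cj_eq by (simp add: t_def)
  then have "y = 0" using D1 by simp
  then show False using xy W_irr[of k] by simp
qed

lemma t_period: "t (k + m * s) = t k" by (simp add: t_def W_period)

lemma t_step: "t k < 0 \<Longrightarrow> -1 < t (Suc k) \<and> t (Suc k) < 0"
proof -
  assume "t k < 0"
  then have "t k - of_int (a k) < -1" using a_real[of k] by linarith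
  then show ?thesis unfolding t_Suc by (simp add: field_simps)
qed

text \<open>If all conjugates were nonnegative, they would satisfy the same expanding recursion as the
  complete quotients, and the distance between both would grow strictly along a period.\<close>

lemma t_neg_ex: "\<exists>k. t k < 0"
proof (rule ccontr)
  assume "\<not> ?thesis"
  then have nn: "t k \<ge> 0" for k by (meson not_le)
  have "t k \<noteq> 0" for k using cj_eq_0_iff[OF W_K[of k]] W_gt_1[of k] by (simp add: t_def)
  then have pos: "t k > 0" for k using nn[of k] by (simp add: order.strict_iff_order)
  have gt1: "t k > of_int (a k)" for k using pos[of "Suc k"] by (simp add: t_Suc)
  have tk: "t k = of_int (a k) + 1 / t (Suc k)" for k using gt1[of k] by (simp add: t_Suc)
  have Wk: "W k = of_int (a k) + 1 / W (Suc k)" for k using W_bounds[of k] by simp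
  have "\<bar>t k - W k\<bar> < \<bar>t (Suc k) - W (Suc k)\<bar>" for k
  proof -
    have tW: "t (Suc k) * W (Suc k) > 1 * 1"
      using gt1[of "Suc k"] a_real[of "Suc k"] W_gt_1[of "Suc k"] by (intro mult_strict_mono) linarith+
    have "t k - W k = 1 / t (Suc k) - 1 / W (Suc k)" using tk[of k] Wk[of k] by linarith
    also have "\<dots> = (W (Suc k) - t (Suc k)) / (t (Suc k) * W (Suc k))"
      using pos[of "Suc k"] W_gt_1[of "Suc k"] by (simp add: diff_frac_eq del: W.simps)
    finally have "\<bar>t k - W k\<bar> = \<bar>t (Suc k) - W (Suc k)\<bar> / (t (Suc k) * W (Suc k))"
      using tW by (simp add: abs_divide abs_minus_commute del: W.simps)
    moreover have "\<bar>t (Suc k) - W (Suc k)\<bar> > 0" using t_ne_W[of "Suc k"] by simp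
    ultimately show ?thesis using tW by (simp add: divide_less_eq del: W.simps)
  qed
  then have "strict_mono (\<lambda>k. \<bar>t k - W k\<bar>)" by (simp only: strict_mono_Suc_iff) blast
  then have "\<bar>t 0 - W 0\<bar> < \<bar>t s - W s\<bar>" using s_pos by (rule strict_monoD)
  then show False using t_period[of 0 1] W_period[of 0 1] by simp
qed

text \<open>Galois' theorem that purely periodic continued fractions are reduced: by
  \<open>t_step\<close> one negative conjugate forces all later ones into the interval from -1 to 0,
  and periodicity carries this to every index.\<close>

lemma t_bounds: "-1 < t k" "t k < 0"
proof -
  obtain k0 where k0: "t k0 < 0" using t_neg_ex by blast
  have j: "-1 < t (Suc k0 + j) \<and> t (Suc k0 + j) < 0" for j
  proof (induction j)
    case 0
    then show ?case using t_step[OF k0] by simp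
  next
    case (Suc j)
    then show ?case using t_step[of "Suc k0 + j"] by simp
  qed
  \<comment> \<open>Enough periods are added to \<open>k\<close> to pass \<open>k0\<close>.\<close>
  have "Suc k0 \<le> k + Suc k0 * s" using s_pos by (cases s) auto
  then obtain j where "k + Suc k0 * s = Suc k0 + j" using le_Suc_ex by blast
  then have "t k = t (Suc k0 + j)" using t_period[of k "Suc k0"] by simp
  then show "-1 < t k" "t k < 0" using j[of j] by auto
qed

primrec e :: "nat \<Rightarrow> real" where
  "e 0 = 1"
| "e (Suc k) = (W k - of_int (a k)) * e k"

lemma e_pos: "e k > 0"
  using W_bounds by (induction k) auto

lemma e_W: "W (Suc k) * e (Suc k) = e k"
  using W_bounds[of k] by simp

lemma e_rec: "e k = e (Suc (Suc k)) + of_int (a (Suc k)) * e (Suc k)"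
  using e_W[of k] by (simp only: e.simps(2)[of "Suc k"] left_diff_distrib)

lemma e_dec: "e (Suc k) < e k"
  using W_bounds[of k] e_pos[of k] by simp

lemma e_K: "e k \<in> K"
  by (induction k) (auto intro!: K_closed K_int W_K)

definition c :: "nat \<Rightarrow> real" where "c k = (-1) ^ k * cj (e k)"

lemma c_Suc: "c (Suc k) = (of_int (a k) - t k) * c k"
proof -
  have "cj (W k - of_int (a k)) = t k - of_int (a k)" "W k - of_int (a k) \<in> K"
    using K_diff[of "W k" "of_int (a k)"] W_K[of k] by (auto simp: t_def)
  then have "cj (e (Suc k)) = (t k - of_int (a k)) * cj (e k)"
    using K_mult[OF _ e_K[of k], of "W k - of_int (a k)"] by simp
  then have "c (Suc k) = (-1) ^ Suc k * ((t k - of_int (a k)) * cj (e k))" by (simp only: c_def)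
  also have "\<dots> = (of_int (a k) - t k) * c k" by (simp add: c_def algebra_simps)
  finally show ?thesis .
qed

lemma c_0 [simp]: "c 0 = 1" by (simp add: c_def)

lemma c_pos: "c k > 0" and c_mono: "c k < c (Suc k)"
proof -
  have g: "of_int (a k) - t k > 1" for k using a_real[of k] t_bounds(2)[of k] by linarith
  show "c k > 0"
  proof (induction k)
    case (Suc k)
    then show ?case unfolding c_Suc using g[of k] by simp
  qed simp
  then show "c k < c (Suc k)" unfolding c_Suc using g[of k] by simp
qed

lemma cj_e: "cj (e k) = (-1) ^ k * c k" by (simp add: c_def flip: power_add mult_2 mult.assoc)

lemma e_period: "e (k + m * s) = e (m * s) * e k"
proof (induction k)
  case (Suc k)
  then show ?case using W_period[of k m] a_period[of k m] by simp
qed simp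

section \<open>The lattice and its bases of consecutive vectors\<close>

definition M :: "real set" where "M = unit_lattice (w + 1)"

text \<open>\<open>w + 1\<close> generates the lattice together with 1, and the recursion
  \<open>e_rec\<close> is a unimodular change between consecutive pairs.\<close>

lemma M_basis: "M = zlat (e k) (e (Suc k))"
proof (induction k)
  case 0
  show ?case
  proof (intro equalityI subsetI)
    fix z assume "z \<in> M"
    then obtain m n where "z = of_int m + of_int n * (w + 1)" by (auto simp: M_def unit_lattice_def)
    then have "z = of_int (m + n + n * a 0) * e 0 + of_int n * e (Suc 0)" by (simp add: algebra_simps)
    then show "z \<in> zlat (e 0) (e (Suc 0))" using zlatI by metis
  next
    fix z assume "z \<in> zlat (e 0) (e (Suc 0))"
    then obtain m n where "z = of_int m * e 0 + of_int n * e (Suc 0)" by (rule zlatE)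
    then have "z = of_int (m - n * a 0 - n) + of_int n * (w + 1)" by (simp add: algebra_simps)
    then show "z \<in> M" unfolding M_def unit_lattice_def by blast
  qed
next
  case (Suc k)
  have "e k \<in> zlat (e (Suc k)) (e (Suc (Suc k)))"
    by (subst e_rec) (intro zlat_add zlat_right zlat_mult_int zlat_left)
  moreover have "e (Suc (Suc k)) = of_int 1 * e k + of_int (- a (Suc k)) * e (Suc k)" using e_rec[of k] by simp
  then have "e (Suc (Suc k)) \<in> zlat (e k) (e (Suc k))" using zlatI by metis
  ultimately show ?case unfolding Suc
    by (intro equalityI zlat_subset zlat_left zlat_right)
qed

lemma e_indep:
  assumes "of_int m * e k + of_int n * e (Suc k) = of_int m' * e k + of_int n' * e (Suc k)"
  shows "m = m'" "n = n'"
proof -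
  have "(of_int (m - m') * W (Suc k) + of_int (n - n')) * e (Suc k)
      = of_int (m - m') * (W (Suc k) * e (Suc k)) + of_int (n - n') * e (Suc k)"
    by (simp only: distrib_right mult.assoc)
  also have "\<dots> = 0" unfolding e_W using assms by (simp add: algebra_simps)
  finally have *: "of_int (m - m') * W (Suc k) = of_int (n' - n)" using e_pos[of "Suc k"]
    by (simp del: W.simps e.simps)
  show mm: "m = m'"
  proof (rule ccontr)
    assume "m \<noteq> m'"
    then have "W (Suc k) = of_int (n' - n) / of_int (m - m')" using * by (simp add: field_simps del: W.simps)
    then show False using W_irr[of "Suc k"] by simp
  qed
  show "n = n'" using * mm by simp
qed

lemma M_K: "z \<in> M \<Longrightarrow> z \<in> K"
  by (auto simp: M_def unit_lattice_def intro!: K_closed K_int wK)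

lemma M_add: "x \<in> M \<Longrightarrow> y \<in> M \<Longrightarrow> x + y \<in> M" and M_int: "x \<in> M \<Longrightarrow> of_int k * x \<in> M"
  unfolding M_basis[of 0] by (rule zlat_add zlat_mult_int; assumption)+

lemma e_M: "e k \<in> M" unfolding M_basis[of k] by (rule zlat_left)

text \<open>The period has to be even for the unit \<open>\<eta>\<close> below to be totally positive.\<close>

definition len :: nat where "len = (if even s then s else 2 * s)"

definition p :: nat where "p = len div 2"

lemma len_eqs: "len = 2 * p" "\<exists>m. len = m * s" "p > 0"
  using s_pos by (auto simp: len_def p_def intro: exI[of _ 1] exI[of _ 2])

definition \<eta> :: real where "\<eta> = e len"

lemma e_len: "e (k + len) = \<eta> * e k" and W_len: "W (k + len) = W k"
  unfolding \<eta>_def using len_eqs(2) e_period W_period by auto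

lemma \<eta>_pos: "\<eta> > 0" unfolding \<eta>_def by (rule e_pos)

lemma \<eta>_K: "\<eta> \<in> K" unfolding \<eta>_def by (rule e_K)

lemma \<eta>_slope: "cj \<eta> > \<eta>"
proof -
  have "strict_mono c" using c_mono by (simp only: strict_mono_Suc_iff) blast
  then have "c 0 < c len" using len_eqs by (intro strict_monoD[of c]) auto
  moreover have "cj \<eta> = c len" unfolding \<eta>_def cj_e using len_eqs by simp
  moreover have "strict_mono (\<lambda>k. - e k)" using e_dec by (simp only: strict_mono_Suc_iff) force
  then have "- e 0 < - e len" using len_eqs by (intro strict_monoD[of "\<lambda>k. - e k"]) auto
  ultimately show ?thesis by (simp add: \<eta>_def)
qed

lemma \<eta>_M: "(\<lambda>z. \<eta> * z) ` M = M"
  using e_len[of 0] e_len[of "Suc 0"] M_basis[of len] unfolding M_basis[of 0] zlat_scale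
  by (simp del: e.simps)

declare e.simps(2) [simp del] W.simps(2) [simp del]

section \<open>The chain of totally positive vectors and its cones\<close>

definition N :: "nat \<Rightarrow> nat" where "N i = nat (a (2 * i + 1))"

lemma N_real: "real (N i) = of_int (a (2 * i + 1))"
  using a_pos[of "2 * i + 1"] by (simp add: N_def)

lemma N_pos: "N i > 0" using a_pos[of "2 * i + 1"] by (simp add: N_def)

text \<open>For \<open>j = 0, ..., N i\<close> these are the lattice points on the segment from
  \<open>e (2 * i)\<close> to \<open>e (2 * i + 2)\<close>.\<close>

definition u :: "nat \<Rightarrow> nat \<Rightarrow> real" where
  "u i j = e (2 * i) - real j * e (2 * i + 1)"

lemma e_rec2: "e (2 * i) = e (2 * Suc i) + real (N i) * e (2 * i + 1)"
  using e_rec[of "2 * i"] by (simp add: N_real del: e.simps)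

lemma u_0: "u i 0 = e (2 * i)" by (simp add: u_def)

lemma u_N: "u i (N i) = e (2 * Suc i)" using e_rec2[of i] by (simp add: u_def del: e.simps)

lemma u_pos: "j \<le> N i \<Longrightarrow> u i j > 0"
proof -
  assume "j \<le> N i"
  then have "real j * e (2 * i + 1) \<le> real (N i) * e (2 * i + 1)"
    using e_pos[of "2 * i + 1"] by (intro mult_right_mono) auto
  then show ?thesis using e_rec2[of i] e_pos[of "2 * Suc i"] by (simp add: u_def del: e.simps)
qed

lemma u_M: "u i j \<in> M"
proof -
  have "u i j = e (2 * i) + of_int (- int j) * e (2 * i + 1)" by (simp add: u_def)
  then show ?thesis using M_add[OF e_M[of "2 * i"] M_int[OF e_M[of "2 * i + 1"], of "- int j"]] by simp
qed

lemma u_K: "u i j \<in> K" using u_M M_K by blast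

lemma cj_u: "cj (u i j) = c (2 * i) + real j * c (2 * i + 1)"
  unfolding u_def using K_diff[OF e_K K_closed(2)[OF K_int(2) e_K]] K_mult[OF K_int(2) e_K]
  by (simp add: cj_e del: e.simps)

lemma cj_u_pos: "cj (u i j) > 0"
  unfolding cj_u using c_pos[of "2 * i"] c_pos[of "2 * i + 1"] by (simp add: add_pos_nonneg)

text \<open>This orders the rays in the totally positive quadrant. It is multiplicative, so
  multiplication by a unit changes it by a fixed factor.\<close>

definition slope :: "real \<Rightarrow> real" where "slope z = cj z / z"

lemma u_Suc: "u i (Suc j) < u i j" "cj (u i j) < cj (u i (Suc j))"
  using e_pos[of "2 * i + 1"] c_pos[of "2 * i + 1"] unfolding cj_u
  by (auto simp: u_def algebra_simps simp del: e.simps)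

text \<open>The determinant of two neighbouring vectors under the embedding of \<open>z\<close> as
  the pair of \<open>z\<close> and \<open>cj z\<close>; it serves as denominator in Cramer's
  rule.\<close>

definition dt :: "nat \<Rightarrow> nat \<Rightarrow> real" where
  "dt i j = cj (u i (Suc j)) * u i j - cj (u i j) * u i (Suc j)"

lemma dt_pos: "j < N i \<Longrightarrow> dt i j > 0"
  unfolding dt_def using u_Suc[of i j] cj_u_pos[of i j] u_pos[of j i] u_pos[of "Suc j" i]
  by (smt (verit, ccfv_SIG) Suc_leI less_imp_le_nat mult_strict_mono)

lemma slope_u_Suc: "j < N i \<Longrightarrow> slope (u i j) < slope (u i (Suc j))"
  using dt_pos[of j i] u_pos[of j i] u_pos[of "Suc j" i]
  by (simp add: slope_def dt_def divide_less_eq less_divide_eq field_simps)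

lemma slope_u_mono: "j \<le> j' \<Longrightarrow> j' \<le> N i \<Longrightarrow> slope (u i j) \<le> slope (u i j')"
proof (induction j' rule: dec_induct)
  case (step n)
  then show ?case using slope_u_Suc[of n i] by simp
qed simp

lemma slope_e_Suc: "slope (e (2 * i)) < slope (e (2 * Suc i))"
  using slope_u_Suc[of 0 i] slope_u_mono[of "Suc 0" "N i" i] N_pos[of i] unfolding u_0 u_N by simp

lemma slope_e_mono: "i \<le> i' \<Longrightarrow> slope (e (2 * i)) \<le> slope (e (2 * i'))"
proof (induction i' rule: dec_induct)
  case (step n)
  then show ?case using slope_e_Suc[of n] by simp
qed simp

text \<open>The totally positive points of the half-open cone between \<open>u i j\<close> and \<open>u i (Suc j)\<close>
  that contains the ray through \<open>u i j\<close>.\<close>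

definition cone_pt :: "nat \<Rightarrow> nat \<Rightarrow> nat \<Rightarrow> nat \<Rightarrow> real" where
  "cone_pt i j m n = real (Suc m) * u i j + real n * u i (Suc j)"

lemma cone_pt_M: "cone_pt i j m n \<in> M"
  using M_add[OF M_int[OF u_M, of "int (Suc m)"] M_int[OF u_M, of "int n"]]
  by (simp add: cone_pt_def del: of_nat_Suc)

lemma cj_comb:
  "cj (real m * u i j + real n * u i' j') = real m * cj (u i j) + real n * cj (u i' j')"
  using K_add[OF K_closed(2)[OF K_int(2) u_K] K_closed(2)[OF K_int(2) u_K]] K_mult[OF K_int(2) u_K] by simp

lemma cone_pt_pos: "j < N i \<Longrightarrow> cone_pt i j m n > 0"
  using u_pos[of j i] u_pos[of "Suc j" i] by (simp add: cone_pt_def add_pos_nonneg del: of_nat_Suc)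

lemma cj_cone_pt: "cj (cone_pt i j m n) = real (Suc m) * cj (u i j) + real n * cj (u i (Suc j))"
  unfolding cone_pt_def by (rule cj_comb)

lemma cj_cone_pt_pos: "cj (cone_pt i j m n) > 0"
  unfolding cj_cone_pt using cj_u_pos by (simp add: add_pos_nonneg less_imp_le del: of_nat_Suc)

lemma cone_pt_slope:
  assumes "j < N i"
  shows "slope (u i j) \<le> slope (cone_pt i j m n)" "slope (cone_pt i j m n) < slope (u i (Suc j))"
proof -
  have p: "u i j > 0" "u i (Suc j) > 0" "cone_pt i j m n > 0"
    using assms u_pos cone_pt_pos by auto
  have "cj (cone_pt i j m n) * u i j - cj (u i j) * cone_pt i j m n = real n * dt i j"
    unfolding cj_cone_pt unfolding cone_pt_def dt_def by (simp add: algebra_simps)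
  moreover have "real n * dt i j \<ge> 0" using dt_pos[OF assms] by simp
  ultimately show "slope (u i j) \<le> slope (cone_pt i j m n)"
    using p by (simp add: slope_def field_simps)
  have "cj (u i (Suc j)) * cone_pt i j m n - cj (cone_pt i j m n) * u i (Suc j) = real (Suc m) * dt i j"
    unfolding cj_cone_pt unfolding cone_pt_def dt_def by (simp add: algebra_simps)
  moreover have "real (Suc m) * dt i j > 0" using dt_pos[OF assms] by simp
  ultimately show "slope (cone_pt i j m n) < slope (u i (Suc j))"
    using p by (simp add: slope_def field_simps)
qed

lemma slope_e_0: "slope (e (2 * 0)) = 1" by (simp add: slope_def)

lemma cone_pt_slope_e:
  assumes "j < N i"
  shows "slope (e (2 * i)) \<le> slope (cone_pt i j m n)" "slope (cone_pt i j m n) < slope (e (2 * Suc i))"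
  using cone_pt_slope[OF assms, of m n] slope_u_mono[of 0 j i] slope_u_mono[of "Suc j" "N i" i] assms
  unfolding u_0 u_N by auto

lemma u_basis: "zlat (u i j) (e (2 * i + 1)) = M" and u_u_basis: "zlat (u i j) (u i (Suc j)) = M"
proof -
  have 1: "e (2 * i) \<in> zlat (u i j) (e (2 * i + 1))"
    using zlatI[of 1 "u i j" "int j" "e (2 * i + 1)"] by (simp add: u_def del: e.simps)
  have 2: "e (2 * i + 1) \<in> zlat (u i j) (u i (Suc j))"
    using zlatI[of 1 "u i j" "-1" "u i (Suc j)"] by (simp add: u_def algebra_simps del: e.simps)
  have M1: "M = zlat (e (2 * i)) (e (2 * i + 1))" using M_basis[of "2 * i"] by (simp del: e.simps)
  have s1: "M \<subseteq> zlat (u i j) (e (2 * i + 1))" unfolding M1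
    by (intro zlat_subset 1 zlat_right)
  have s2: "zlat (u i j) (e (2 * i + 1)) \<subseteq> zlat (u i j) (u i (Suc j))"
    by (intro zlat_subset 2 zlat_left)
  have s3: "zlat (u i j) (u i (Suc j)) \<subseteq> M"
    using u_M unfolding M1 by (intro zlat_subset)
  show "zlat (u i j) (e (2 * i + 1)) = M" "zlat (u i j) (u i (Suc j)) = M"
    using s1 s2 s3 by auto
qed

text \<open>The slopes of the vectors \<open>u i j\<close> increase from 1 to
  \<open>slope \<eta>\<close>, so some neighbouring pair encloses the slope of \<open>z\<close>.
  That pair is a basis of \<open>M\<close>, and by Cramer's rule the two slope inequalities are the
  signs of the integer coordinates.\<close>

lemma cone_cover:
  assumes z: "z \<in> M" "z > 0" and s: "1 \<le> slope z" "slope z < slope \<eta>"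
  shows "\<exists>i<p. \<exists>j<N i. \<exists>m n. z = cone_pt i j m n"
proof -
  have "\<exists>i<p. slope (e (2 * i)) \<le> slope z \<and> slope z < slope (e (2 * Suc i))"
    by (rule exists_step) (use s slope_e_0 len_eqs(1) in \<open>auto simp: \<eta>_def\<close>)
  then obtain i where i: "i < p" "slope (e (2 * i)) \<le> slope z" "slope z < slope (e (2 * Suc i))" by blast
  have "\<exists>j<N i. slope (u i j) \<le> slope z \<and> slope z < slope (u i (Suc j))"
    by (rule exists_step) (use i in \<open>simp_all only: u_0 u_N\<close>)
  then obtain j where j: "j < N i" "slope (u i j) \<le> slope z" "slope z < slope (u i (Suc j))" by blast
  obtain x y where xy: "z = of_int x * u i j + of_int y * u i (Suc j)"
    using z(1) unfolding u_u_basis[of i j, symmetric] by (rule zlatE)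
  have cz: "cj z = of_int x * cj (u i j) + of_int y * cj (u i (Suc j))"
    unfolding xy using K_add[OF K_closed(2)[OF K_int(1) u_K] K_closed(2)[OF K_int(1) u_K]]
      K_mult[OF K_int(1) u_K] by simp
  have p: "u i j > 0" "u i (Suc j) > 0" using j u_pos by auto
  have "of_int y * dt i j = cj z * u i j - cj (u i j) * z"
    unfolding cz dt_def by (simp add: xy algebra_simps)
  also have "\<dots> \<ge> 0" using j(2) p z by (simp add: slope_def field_simps)
  finally have y: "y \<ge> 0" using dt_pos[OF j(1)] by (simp add: zero_le_mult_iff)
  have "of_int x * dt i j = cj (u i (Suc j)) * z - cj z * u i (Suc j)"
    unfolding cz dt_def by (simp add: xy algebra_simps)
  also have "\<dots> > 0" using j(3) p z by (simp add: slope_def field_simps)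
  finally have x: "x > 0" using dt_pos[OF j(1)] by (simp add: zero_less_mult_iff)
  have "z = cone_pt i j (nat (x - 1)) (nat y)"
    unfolding cone_pt_def using x y by (simp add: xy of_nat_diff)
  then show ?thesis using i j by blast
qed

lemma u_indep:
  assumes "j < N i" "of_int x * u i j + of_int y * u i (Suc j) = of_int x' * u i j + of_int y' * u i (Suc j)"
  shows "x = x'" "y = y'"
proof -
  have ex: "of_int (x + y) * e (2 * i) + of_int (- int j * x - int (Suc j) * y) * e (Suc (2 * i))
    = of_int x * u i j + of_int y * u i (Suc j)" for x y
    by (simp add: u_def algebra_simps)
  have "of_int (x + y) * e (2 * i) + of_int (- int j * x - int (Suc j) * y) * e (Suc (2 * i))
    = of_int (x' + y') * e (2 * i) + of_int (- int j * x' - int (Suc j) * y') * e (Suc (2 * i))"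
    unfolding ex by (rule assms(2))
  note * = e_indep[OF this]
  have "int j * (x + y) + y = int j * (x' + y') + y'" using *(2) by (simp add: algebra_simps)
  then show "y = y'" using *(1) by simp
  then show "x = x'" using *(1) by simp
qed

lemma cone_pt_inj:
  assumes "i < p" "j < N i" "i' < p" "j' < N i'" "cone_pt i j m n = cone_pt i' j' m' n'"
  shows "i = i'" "j = j'" "m = m'" "n = n'"
proof -
  have aux: "\<not> i < i'" if "j < N i" "j' < N i'" "cone_pt i j m n = cone_pt i' j' m' n'" for i j m n i' j' m' n'
    using cone_pt_slope_e(2)[OF that(1), of m n] cone_pt_slope_e(1)[OF that(2), of m' n'] that(3)
      slope_e_mono[of "Suc i" i'] by force
  show i: "i = i'" using aux[of j i j' i' m n m' n'] aux[of j' i' j i m' n' m n] assms by force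
  have aux2: "\<not> j < j'" if "j < N i" "j' < N i" "cone_pt i j m n = cone_pt i j' m' n'" for j m n j' m' n'
    using cone_pt_slope(2)[OF that(1), of m n] cone_pt_slope(1)[OF that(2), of m' n'] that
      slope_u_mono[of "Suc j" j' i] by force
  show j: "j = j'" using aux2[of j j' m n m' n'] aux2[of j' j m' n' m n] assms i by force
  have "of_int (int (Suc m)) * u i j + of_int (int n) * u i (Suc j)
      = of_int (int (Suc m')) * u i j + of_int (int n') * u i (Suc j)"
    using assms(5) i j by (simp add: cone_pt_def)
  from u_indep[OF assms(2) this] show "m = m'" "n = n'" by auto
qed

section \<open>Reduction by powers of the unit\<close>

lemma slope_\<eta>: "slope \<eta> > 1" using \<eta>_slope \<eta>_pos by (simp add: slope_def)

lemma slope_mult: "x \<in> K \<Longrightarrow> y \<in> K \<Longrightarrow> slope (x * y) = slope x * slope y"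
  using K_mult[of x y] by (simp add: slope_def)

lemma powi_K: "x \<in> K \<Longrightarrow> x powi k \<in> K \<and> cj (x powi k) = cj x powi k"
proof -
  assume x: "x \<in> K"
  have n: "x ^ n \<in> K \<and> cj (x ^ n) = cj x ^ n" for n
  proof (induction n)
    case (Suc n)
    then show ?case using K_mult[OF x, of "x ^ n"] by simp
  qed simp
  show ?thesis
  proof (cases "k \<ge> 0")
    case True
    then show ?thesis using n[of "nat k"] by (simp add: power_int_def)
  next
    case False
    then show ?thesis using n[of "nat (-k)"] K_inverse[of "x ^ nat (-k)"]
      by (simp add: power_int_def power_inverse)
  qed
qed

lemma slope_\<eta>_powi: "slope (\<eta> powi k) = slope \<eta> powi k"
  using powi_K[OF \<eta>_K, of k] by (simp add: slope_def power_int_divide_distrib)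

lemma \<eta>_powi_M: "z \<in> M \<Longrightarrow> \<eta> powi k * z \<in> M"
proof -
  have 1: "\<eta> ^ n * z \<in> M" if "z \<in> M" for n z using that
  proof (induction n)
    case (Suc n)
    then have "\<eta> * (\<eta> ^ n * z) \<in> M" using \<eta>_M by blast
    then show ?case by (simp add: mult.assoc)
  qed simp
  have 2: "inverse (\<eta> ^ n) * z \<in> M" if "z \<in> M" for n z using that
  proof (induction n arbitrary: z)
    case (Suc n)
    obtain y where y: "y \<in> M" "z = \<eta> * y" using \<eta>_M Suc.prems by blast
    have e: "inverse (\<eta> ^ Suc n) * z = inverse (\<eta> ^ n) * y" using y \<eta>_pos by simp
    show ?case unfolding e by (rule Suc.IH[OF y(1)])
  qed simp
  assume z: "z \<in> M"
  show ?thesis using 1[OF z] 2[OF z] by (cases "k \<ge> 0") (auto simp: power_int_def power_inverse)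
qed

lemma reduce_slope:
  assumes "z \<in> K" "z > 0" "cj z > 0"
  shows "\<exists>k. 1 \<le> slope (\<eta> powi k * z) \<and> slope (\<eta> powi k * z) < slope \<eta>"
proof -
  obtain k where "1 \<le> slope z * slope \<eta> powi k \<and> slope z * slope \<eta> powi k < slope \<eta>"
    using exists_powi_in_interval[of "slope z" "slope \<eta>"] slope_\<eta> assms by (auto simp: slope_def)
  then show ?thesis
    using slope_mult[OF conjunct1[OF powi_K[OF \<eta>_K]] assms(1)] slope_\<eta>_powi by (auto simp: mult.commute)
qed

lemma t0: "cj w = t 0" by (simp add: t_def)

lemma cj_int_comb: "cj (of_int m + of_int n * w) = of_int m + of_int n * cj w"
  using K_add[OF K_int(1) K_closed(2)[OF K_int(1) wK]] K_mult[OF K_int(1) wK] by simp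

lemma M_alt: "z \<in> M \<longleftrightarrow> (\<exists>m n. z = of_int m + of_int n * w)"
proof
  assume "z \<in> M"
  then obtain m n where "z = of_int m + of_int n * (w + 1)" by (auto simp: M_def unit_lattice_def)
  then have "z = of_int (m + n) + of_int n * w" by (simp add: algebra_simps)
  then show "\<exists>m n. z = of_int m + of_int n * w" by blast
next
  assume "\<exists>m n. z = of_int m + of_int n * w"
  then obtain m n where "z = of_int m + of_int n * w" by blast
  then have "z = of_int (m - n) + of_int n * (w + 1)" by (simp add: algebra_simps)
  then show "z \<in> M" unfolding M_def unit_lattice_def by blast
qed

text \<open>The difference \<open>z - cj z\<close> is an integer multiple of
  \<open>w - cj w\<close>, which exceeds 1 because \<open>w\<close> is reduced. So \<open>z\<close>
  would be an integer strictly between 0 and 1.\<close>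

lemma one_indecomposable:
  assumes "z \<in> M" "0 < z" "z < 1" "0 < cj z" "cj z < 1"
  shows False
proof -
  obtain m n where mn: "z = of_int m + of_int n * w" using assms(1) M_alt by blast
  have d: "z - cj z = of_int n * (w - cj w)" unfolding mn cj_int_comb by (simp add: algebra_simps)
  have w: "w - cj w > 1" using W_gt_1[of 0] t_bounds(2)[of 0] t0 by simp
  have "\<bar>of_int n * (w - cj w)\<bar> < 1" unfolding d[symmetric] using assms by linarith
  then have "real_of_int \<bar>n\<bar> * (w - cj w) < 1" using w by (simp add: abs_mult)
  moreover have "real_of_int \<bar>n\<bar> * 1 \<le> real_of_int \<bar>n\<bar> * (w - cj w)" using w by (intro mult_left_mono) auto
  ultimately have "real_of_int \<bar>n\<bar> < 1" by linarith
  then have "n = 0" by linarith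
  then have "0 < m \<and> m < 1" using assms mn by simp
  then show False by linarith
qed

text \<open>Minimality of \<open>s\<close> enters the proof here: a shift by \<open>d\<close> is
  also a shift by \<open>d mod s\<close>.\<close>

lemma shift_imp_dvd:
  assumes "\<And>j. a (j + d) = a j"
  shows "s dvd d"
proof (rule ccontr)
  assume "\<not> s dvd d"
  then have "0 < d mod s" "d mod s < s" using s_pos by (auto simp: dvd_eq_mod_eq_0)
  then obtain j where "a0 ((j + d mod s) mod s) \<noteq> a0 (j mod s)"
    using per unfolding has_periodic_cfrac_def by blast
  moreover have "(j + d mod s) mod s = (j + d) mod s" by presburger
  ultimately show False using assms[of j] by (simp add: a_def)
qed

text \<open>The unit \<open>\<epsilon>\<close> is indecomposable because 1 is, hence it is one of the vectors \<open>u i j\<close>. Comparing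
  the bases \<open>\<epsilon>, \<epsilon> w\<close> and \<open>u i j, e (2 i + 1)\<close> of \<open>M\<close> shows that the continued fraction is
  invariant under the shift by \<open>2 i\<close>.\<close>

lemma unit_eq_1:
  assumes \<epsilon>: "\<epsilon> \<in> K" "\<epsilon> > 0" "cj \<epsilon> > 0" and \<epsilon>M: "(\<lambda>z. \<epsilon> * z) ` M = M"
    and s: "1 \<le> slope \<epsilon>" "slope \<epsilon> < slope \<eta>"
  shows "\<epsilon> = 1"
proof -
  have one: "1 \<in> M" using e_M[of 0] by simp
  have divM: "z / \<epsilon> \<in> M" if "z \<in> M" for z
  proof -
    obtain y where "y \<in> M" "z = \<epsilon> * y" using \<epsilon>M \<open>z \<in> M\<close> by blast
    then show ?thesis using \<epsilon> by simp
  qed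
  have cjdiv: "cj (z / \<epsilon>) = cj z / cj \<epsilon>" if "z \<in> K" for z using K_divide[OF that \<epsilon>(1)] by simp
  have "\<epsilon> * 1 \<in> M" using \<epsilon>M one by blast
  then obtain i j m n where ij: "i < p" "j < N i" "\<epsilon> = cone_pt i j m n"
    using cone_cover[OF _ \<epsilon>(2) s] by auto
  have upos: "u i j > 0" "u i (Suc j) > 0" "cj (u i j) > 0" "cj (u i (Suc j)) > 0"
    using u_pos cj_u_pos ij by auto
  \<comment> \<open>Otherwise \<open>\<epsilon>\<close> exceeds \<open>u i j\<close> in both
    embeddings, and \<open>u i j / \<epsilon>\<close> contradicts \<open>one_indecomposable\<close>.
    The same argument gives \<open>m = 0\<close>.\<close>
  have n0: "n = 0"
  proof (rule ccontr)
    assume "n \<noteq> 0"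
    then have n: "real n \<ge> 1" by simp
    have "u i j < \<epsilon>" "cj (u i j) < cj \<epsilon>"
    proof -
      have 1: "1 * u i j \<le> real (Suc m) * u i j" "1 * cj (u i j) \<le> real (Suc m) * cj (u i j)"
        using upos by (intro mult_right_mono; simp)+
      have 2: "0 < real n * u i (Suc j)" "0 < real n * cj (u i (Suc j))" using upos n by auto
      show "u i j < \<epsilon>" "cj (u i j) < cj \<epsilon>"
        using 1 2 unfolding ij(3) cj_cone_pt unfolding cone_pt_def by linarith+
    qed
    then show False
      using one_indecomposable[OF divM[OF u_M[of i j]]] cjdiv[OF u_K] upos \<epsilon> by simp
  qed
  have m0: "m = 0"
  proof (rule ccontr)
    assume "m \<noteq> 0"
    then have "1 * u i j < real (Suc m) * u i j" "1 * cj (u i j) < real (Suc m) * cj (u i j)"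
      using upos by (intro mult_strict_right_mono; simp)+
    then have "u i j < \<epsilon>" "cj (u i j) < cj \<epsilon>"
      using n0 unfolding ij(3) cj_cone_pt unfolding cone_pt_def by auto
    then show False
      using one_indecomposable[OF divM[OF u_M[of i j]]] cjdiv[OF u_K] upos \<epsilon> by simp
  qed
  have \<epsilon>u: "\<epsilon> = u i j" using ij(3) m0 n0 by (simp add: cone_pt_def)
  \<comment> \<open>Division by \<open>\<epsilon>\<close> maps the basis \<open>u i j\<close>,
    \<open>e (2 * i + 1)\<close> of \<open>M\<close> to the basis 1, \<open>z\<close>. Hence
    \<open>z\<close> is an integer plus or minus \<open>w\<close>; the signs of \<open>z\<close> and
    its conjugate will decide for plus.\<close>
  define z where "z = e (2 * i + 1) / \<epsilon>"
  have zM: "z \<in> M" unfolding z_def by (rule divM[OF e_M])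
  have z0: "z > 0" unfolding z_def using e_pos \<epsilon> by simp
  have cz: "cj z = - c (2 * i + 1) / (c (2 * i) + real j * c (2 * i + 1))"
  proof -
    have "cj z = cj (e (2 * i + 1)) / cj \<epsilon>" unfolding z_def by (rule cjdiv[OF e_K])
    then show ?thesis unfolding cj_e \<epsilon>u cj_u by simp
  qed
  have zneg: "cj z < 0" unfolding cz using c_pos[of "2 * i"] c_pos[of "2 * i + 1"]
    by (simp add: divide_neg_pos add_pos_nonneg)
  obtain m y where my: "z = of_int m + of_int y * w" using zM M_alt by blast
  have w: "w - cj w > 1" using W_gt_1[of 0] t_bounds(2)[of 0] t0 by simp
  have "w * \<epsilon> \<in> M"
  proof -
    have "w \<in> M" using M_alt[of w] by (metis add_0 of_int_0 of_int_1 mult_1)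
    then have "\<epsilon> * w \<in> M" using \<epsilon>M by blast
    then show ?thesis by (simp add: mult.commute)
  qed
  then obtain m' y' where "w * \<epsilon> = of_int m' * \<epsilon> + of_int y' * e (2 * i + 1)"
    unfolding u_basis[of i j, symmetric] \<epsilon>u[symmetric] by (rule zlatE)
  then have "w = of_int m' + of_int y' * z" using \<epsilon> by (simp add: z_def field_simps)
  then have "w = of_int (m' + y' * m) + of_int (y' * y) * w" unfolding my by (simp add: algebra_simps)
  then have wy: "of_int (1 - y' * y) * w = of_int (m' + y' * m)" by (simp add: algebra_simps)
  have "y' * y = 1"
  proof (rule ccontr)
    assume "y' * y \<noteq> 1"
    then have "real_of_int (1 - y' * y) \<noteq> 0" by (simp only: of_int_eq_0_iff)
    then have "w = of_int (m' + y' * m) / of_int (1 - y' * y)" using wy by (simp add: field_simps)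
    then have "w \<in> \<rat>" by (metis Rats_divide Rats_of_int)
    then show False using w_irr by simp
  qed
  then have "y dvd 1" by (metis dvd_triv_right)
  moreover have "y > 0"
  proof -
    have "z - cj z = of_int y * (w - cj w)" unfolding my cj_int_comb by (simp add: algebra_simps)
    then have "of_int y * (w - cj w) > 0" using z0 zneg by linarith
    then show ?thesis using w by (simp add: zero_less_mult_iff)
  qed
  ultimately have "y = 1" by (simp add: zdvd1_eq)
  then have zw: "z = of_int m + w" using my by simp
  have cjz: "cj z = of_int m + cj w" using cj_int_comb[of m 1] zw by simp
  show ?thesis
  proof (cases "j = 0")
    case True
    \<comment> \<open>Now \<open>z\<close> is the fractional part of \<open>W (2 * i)\<close> and
      differs from \<open>w\<close> by an integer. So the fractional parts of
      \<open>W (2 * i)\<close> and \<open>w\<close> coincide, and with them all later complete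
      quotients.\<close>
    have "z = W (2 * i) - of_int (a (2 * i))"
      using e_pos[of "2 * i"] by (simp add: z_def \<epsilon>u True u_0 e.simps(2))
    then have "of_int m + W 0 = W (2 * i) - of_int (a (2 * i))" using zw by simp
    then have "of_int m = - real_of_int (a 0) \<and> W (2 * i) - of_int (a (2 * i)) = W 0 - of_int (a 0)"
    proof -
      assume *: "of_int m + W 0 = W (2 * i) - of_int (a (2 * i))"
      have "real_of_int (- m) = of_int (a 0)"
      proof -
        have "real_of_int (- m) < of_int (a 0 + 1)" "real_of_int (a 0) < of_int (- m + 1)"
          using * W_bounds[of 0] W_bounds[of "2 * i"] by simp_all
        then have "- m < a 0 + 1" "a 0 < - m + 1" by (simp_all only: of_int_less_iff)
        then show ?thesis by simp
      qed
      then show ?thesis using * by simp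
    qed
    then have W1: "W (Suc (2 * i)) = W (Suc 0)" by (simp add: W.simps)
    have "a (Suc (2 * i) + j) = a (Suc 0 + j)" for j
      using has_cfrac_unique[OF W_cfrac[of "Suc (2 * i)"], of "\<lambda>j. a (Suc 0 + j)" j] W_cfrac[of "Suc 0"] W1 by simp
    then have sh: "a (Suc j + 2 * i) = a (Suc j)" for j by (simp add: add_ac)
    \<comment> \<open>The comparison of quotients starts at index 1; index 0 is reached by adding a
      period.\<close>
    have "a (j + 2 * i) = a j" for j
    proof (cases j)
      case 0
      obtain s' where s': "s = Suc s'" using s_pos by (cases s) auto
      have "a (2 * i) = a (Suc s' + 2 * i)" using a_period[of "2 * i" 1] s' by (simp add: add.commute)
      also have "\<dots> = a 0" using sh[of s'] a_period[of 0 1] s' by simp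
      finally show ?thesis using 0 by simp
    qed (use sh in auto)
    then have "s dvd 2 * i" by (rule shift_imp_dvd)
    \<comment> \<open>For odd \<open>s\<close> the length is \<open>2 * s\<close>, and
      \<open>s dvd 2 * i\<close> has to be sharpened to \<open>s dvd i\<close> before comparing with
      \<open>2 * i < len\<close>.\<close>
    have "i = 0"
    proof (rule ccontr)
      assume "i \<noteq> 0"
      have lt: "2 * i < len" using ij len_eqs by simp
      show False
      proof (cases "even s")
        case True
        then show False using lt \<open>s dvd 2 * i\<close> \<open>i \<noteq> 0\<close> by (auto simp: len_def dest: dvd_imp_le)
      next
        case False
        then have "coprime s 2" by simp
        then have "s dvd i" using \<open>s dvd 2 * i\<close> by (metis coprime_dvd_mult_right_iff)
        then show False using lt False \<open>i \<noteq> 0\<close> by (auto simp: len_def dest: dvd_imp_le)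
      qed
    qed
    then show ?thesis using True \<epsilon>u by (simp add: u_0)
  next
    case False
    \<comment> \<open>A point strictly inside a segment is impossible: its conjugate data force
      \<open>m = 0\<close>, hence \<open>z = w > 1\<close>, while
      \<open>e (2 * i + 1) < u i j\<close> gives \<open>z < 1\<close>.\<close>
    have j1: "real j \<ge> 1" using False by simp
    have "c (2 * i + 1) \<le> real j * c (2 * i + 1)" using j1 c_pos[of "2 * i + 1"] by simp
    then have "c (2 * i + 1) < c (2 * i) + real j * c (2 * i + 1)" using c_pos[of "2 * i"] by linarith
    then have "c (2 * i + 1) / (c (2 * i) + real j * c (2 * i + 1)) < 1"
      using c_pos[of "2 * i + 1"] by (subst divide_less_eq_1_pos) linarith+
    then have "cj z > -1" unfolding cz by simp
    then have "\<bar>real_of_int m\<bar> < 1" using zneg cjz t_bounds[of 0] t0 by linarith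
    then have "m = 0" by linarith
    then have "z > 1" using zw W_gt_1[of 0] by simp
    moreover have "z < 1"
    proof -
      have "e (2 * i + 1) < u i j" using u_pos[of "Suc j" i] ij(2) by (simp add: u_def algebra_simps)
      then show ?thesis unfolding z_def \<epsilon>u using upos by simp
    qed
    ultimately show ?thesis by simp
  qed
qed

end

subsection \<open>Sublattices, ideals and norms\<close>

text \<open>Translates are written with the representative on the right, matching the cosets that
  form the carrier of the quotient ring.\<close>

definition cosets :: "real set \<Rightarrow> real set \<Rightarrow> real set set" where
  "cosets G H = (\<lambda>x. (\<lambda>i. i + x) ` H) ` G"

lemma coset_eq_iff:
  fixes H :: "real set"
  assumes "0 \<in> H" "\<And>x y. x \<in> H \<Longrightarrow> y \<in> H \<Longrightarrow> x + y \<in> H" "\<And>x. x \<in> H \<Longrightarrow> - x \<in> H"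
  shows "(\<lambda>i. i + x) ` H = (\<lambda>i. i + y) ` H \<longleftrightarrow> x - y \<in> H"
proof
  assume "(\<lambda>i. i + x) ` H = (\<lambda>i. i + y) ` H"
  then have "0 + x \<in> (\<lambda>i. i + y) ` H" using assms(1) by blast
  then obtain i where "i \<in> H" "0 + x = i + y" by blast
  moreover from this have "x - y = i" by simp
  ultimately show "x - y \<in> H" by simp
next
  assume d: "x - y \<in> H"
  have "(\<lambda>i. i + x) ` H \<subseteq> (\<lambda>i. i + y) ` H" if "x - y \<in> H" for x y
  proof
    fix z assume "z \<in> (\<lambda>i. i + x) ` H"
    then obtain i where "i \<in> H" "z = i + x" by blast
    then have "i + (x - y) \<in> H" "z = (i + (x - y)) + y" using assms(2) that by auto
    then show "z \<in> (\<lambda>i. i + y) ` H" by blast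
  qed
  moreover have "y - x \<in> H" using assms(3)[OF d] by simp
  ultimately show "(\<lambda>i. i + x) ` H = (\<lambda>i. i + y) ` H" using d by blast
qed

lemma int_subgroup_generator:
  fixes P :: "int set"
  assumes add: "\<And>x y. x \<in> P \<Longrightarrow> y \<in> P \<Longrightarrow> x - y \<in> P" and N: "N \<in> P" "N > 0"
  obtains C where "C > 0" "C \<in> P" "\<And>x. x \<in> P \<Longrightarrow> C dvd x"
proof -
  define C where "C = int (LEAST n. n > 0 \<and> int n \<in> P)"
  have "\<exists>n. n > 0 \<and> int n \<in> P" using N by (intro exI[of _ "nat N"]) auto
  then have L: "(LEAST n. n > 0 \<and> int n \<in> P) > 0 \<and> int (LEAST n. n > 0 \<and> int n \<in> P) \<in> P"
    by (rule LeastI_ex)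
  have C: "C > 0" "C \<in> P" using L by (auto simp: C_def)
  have z: "0 \<in> P" using add[OF C(2) C(2)] by simp
  have neg: "- x \<in> P" if "x \<in> P" for x using add[OF z that] by simp
  have plus: "x + y \<in> P" if "x \<in> P" "y \<in> P" for x y using add[OF that(1) neg[OF that(2)]] by simp
  have natmult: "int n * C \<in> P" for n
    by (induction n) (use z plus C in \<open>auto simp: algebra_simps\<close>)
  have mult: "k * C \<in> P" for k
    using natmult[of "nat k"] neg[OF natmult[of "nat (-k)"]] by (cases "k \<ge> 0") auto
  have "C dvd x" if x: "x \<in> P" for x
  proof (rule ccontr)
    assume nd: "\<not> C dvd x"
    have "x mod C = x - x div C * C" by (simp add: minus_div_mult_eq_mod)
    then have "x mod C \<in> P" using add[OF x mult] by simp
    moreover have m: "0 < x mod C" "x mod C < C"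
      using C(1) nd pos_mod_bound[of C x] pos_mod_sign[of C x] by (auto simp: dvd_eq_mod_eq_0 less_le)
    ultimately have "nat (x mod C) > 0 \<and> int (nat (x mod C)) \<in> P" by auto
    then have "(LEAST n. n > 0 \<and> int n \<in> P) \<le> nat (x mod C)" by (rule Least_le)
    then show False using m unfolding C_def by linarith
  qed
  then show ?thesis using that C by blast
qed

context quad_radicand
begin

text \<open>Up to sign the covolume of the lattice spanned by \<open>x\<close> and \<open>y\<close>
  under both embeddings; indices of sublattices become quotients of such values.\<close>

definition disc :: "real \<Rightarrow> real \<Rightarrow> real" where "disc x y = x * cj y - y * cj x"

lemma cj_zcomb: "x \<in> K \<Longrightarrow> y \<in> K \<Longrightarrow> cj (of_int m * x + of_int n * y) = of_int m * cj x + of_int n * cj y"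
  using K_add[OF K_closed(2)[OF K_int(1)] K_closed(2)[OF K_int(1)], of x y m n] K_mult[OF K_int(1)] by simp

lemma disc_comb:
  assumes "x \<in> K" "y \<in> K"
  shows "disc (of_int m * x + of_int n * y) (of_int m' * x + of_int n' * y) = of_int (m * n' - n * m') * disc x y"
  unfolding disc_def cj_zcomb[OF assms] by (simp add: algebra_simps)

lemma disc_basis_change:
  assumes K: "x \<in> K" "y \<in> K" "x' \<in> K" "y' \<in> K" and eq: "zlat x y = zlat x' y'"
  shows "\<bar>disc x y\<bar> = \<bar>disc x' y'\<bar>"
proof -
  have 1: "\<exists>k::int. disc x y = of_int k * disc x' y'"
    if "x' \<in> K" "y' \<in> K" "zlat x y = zlat x' y'" for x y x' y'
  proof -
    have "x \<in> zlat x' y'" "y \<in> zlat x' y'"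
      unfolding that(3)[symmetric] by (rule zlat_left, rule zlat_right)
    then obtain m n m' n' where "x = of_int m * x' + of_int n * y'" "y = of_int m' * x' + of_int n' * y'"
      unfolding zlat_def by blast
    then show ?thesis using disc_comb[OF that(1,2)] by blast
  qed
  obtain k l :: int where kl: "disc x y = of_int k * disc x' y'" "disc x' y' = of_int l * disc x y"
    using 1[OF K(3,4) eq] 1[OF K(1,2) eq[symmetric]] by blast
  show ?thesis
  proof (cases "disc x y = 0")
    case True
    then show ?thesis using kl(2) by simp
  next
    case False
    have "disc x y = of_int k * (of_int l * disc x y)" unfolding kl(2)[symmetric] by (rule kl(1))
    then have "disc x y = of_int (k * l) * disc x y" by simp
    then have "real_of_int (k * l) = 1" using False by (simp del: of_int_mult)
    then have "k * l = 1" by (simp only: of_int_eq_1_iff)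
    then have "\<bar>k\<bar> = 1" using zmult_eq_1_iff[of k l] by auto
    then have "\<bar>real_of_int k\<bar> = 1" by linarith
    then show ?thesis using kl(1) by (simp add: abs_mult)
  qed
qed

text \<open>The basis is the Hermite normal form of the sublattice with respect to \<open>g1, g2\<close>.\<close>

lemma sublattice_basis:
  assumes g: "g1 \<in> K" "g2 \<in> K" "disc g1 g2 \<noteq> 0" and HG: "H \<subseteq> zlat g1 g2"
    and H: "0 \<in> H" "\<And>x y. x \<in> H \<Longrightarrow> y \<in> H \<Longrightarrow> x + y \<in> H" "\<And>x. x \<in> H \<Longrightarrow> - x \<in> H"
    and N: "N > 0" "of_int N * g1 \<in> H" "of_int N * g2 \<in> H"
  obtains h1 h2 where "h1 \<in> H" "h2 \<in> H" "H = zlat h1 h2"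
    "real (card (cosets (zlat g1 g2) H)) * \<bar>disc g1 g2\<bar> = \<bar>disc h1 h2\<bar>" "disc h1 h2 \<noteq> 0"
    "\<And>x. x \<in> zlat g1 g2 \<Longrightarrow> real (card (cosets (zlat g1 g2) H)) * x \<in> H"
proof -
  have Hdiff: "x - y \<in> H" if "x \<in> H" "y \<in> H" for x y using H(2)[OF that(1) H(3)[OF that(2)]] by simp
  have Hnat: "real n * x \<in> H" if "x \<in> H" for n x
    by (induction n) (use H that in \<open>auto simp: algebra_simps\<close>)
  have Hint: "of_int k * x \<in> H" if "x \<in> H" for k x
  proof (cases "k \<ge> 0")
    case True
    then show ?thesis using Hnat[OF that, of "nat k"] by simp
  next
    case False
    then show ?thesis using H(3)[OF Hnat[OF that, of "nat (-k)"]] by simp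
  qed
  \<comment> \<open>\<open>P\<close> collects the second coordinates of \<open>H\<close>, and
    \<open>Q\<close> below the first coordinates of its elements on the line of \<open>g1\<close>.
    Their generators \<open>C\<close> and \<open>A\<close> are the diagonal entries of the normal
    form, and \<open>B\<close> is the entry off the diagonal.\<close>
  define P where "P = {n. \<exists>m. of_int m * g1 + of_int n * g2 \<in> H}"
  have NP: "N \<in> P" unfolding P_def using N(3) by (auto intro!: exI[of _ 0])
  have Pd: "x - y \<in> P" if xy: "x \<in> P" "y \<in> P" for x y
  proof -
    obtain m m' where mm: "of_int m * g1 + of_int x * g2 \<in> H" "of_int m' * g1 + of_int y * g2 \<in> H"
      using xy by (auto simp: P_def)
    have "of_int (m - m') * g1 + of_int (x - y) * g2 \<in> H"
      using Hdiff[OF mm] by (simp add: algebra_simps)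
    then show ?thesis unfolding P_def by blast
  qed
  obtain C where C: "C > 0" "C \<in> P" "\<And>x. x \<in> P \<Longrightarrow> C dvd x"
    by (rule int_subgroup_generator[OF Pd NP N(1)]) blast+
  define Q where "Q = {m. of_int m * g1 \<in> H}"
  have Qd: "x - y \<in> Q" if "x \<in> Q" "y \<in> Q" for x y
    using Hdiff[of "of_int x * g1" "of_int y * g1"] that by (simp add: Q_def algebra_simps)
  have NQ: "N \<in> Q" using N(2) by (simp add: Q_def)
  obtain A where A: "A > 0" "A \<in> Q" "\<And>x. x \<in> Q \<Longrightarrow> A dvd x"
    by (rule int_subgroup_generator[OF Qd NQ N(1)]) blast+
  obtain B where B: "of_int B * g1 + of_int C * g2 \<in> H" using C(2) by (auto simp: P_def)
  define h1 h2 where "h1 = of_int A * g1" and "h2 = of_int B * g1 + of_int C * g2"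
  have h: "h1 \<in> H" "h2 \<in> H" using A(2) B by (auto simp: h1_def h2_def Q_def)
  have memH: "\<exists>i j. m = A * i + B * j \<and> n = C * j" if "of_int m * g1 + of_int n * g2 \<in> H" for m n
  proof -
    have "n \<in> P" using that by (auto simp: P_def)
    then obtain j where j: "n = C * j" using C(3) by blast
    have "of_int (m - B * j) * g1 = (of_int m * g1 + of_int n * g2) - of_int j * h2"
      by (simp add: j h2_def algebra_simps)
    then have "m - B * j \<in> Q" unfolding Q_def using Hdiff[OF that Hint[OF h(2)]] by simp
    then obtain i where "m - B * j = A * i" using A(3) by blast
    then show ?thesis using j by (intro exI[of _ i] exI[of _ j]) simp
  qed
  have Hz: "H = zlat h1 h2"
  proof (intro equalityI subsetI)
    fix x assume x: "x \<in> H"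
    then obtain m n where mn: "x = of_int m * g1 + of_int n * g2" using HG zlatE by blast
    then obtain i j where "m = A * i + B * j" "n = C * j" using memH x by blast
    then have "x = of_int i * h1 + of_int j * h2" using mn by (simp add: h1_def h2_def algebra_simps)
    then show "x \<in> zlat h1 h2" by (simp only: zlatI)
  next
    fix x assume "x \<in> zlat h1 h2"
    then show "x \<in> H" using H(2) Hint h by (elim zlatE) blast
  qed
  have hd: "disc h1 h2 = of_int (A * C) * disc g1 g2"
    using disc_comb[OF g(1,2), of A 0 B C] by (simp add: h1_def h2_def)
  let ?G = "zlat g1 g2"
  define \<psi> where "\<psi> = (\<lambda>(x, y). (\<lambda>i. i + (of_int x * g1 + of_int y * g2)) ` H)"
  have bij: "bij_betw \<psi> ({0..<A} \<times> {0..<C}) (cosets ?G H)"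
    unfolding bij_betw_def
  proof
    show "inj_on \<psi> ({0..<A} \<times> {0..<C})"
    proof (rule inj_onI, clarify)
      fix x y x' y' assume r: "x \<in> {0..<A}" "y \<in> {0..<C}" "x' \<in> {0..<A}" "y' \<in> {0..<C}"
        and "\<psi> (x, y) = \<psi> (x', y')"
      then have "(of_int x * g1 + of_int y * g2) - (of_int x' * g1 + of_int y' * g2) \<in> H"
        using coset_eq_iff[OF H] by (simp add: \<psi>_def)
      then have "of_int (x - x') * g1 + of_int (y - y') * g2 \<in> H" by (simp add: algebra_simps)
      then obtain i j where ij: "x - x' = A * i + B * j" "y - y' = C * j" using memH by blast
      have "C dvd y - y'" "\<bar>y - y'\<bar> < C" using ij r by auto
      then have y: "y = y'" using zdvd_imp_le[of C "\<bar>y - y'\<bar>"] by fastforce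
      then have "j = 0" using ij C by simp
      then have "A dvd x - x'" "\<bar>x - x'\<bar> < A" using ij r by auto
      then have "x = x'" using zdvd_imp_le[of A "\<bar>x - x'\<bar>"] by fastforce
      then show "x = x' \<and> y = y'" using y by simp
    qed
    show "\<psi> ` ({0..<A} \<times> {0..<C}) = cosets ?G H"
    proof (intro equalityI subsetI)
      fix S assume "S \<in> \<psi> ` ({0..<A} \<times> {0..<C})"
      then obtain x y where "S = \<psi> (x, y)" by auto
      then show "S \<in> cosets ?G H"
        unfolding cosets_def \<psi>_def prod.case by (intro image_eqI[OF _ zlatI])
    next
      fix S assume "S \<in> cosets ?G H"
      then obtain m n where S: "S = (\<lambda>i. i + (of_int m * g1 + of_int n * g2)) ` H"
        unfolding cosets_def by (auto elim: zlatE)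
      define k where "k = n div C"
      define y where "y = n mod C"
      define l where "l = (m - B * k) div A"
      define x where "x = (m - B * k) mod A"
      have n: "n = C * k + y" and m: "m = A * l + B * k + x"
        unfolding k_def y_def l_def x_def by simp_all
      have "(of_int m * g1 + of_int n * g2) - (of_int x * g1 + of_int y * g2) = of_int l * h1 + of_int k * h2"
        unfolding n m by (simp add: h1_def h2_def algebra_simps)
      moreover have "of_int l * h1 + of_int k * h2 \<in> H" using H(2) Hint h by simp
      ultimately have "S = \<psi> (x, y)" unfolding S \<psi>_def prod.case
        by (intro iffD2[OF coset_eq_iff[OF H]]) simp_all
      moreover have "(x, y) \<in> {0..<A} \<times> {0..<C}" using A C by (simp add: x_def y_def)
      ultimately show "S \<in> \<psi> ` ({0..<A} \<times> {0..<C})" by blast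
    qed
  qed
  have card: "card (cosets ?G H) = nat (A * C)"
    using bij_betw_same_card[OF bij] A C by (simp add: nat_mult_distrib)
  then have cardr: "real (card (cosets ?G H)) = of_int (A * C)" using A C by simp
  have "real (card (cosets ?G H)) * \<bar>disc g1 g2\<bar> = \<bar>disc h1 h2\<bar>"
    unfolding cardr hd abs_mult using A C by simp
  moreover have "disc h1 h2 \<noteq> 0" using hd g(3) A C by simp
  moreover have "real (card (cosets ?G H)) * x \<in> H" if xG: "x \<in> ?G" for x
  proof -
    obtain m n where x: "x = of_int m * g1 + of_int n * g2" using xG by (rule zlatE)
    \<comment> \<open>The index is the determinant \<open>A * C\<close>; the coefficients come from
      the adjugate of the triangular matrix.\<close>
    have e: "real (card (cosets ?G H)) * x = of_int (m * C - n * B) * h1 + of_int (A * n) * h2"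
      unfolding cardr x by (simp add: h1_def h2_def algebra_simps)
    show ?thesis unfolding e by (intro H(2) Hint h)
  qed
  ultimately show ?thesis using that h Hz by blast
qed

section \<open>The ring of integers, its ideals and their norms\<close>

abbreviation R :: "real ring" where "R \<equiv> quad_ints D"

abbreviation OK :: "real set" where "OK \<equiv> {x \<in> K. algebraic_int x}"

lemma R_simps: "carrier R = OK" "x \<otimes>\<^bsub>R\<^esub> y = x * y" "x \<oplus>\<^bsub>R\<^esub> y = x + y" "\<zero>\<^bsub>R\<^esub> = 0" "\<one>\<^bsub>R\<^esub> = 1"
  by (simp_all add: quad_ints_def ring_on_def)

lemma O_uminus: "x \<in> OK \<Longrightarrow> - x \<in> OK"
  using K_closed(5) by auto

lemma O_rho: "\<rho> \<in> OK" using K_rho rho_algebraic_int by simp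

lemma O_int: "of_int k \<in> OK"
  using K_int(1)[of k] by (auto intro: int_imp_algebraic_int)

lemma ideal_norm_cosets:
  "ideal_norm D I = card (cosets OK I)"
proof -
  have "carrier (R Quot I) = cosets OK I"
    unfolding FactRing_def cosets_def
    by (auto simp: A_RCOSETS_def' a_r_coset_def' R_simps)
  then show ?thesis by (simp add: ideal_norm_def Coset.order_def)
qed

text \<open>That the algebraic integers of the field form a ring is contained in the ideal predicate
  and is read off from it.\<close>

lemma integral_ideal_unpack:
  assumes "integral_ideal D I"
  shows "ring R" "I \<subseteq> OK" "0 \<in> I" "\<And>x y. x \<in> I \<Longrightarrow> y \<in> I \<Longrightarrow> x + y \<in> I"
    "\<And>x. x \<in> I \<Longrightarrow> - x \<in> I" "\<And>x y. x \<in> OK \<Longrightarrow> y \<in> I \<Longrightarrow> x * y \<in> I" "\<exists>x\<in>I. x \<noteq> 0"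
proof -
  have id: "ideal I R" and ne: "I \<noteq> {0}" using assms by (auto simp: integral_ideal_def)
  interpret ideal I R by (rule id)
  show "ring R" by unfold_locales
  show sub: "I \<subseteq> OK" using a_subset by (simp add: R_simps)
  show "0 \<in> I" using additive_subgroup.zero_closed[OF is_additive_subgroup] by (simp add: R_simps)
  show "x + y \<in> I" if "x \<in> I" "y \<in> I" for x y using additive_subgroup.a_closed[OF is_additive_subgroup that] by (simp add: R_simps)
  show m: "x * y \<in> I" if "x \<in> OK" "y \<in> I" for x y using I_l_closed[of y x] that by (simp add: R_simps)
  show "- x \<in> I" if "x \<in> I" for x using m[OF O_int[of "-1"] that] by simp
  show "\<exists>x\<in>I. x \<noteq> 0" using ne \<open>0 \<in> I\<close> by blast
qed

lemma integral_idealI: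
  assumes "ring R" "I \<subseteq> OK" "0 \<in> I" "\<And>x y. x \<in> I \<Longrightarrow> y \<in> I \<Longrightarrow> x + y \<in> I"
    "\<And>x y. x \<in> OK \<Longrightarrow> y \<in> I \<Longrightarrow> x * y \<in> I" "z \<in> I" "z \<noteq> 0"
  shows "integral_ideal D I"
proof -
  interpret ring R by (rule assms(1))
  have "ideal I R"
  proof (rule idealI)
    show "subgroup I (add_monoid R)"
    proof
      show "I \<subseteq> carrier (add_monoid R)" using assms(2) by (simp add: R_simps)
      fix x assume x: "x \<in> I"
      then have xO: "x \<in> OK" "- x \<in> OK" using assms(2) O_uminus by blast+
      then have "inv\<^bsub>add_monoid R\<^esub> x = - x"
        using minus_equality[of "- x" x] by (simp add: R_simps a_inv_def)
      moreover have "- x \<in> I" using assms(5)[OF O_int[of "-1"] x] by simp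
      ultimately show "inv\<^bsub>add_monoid R\<^esub> x \<in> I" by simp
    qed (use assms in \<open>simp_all add: R_simps\<close>)
    fix a x assume "a \<in> I" "x \<in> carrier R"
    then have "x * a \<in> I" using assms(5) by (simp add: R_simps)
    then show "x \<otimes>\<^bsub>R\<^esub> a \<in> I" "a \<otimes>\<^bsub>R\<^esub> x \<in> I" by (simp_all add: R_simps mult.commute)
  qed (rule assms(1))
  then show ?thesis using assms by (auto simp: integral_ideal_def)
qed

lemma O_closed:
  assumes "ring R" "x \<in> OK" "y \<in> OK"
  shows "x + y \<in> OK" "x * y \<in> OK"
proof -
  interpret ring R by (rule assms(1))
  show "x + y \<in> OK" "x * y \<in> OK"
    using a_closed[of x y] m_closed[of x y] assms by (simp_all only: R_simps)
qed

lemma ex_integral_multiple: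
  assumes R: "ring R" and "x \<in> K"
  obtains N :: int where "N > 0" "of_int N * x \<in> OK"
proof -
  obtain p q where pq: "p \<in> \<rat>" "q \<in> \<rat>" "x = p + q * \<rho>" using assms K_E by blast
  obtain a b where ab: "b > 0" "p = of_int a / of_int b" by (rule Rats_cases'[OF pq(1)])
  obtain c d where cd: "d > 0" "q = of_int c / of_int d" by (rule Rats_cases'[OF pq(2)])
  show ?thesis
  proof
    show "b * d > 0" using ab cd by simp
    have e: "of_int (b * d) * x = of_int (a * d) + of_int (c * b) * \<rho>"
      unfolding pq(3) ab(2) cd(2) using ab cd by (simp add: field_simps)
    show "of_int (b * d) * x \<in> OK"
      unfolding e by (intro O_closed[OF R] O_int O_rho)
  qed
qed

end

locale hecke_lattice = cf_lattice +
  fixes b :: "real set"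
  assumes b_ideal: "integral_ideal D b" and b_inv: "inverse_ideal D b = M"
begin

lemmas b = integral_ideal_unpack[OF b_ideal]

lemma M_iff: "x \<in> M \<longleftrightarrow> x \<in> K \<and> (\<forall>y\<in>b. x * y \<in> OK)"
  unfolding b_inv[symmetric] by (simp add: inverse_ideal_def R_simps)

lemma O_sub_M: "OK \<subseteq> M"
proof
  fix x assume x: "x \<in> OK"
  then have "x * y \<in> OK" if "y \<in> b" for y using b(6)[OF x that] b(2) by blast
  then show "x \<in> M" unfolding M_iff using x by blast
qed

text \<open>A nonzero element is multiplied by an integral multiple of its conjugate, which gives a
  nonzero rational number in the ideal; then the denominator is cleared.\<close>

lemma ideal_contains_int:
  assumes I: "integral_ideal D I"
  obtains n :: int where "n > 0" "of_int n \<in> I"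
proof -
  note i = integral_ideal_unpack[OF I]
  obtain x where x: "x \<in> I" "x \<noteq> 0" using i(7) by blast
  have xK: "x \<in> K" using x i(2) by blast
  obtain k where k: "k > 0" "of_int k * cj x \<in> OK" using ex_integral_multiple[OF i(1) cj_K[OF xK]] .
  have "of_int k * cj x * x \<in> I" using i(6)[OF k(2) x(1)] .
  moreover have "of_int k * cj x * x \<in> \<rat>" using norm_rat[OF xK] by (simp add: mult.assoc mult.commute[of x])
  moreover have "of_int k * cj x * x \<noteq> 0" using k x cj_eq_0_iff[OF xK] by simp
  ultimately obtain r where r: "r \<in> I" "r \<in> \<rat>" "r \<noteq> 0" by blast
  obtain m n where mn: "n > 0" "r = of_int m / of_int n" by (rule Rats_cases'[OF r(2)])
  have "of_int n * r \<in> I" by (rule i(6)[OF O_int r(1)])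
  then have "of_int m \<in> I" using mn by simp
  moreover from this have "- of_int m \<in> I" by (rule i(5))
  moreover have "m \<noteq> 0" using r mn by auto
  ultimately show ?thesis using that[of m] that[of "-m"] by (cases "m > 0") auto
qed

lemma disc_M: "disc (e 0) (e (Suc 0)) \<noteq> 0"
proof -
  have "disc (e 0) (e (Suc 0)) = - c 1 - e 1" by (simp add: disc_def cj_e)
  then show ?thesis using c_pos[of 1] e_pos[of 1] by simp
qed

text \<open>A positive integer \<open>n\<close> in \<open>b\<close> maps \<open>M\<close> into the
  ring of integers, which itself lies in \<open>M\<close>. So the ring is a sublattice of finite
  index, and a basis results without a case distinction on \<open>D\<close> modulo 4.\<close>

lemma O_basis:
  obtains o1 o2 where "o1 \<in> K" "o2 \<in> K" "disc o1 o2 \<noteq> 0" "OK = zlat o1 o2"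
proof -
  obtain n where n: "n > 0" "of_int n \<in> b" using ideal_contains_int[OF b_ideal] .
  have nM: "of_int n * x \<in> OK" if "x \<in> M" for x
    using bspec[OF conjunct2[OF iffD1[OF M_iff that]] n(2)] by (simp add: mult.commute)
  have sub: "OK \<subseteq> zlat (e 0) (e (Suc 0))" using O_sub_M M_basis[of 0] by simp
  have z: "0 \<in> OK" using O_int[of 0] by simp
  obtain h1 h2 where h: "h1 \<in> OK" "h2 \<in> OK" "OK = zlat h1 h2" "disc h1 h2 \<noteq> 0"
    by (rule sublattice_basis[OF e_K e_K disc_M sub z O_closed(1)[OF b(1)] O_uminus n(1) nM[OF e_M] nM[OF e_M]])
      (assumption | rule that)+
  show ?thesis by (rule that[OF _ _ h(4,3)]) (use h(1,2) in auto)
qed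

lemma ideal_basis:
  assumes I: "integral_ideal D I"
  obtains h1 h2 where "h1 \<in> K" "h2 \<in> K" "I = zlat h1 h2" "disc h1 h2 \<noteq> 0"
    "\<And>o1 o2. o1 \<in> K \<Longrightarrow> o2 \<in> K \<Longrightarrow> OK = zlat o1 o2 \<Longrightarrow> real (ideal_norm D I) * \<bar>disc o1 o2\<bar> = \<bar>disc h1 h2\<bar>"
    "real (ideal_norm D I) \<in> I"
proof -
  note i = integral_ideal_unpack[OF I]
  obtain o1 o2 where o: "o1 \<in> K" "o2 \<in> K" "disc o1 o2 \<noteq> 0" "OK = zlat o1 o2" using O_basis .
  obtain n where n: "n > 0" "of_int n \<in> I" using ideal_contains_int[OF I] .
  have nI: "of_int n * x \<in> I" if "x \<in> OK" for x
    using i(6)[OF that n(2)] by (simp add: mult.commute)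
  have oO: "o1 \<in> OK" "o2 \<in> OK" unfolding o(4) by (rule zlat_left, rule zlat_right)
  have sub: "I \<subseteq> zlat o1 o2" using i(2) o(4) by simp
  obtain h1 h2 where h: "h1 \<in> I" "h2 \<in> I" "I = zlat h1 h2"
    "real (card (cosets (zlat o1 o2) I)) * \<bar>disc o1 o2\<bar> = \<bar>disc h1 h2\<bar>" "disc h1 h2 \<noteq> 0"
    "\<And>x. x \<in> zlat o1 o2 \<Longrightarrow> real (card (cosets (zlat o1 o2) I)) * x \<in> I"
    by (rule sublattice_basis[OF o(1-3) sub i(3-5) n(1) nI[OF oO(1)] nI[OF oO(2)]])
      (assumption | rule that)+
  have c: "card (cosets (zlat o1 o2) I) = ideal_norm D I" by (simp only: ideal_norm_cosets o(4))
  have "real (ideal_norm D I) * \<bar>disc x y\<bar> = \<bar>disc h1 h2\<bar>" if "x \<in> K" "y \<in> K" "OK = zlat x y" for x y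
    using h(4) disc_basis_change[OF o(1,2) that(1,2)] that(3) o(4) c by simp
  moreover have "real (ideal_norm D I) \<in> I"
    using h(6)[of 1] O_int[of 1] unfolding o(4)[symmetric] c[unfolded o(4)[symmetric]] by simp
  moreover have "h1 \<in> K" "h2 \<in> K" using h i(2) by auto
  ultimately show ?thesis using that h by blast
qed

definition Nb :: nat where "Nb = ideal_norm D b"

definition Mpos :: "real set" where "Mpos = {x \<in> M. x > 0 \<and> cj x > 0}"

lemma scale_integral:
  assumes "x \<in> Mpos"
  shows "integral_ideal D (scale_ideal x b)"
proof -
  obtain v0 where v0: "v0 \<in> b" "v0 \<noteq> 0" using b(7) by blast
  show ?thesis
  proof (rule integral_idealI[OF b(1)])
    have x: "x \<in> M" "x > 0" using assms by (auto simp: Mpos_def)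
    show "scale_ideal x b \<subseteq> OK" using x unfolding M_iff scale_ideal_def by blast
    show "0 \<in> scale_ideal x b" using b(3) by (force simp: scale_ideal_def)
    show "y + z \<in> scale_ideal x b" if "y \<in> scale_ideal x b" "z \<in> scale_ideal x b" for y z
      using that b(4) by (auto simp: scale_ideal_def simp flip: distrib_left)
    show "y * z \<in> scale_ideal x b" if yz: "y \<in> OK" "z \<in> scale_ideal x b" for y z
    proof -
      obtain v where v: "v \<in> b" "z = x * v" using yz by (auto simp: scale_ideal_def)
      then have "y * z = x * (y * v)" "y * v \<in> b" using b(6)[OF yz(1)] by auto
      then show ?thesis by (auto simp: scale_ideal_def)
    qed
    show "x * v0 \<in> scale_ideal x b" "x * v0 \<noteq> 0" using x v0 by (auto simp: scale_ideal_def)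
  qed
qed

text \<open>A multiple of \<open>b\<close> by \<open>x\<close> consists of integers exactly when
  \<open>x\<close> lies in the inverse ideal, which is \<open>M\<close>.\<close>

lemma narrow_class_eq: "narrow_class D b = (\<lambda>x. scale_ideal x b) ` Mpos"
proof (intro equalityI subsetI)
  fix J assume "J \<in> narrow_class D b"
  then obtain x where x: "integral_ideal D J" "x \<in> K" "x > 0" "cj x > 0" "J = scale_ideal x b"
    by (auto simp: narrow_class_def totally_positive_iff)
  have "x * y \<in> OK" if "y \<in> b" for y
    using integral_ideal_unpack(2)[OF x(1)] that unfolding x(5) scale_ideal_def by blast
  then have "x \<in> M" unfolding M_iff using x by blast
  then show "J \<in> (\<lambda>x. scale_ideal x b) ` Mpos" using x by (auto simp: Mpos_def)
next
  fix J assume "J \<in> (\<lambda>x. scale_ideal x b) ` Mpos"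
  then obtain x where x: "x \<in> Mpos" "J = scale_ideal x b" by blast
  then have "totally_positive D x" using M_K by (auto simp: Mpos_def totally_positive_iff)
  then show "J \<in> narrow_class D b" using scale_integral x by (auto simp: narrow_class_def)
qed

text \<open>Norms are quotients of discriminants of bases, and multiplication by \<open>x\<close>
  scales a discriminant by \<open>x * cj x\<close>.\<close>

lemma ideal_norm_scale:
  assumes x: "x \<in> Mpos"
  shows "real (ideal_norm D (scale_ideal x b)) = real Nb * (x * cj x)"
proof -
  have xK: "x \<in> K" and pos: "x > 0" "cj x > 0" using x M_K by (auto simp: Mpos_def)
  obtain o1 o2 where o: "o1 \<in> K" "o2 \<in> K" "disc o1 o2 \<noteq> 0" "OK = zlat o1 o2" using O_basis .
  obtain h1 h2 where h: "h1 \<in> K" "h2 \<in> K" "b = zlat h1 h2"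
    "real (ideal_norm D b) * \<bar>disc o1 o2\<bar> = \<bar>disc h1 h2\<bar>"
  proof (rule ideal_basis[OF b_ideal])
    fix h1 h2 assume "h1 \<in> K" "h2 \<in> K" "b = zlat h1 h2"
      and n: "\<And>o1 o2. o1 \<in> K \<Longrightarrow> o2 \<in> K \<Longrightarrow> OK = zlat o1 o2 \<Longrightarrow> real (ideal_norm D b) * \<bar>disc o1 o2\<bar> = \<bar>disc h1 h2\<bar>"
    then show thesis using that[of h1 h2] n[OF o(1,2,4)] by blast
  qed
  obtain k1 k2 where k: "k1 \<in> K" "k2 \<in> K" "scale_ideal x b = zlat k1 k2"
    "real (ideal_norm D (scale_ideal x b)) * \<bar>disc o1 o2\<bar> = \<bar>disc k1 k2\<bar>"
  proof (rule ideal_basis[OF scale_integral[OF x]])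
    fix h1 h2 assume "h1 \<in> K" "h2 \<in> K" "scale_ideal x b = zlat h1 h2"
      and n: "\<And>o1 o2. o1 \<in> K \<Longrightarrow> o2 \<in> K \<Longrightarrow> OK = zlat o1 o2 \<Longrightarrow>
        real (ideal_norm D (scale_ideal x b)) * \<bar>disc o1 o2\<bar> = \<bar>disc h1 h2\<bar>"
    then show thesis using that[of h1 h2] n[OF o(1,2,4)] by blast
  qed
  have "zlat k1 k2 = zlat (x * h1) (x * h2)"
    using k(3) h(3) by (simp add: scale_ideal_def zlat_scale)
  then have "\<bar>disc k1 k2\<bar> = \<bar>disc (x * h1) (x * h2)\<bar>"
    by (intro disc_basis_change k K_closed(2) xK h)
  also have "disc (x * h1) (x * h2) = (x * cj x) * disc h1 h2"
    using K_mult[OF xK h(1)] K_mult[OF xK h(2)] by (simp add: disc_def algebra_simps)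
  also have "\<bar>(x * cj x) * disc h1 h2\<bar> = (x * cj x) * (real Nb * \<bar>disc o1 o2\<bar>)"
    using pos h(4) by (simp add: abs_mult Nb_def)
  finally show ?thesis using k(4) o(3) by simp
qed

text \<open>The ideal contains its norm. If this were prime to \<open>q\<close>, Bezout would put 1
  into the sum of the ideal and the multiples of \<open>q\<close>; so for an ideal not prime to
  \<open>q\<close> the Dirichlet character already vanishes at the norm.\<close>

lemma norm_character_eq:
  assumes chi: "dirichlet_character q chi" and I: "integral_ideal D I"
  shows "norm_character D q chi I = chi (int (ideal_norm D I))"
proof (cases "coprime_to D q I")
  case True
  then show ?thesis by (simp add: norm_character_def)
next
  case False
  have "\<not> coprime (int (ideal_norm D I)) (int q)"
  proof
    assume "coprime (int (ideal_norm D I)) (int q)"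
    then obtain x y where xy: "x * int (ideal_norm D I) + y * int q = 1"
      by (metis bezout_int coprime_imp_gcd_eq_1)
    note i = integral_ideal_unpack[OF I]
    have nI: "real (ideal_norm D I) \<in> I" by (rule ideal_basis[OF I])
    have "I <+>\<^bsub>R\<^esub> (PIdl\<^bsub>R\<^esub> (of_nat q)) = OK"
    proof (intro equalityI subsetI)
      fix z assume "z \<in> I <+>\<^bsub>R\<^esub> (PIdl\<^bsub>R\<^esub> (of_nat q))"
      then obtain u v where "u \<in> I" "v \<in> OK" "z = u + v * of_nat q"
        by (auto simp: set_add_def' cgenideal_def R_simps)
      moreover have "real q \<in> OK" using O_int[of "int q"] by simp
      ultimately show "z \<in> OK" using O_closed[OF b(1)] i(2) by blast
    next
      fix z assume z: "z \<in> OK"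
      have "real_of_int (x * int (ideal_norm D I) + y * int q) = 1" by (simp only: xy of_int_1)
      then have "z * 1 = z * (of_int x * real (ideal_norm D I)) + z * of_int y * of_nat q"
        by (metis (no_types, opaque_lifting) distrib_left mult.assoc of_int_add of_int_mult of_int_of_nat_eq)
      moreover have "z * (of_int x * real (ideal_norm D I)) \<in> I" by (intro i(6) z nI O_int)
      moreover have "z * of_int y \<in> OK" by (intro O_closed[OF b(1)] z O_int)
      ultimately show "z \<in> I <+>\<^bsub>R\<^esub> (PIdl\<^bsub>R\<^esub> (of_nat q))"
        unfolding set_add_def' cgenideal_def by (auto simp: R_simps)
    qed
    then show False using False by (simp add: coprime_to_def R_simps)
  qed
  then show ?thesis using False chi by (simp add: norm_character_def dirichlet_character_def)
qed

lemma w_M: "w \<in> M" using M_alt[of w] by (metis add_0 of_int_0 of_int_1 mult_1)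

lemma one_M: "1 \<in> M" using e_M[of 0] by simp

text \<open>\<open>x\<close> acts on the basis 1, \<open>w\<close> by an integer matrix and is a
  root of its characteristic polynomial.\<close>

lemma multiplier_integral:
  assumes xK: "x \<in> K" and xM: "\<And>z. z \<in> M \<Longrightarrow> x * z \<in> M"
  shows "x \<in> OK"
proof -
  obtain p q where pq: "x * 1 = of_int p + of_int q * w" using xM[OF one_M] M_alt by blast
  obtain r t' where rt: "x * w = of_int r + of_int t' * w" using xM[OF w_M] M_alt by blast
  have "(x - of_int p) * x = of_int q * (x * w)" using pq by (simp add: algebra_simps)
  also have "\<dots> = of_int q * of_int r + of_int t' * (x - of_int p)"
    unfolding rt using pq by (simp add: algebra_simps)
  finally have "poly [:of_int (p * t' - q * r), of_int (- (p + t')), 1:] x = 0"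
    by (simp add: algebra_simps)
  moreover have "coeff [:real_of_int (p * t' - q * r), of_int (- (p + t')), 1:] i \<in> \<int>" for i
    by (auto simp: coeff_pCons simp del: of_int_diff of_int_minus of_int_mult of_int_add split: nat.splits)
  ultimately have "algebraic_int x"
    by (intro algebraic_int.intros[of "[:real_of_int (p * t' - q * r), of_int (- (p + t')), 1:]"]) auto
  then show ?thesis using xK by simp
qed

lemma scale_powi: "scale_ideal (\<eta> powi k * z) b = scale_ideal z b"
proof -
  have pK: "\<eta> powi k \<in> K" for k using powi_K[OF \<eta>_K] by blast
  have pO: "\<eta> powi k \<in> OK" for k by (rule multiplier_integral[OF pK \<eta>_powi_M])
  have inv: "\<eta> powi k * \<eta> powi (- k) = 1" using \<eta>_pos by (simp add: power_int_minus)
  show ?thesis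
  proof (intro equalityI subsetI)
    fix y assume "y \<in> scale_ideal (\<eta> powi k * z) b"
    then obtain v where v: "v \<in> b" "y = z * (\<eta> powi k * v)" by (auto simp: scale_ideal_def mult_ac)
    then show "y \<in> scale_ideal z b" using b(6)[OF pO v(1)] by (auto simp: scale_ideal_def)
  next
    fix y assume "y \<in> scale_ideal z b"
    then obtain v where v: "v \<in> b" "y = z * v" by (auto simp: scale_ideal_def)
    then have "y = (\<eta> powi k * z) * (\<eta> powi (- k) * v)" using inv by (simp add: mult_ac)
    moreover have "\<eta> powi (- k) * v \<in> b" by (rule b(6)[OF pO v(1)])
    ultimately show "y \<in> scale_ideal (\<eta> powi k * z) b" unfolding scale_ideal_def by blast
  qed
qed

lemma scale_eq_unit:
  assumes x: "x \<in> Mpos" and y: "y \<in> Mpos" and eq: "scale_ideal x b = scale_ideal y b"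
  shows "(\<lambda>z. (x / y) * z) ` M = M"
proof -
  have xK: "x \<in> K" "x > 0" and yK: "y \<in> K" "y > 0" using x y M_K by (auto simp: Mpos_def)
  have sub: "(x / y) * z \<in> M"
    if "x \<in> K" "x > 0" "y \<in> K" "y > 0" "scale_ideal x b = scale_ideal y b" "z \<in> M" for x y z
  proof -
    have "(x / y) * z * v \<in> OK" if v: "v \<in> b" for v
    proof -
      have "x * v \<in> scale_ideal y b" using v that(1) \<open>scale_ideal x b = scale_ideal y b\<close>
        unfolding scale_ideal_def by blast
      then obtain v' where v': "v' \<in> b" "x * v = y * v'" by (auto simp: scale_ideal_def)
      then have "(x / y) * z * v = z * v'" using \<open>y > 0\<close> by (simp add: field_simps)
      then show ?thesis using \<open>z \<in> M\<close> v' unfolding M_iff by simp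
    qed
    moreover have "(x / y) * z \<in> K" using that M_K by (intro K_closed) auto
    ultimately show ?thesis unfolding M_iff by blast
  qed
  show ?thesis
  proof (intro equalityI subsetI)
    fix z assume "z \<in> (\<lambda>z. (x / y) * z) ` M"
    then show "z \<in> M" using sub[OF xK yK eq] by blast
  next
    fix z assume "z \<in> M"
    then have "(y / x) * z \<in> M" by (rule sub[OF yK xK eq[symmetric]])
    moreover have "z = (x / y) * ((y / x) * z)" using xK yK by simp
    ultimately show "z \<in> (\<lambda>z. (x / y) * z) ` M" by blast
  qed
qed

section \<open>The narrow class as a disjoint union of cones\<close>

definition \<Omega> :: "(nat \<times> nat \<times> nat \<times> nat) set" where
  "\<Omega> = {(i, j, m, n). i < p \<and> j < N i}"

lemma cone_pt_Mpos: "j < N i \<Longrightarrow> cone_pt i j m n \<in> Mpos"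
  using cone_pt_M cone_pt_pos cj_cone_pt_pos by (simp add: Mpos_def)

lemma cone_pt_slope_bounds:
  assumes "i < p" "j < N i"
  shows "1 \<le> slope (cone_pt i j m n)" "slope (cone_pt i j m n) < slope \<eta>"
proof -
  show "1 \<le> slope (cone_pt i j m n)"
    using cone_pt_slope_e(1)[OF assms(2), of m n] slope_e_mono[of 0 i] slope_e_0 by simp
  have "slope (e (2 * Suc i)) \<le> slope (e (2 * p))" using assms by (intro slope_e_mono) auto
  then show "slope (cone_pt i j m n) < slope \<eta>"
    using cone_pt_slope_e(2)[OF assms(2), of m n] len_eqs(1) by (simp add: \<eta>_def)
qed

text \<open>The quotient of two generators of the same ideal preserves \<open>M\<close>. With the
  larger slope in the numerator its slope lies between 1 and \<open>slope \<eta>\<close>, so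
  \<open>unit_eq_1\<close> applies.\<close>

lemma scale_inj:
  assumes x: "x \<in> Mpos" "1 \<le> slope x" "slope x < slope \<eta>"
    and y: "y \<in> Mpos" "1 \<le> slope y" "slope y < slope \<eta>"
    and eq: "scale_ideal x b = scale_ideal y b"
  shows "x = y"
proof -
  have aux: "x = y" if x: "x \<in> Mpos" "slope x < slope \<eta>" and y: "y \<in> Mpos" "1 \<le> slope y" "slope y \<le> slope x"
    and eq: "scale_ideal x b = scale_ideal y b" for x y
  proof -
    have xK: "x \<in> K" "x > 0" "cj x > 0" and yK: "y \<in> K" "y > 0" "cj y > 0"
      using x y M_K by (auto simp: Mpos_def)
    have d: "x / y \<in> K" "cj (x / y) = cj x / cj y" using K_divide[OF xK(1) yK(1)] by auto
    have s: "slope (x / y) = slope x / slope y" unfolding slope_def d using xK yK by simp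
    have "x / y = 1"
    proof (rule unit_eq_1[OF d(1)])
      show "(\<lambda>z. x / y * z) ` M = M" by (rule scale_eq_unit[OF x(1) y(1) eq])
      show "1 \<le> slope (x / y)" unfolding s using y by simp
      have "slope x / slope y \<le> slope x / 1" using y xK by (intro divide_left_mono) (auto simp: slope_def)
      then show "slope (x / y) < slope \<eta>" unfolding s using x by simp
    qed (use d xK yK in auto)
    then show ?thesis using yK by simp
  qed
  show ?thesis
  proof (cases "slope y \<le> slope x")
    case True
    then show ?thesis using aux[of x y] x y eq by blast
  next
    case False
    then show ?thesis using aux[of y x] x y eq by simp
  qed
qed

lemma narrow_class_bij:
  "bij_betw (\<lambda>(i, j, m, n). scale_ideal (cone_pt i j m n) b) \<Omega> (narrow_class D b)"
  unfolding bij_betw_def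
proof
  show "inj_on (\<lambda>(i, j, m, n). scale_ideal (cone_pt i j m n) b) \<Omega>"
  proof (rule inj_onI)
    fix x y
    assume x: "x \<in> \<Omega>" and y: "y \<in> \<Omega>"
      and xy: "(\<lambda>(i, j, m, n). scale_ideal (cone_pt i j m n) b) x = (\<lambda>(i, j, m, n). scale_ideal (cone_pt i j m n) b) y"
    obtain i j m n i' j' m' n' where ij: "x = (i, j, m, n)" "y = (i', j', m', n')" by (cases x, cases y)
    have r: "i < p" "j < N i" "i' < p" "j' < N i'" using x y by (auto simp: \<Omega>_def ij)
    have eq: "scale_ideal (cone_pt i j m n) b = scale_ideal (cone_pt i' j' m' n') b" using xy by (simp add: ij)
    have "cone_pt i j m n = cone_pt i' j' m' n'"
      by (rule scale_inj[OF _ _ _ _ _ _ eq]) (use r in \<open>auto intro!: cone_pt_Mpos cone_pt_slope_bounds\<close>)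
    from cone_pt_inj[OF r this] show "x = y" by (simp add: ij)
  qed
  show "(\<lambda>(i, j, m, n). scale_ideal (cone_pt i j m n) b) ` \<Omega> = narrow_class D b"
  proof (intro equalityI subsetI)
    fix J assume "J \<in> (\<lambda>(i, j, m, n). scale_ideal (cone_pt i j m n) b) ` \<Omega>"
    then obtain i j m n where "j < N i" "J = scale_ideal (cone_pt i j m n) b" by (auto simp: \<Omega>_def)
    then show "J \<in> narrow_class D b" unfolding narrow_class_eq using cone_pt_Mpos by blast
  next
    fix J assume "J \<in> narrow_class D b"
    then obtain z where z: "z \<in> Mpos" "J = scale_ideal z b" unfolding narrow_class_eq by blast
    then have zM: "z \<in> M" "z > 0" "cj z > 0" by (auto simp: Mpos_def)
    obtain k where k: "1 \<le> slope (\<eta> powi k * z)" "slope (\<eta> powi k * z) < slope \<eta>"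
      using reduce_slope[OF M_K[OF zM(1)] zM(2,3)] by blast
    have "\<eta> powi k * z > 0" using \<eta>_pos zM by simp
    then obtain i j m n where r: "i < p" "j < N i" "\<eta> powi k * z = cone_pt i j m n"
      using cone_cover[OF \<eta>_powi_M[OF zM(1)] _ k] by blast
    then have "J = scale_ideal (cone_pt i j m n) b" using scale_powi[of k z] z by simp
    then show "J \<in> (\<lambda>(i, j, m, n). scale_ideal (cone_pt i j m n) b) ` \<Omega>"
      using r by (intro image_eqI[of _ _ "(i, j, m, n)"]) (auto simp: \<Omega>_def)
  qed
qed

text \<open>The norm form \<open>z \<mapsto> N(b) N(z)\<close>, which is integral on \<open>M\<close> (see \<open>\<nu>_eq\<close>).\<close>

definition \<nu> :: "real \<Rightarrow> int" where "\<nu> z = \<lfloor>real Nb * (z * cj z)\<rfloor>"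

lemma \<nu>_Mpos: "z \<in> Mpos \<Longrightarrow> int (ideal_norm D (scale_ideal z b)) = \<nu> z"
  using ideal_norm_scale[of z] by (simp add: \<nu>_def flip: of_nat_mult) (metis floor_of_nat)

lemma cj_K_comb: "x \<in> K \<Longrightarrow> y \<in> K \<Longrightarrow> cj (x + of_int k * y) = cj x + of_int k * cj y"
  using cj_zcomb[of x y 1 k] by simp

text \<open>Ideal norms give integrality only at totally positive elements. With \<delta> the second
  generator, 1, \<delta> and 1 + \<delta> are such elements, and polarization yields all three
  integer coefficients of the form in the basis 1, \<delta>.\<close>

lemma \<nu>_eq: "z \<in> M \<Longrightarrow> of_int (\<nu> z) = real Nb * (z * cj z)"
proof -
  assume z: "z \<in> M"
  define \<delta> where "\<delta> = w + 1"
  have \<delta>: "\<delta> \<in> Mpos" "1 + \<delta> \<in> Mpos" "1 \<in> Mpos"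
    using M_add[OF w_M one_M] M_add[OF one_M M_add[OF w_M one_M]] one_M W_gt_1[of 0] t_bounds(1)[of 0] t0
      K_add[OF wK K_int(4)] K_add[OF K_int(4) K_closed(1)[OF wK K_int(4)]]
    by (auto simp: Mpos_def \<delta>_def)
  have \<delta>K: "\<delta> \<in> K" using \<delta> M_K by (auto simp: Mpos_def)
  have i: "real Nb * (y * cj y) \<in> \<int>" if "y \<in> Mpos" for y
    using ideal_norm_scale[OF that] by (metis Ints_of_nat)
  have N: "real Nb \<in> \<int>" by simp
  have S: "real Nb * (\<delta> * cj \<delta>) \<in> \<int>" by (rule i[OF \<delta>(1)])
  have "real Nb * ((1 + \<delta>) * cj (1 + \<delta>)) - real Nb - real Nb * (\<delta> * cj \<delta>) = real Nb * (\<delta> + cj \<delta>)"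
    using K_add[OF K_int(4) \<delta>K] by (simp add: algebra_simps)
  then have T: "real Nb * (\<delta> + cj \<delta>) \<in> \<int>" using i[OF \<delta>(2)] N S by (metis Ints_diff)
  obtain m n where mn: "z = of_int m + of_int n * \<delta>"
    using z unfolding M_def unit_lattice_def \<delta>_def by blast
  have "real Nb * (z * cj z) = of_int (m * m) * real Nb + of_int (m * n) * (real Nb * (\<delta> + cj \<delta>))
     + of_int (n * n) * (real Nb * (\<delta> * cj \<delta>))"
    unfolding mn using cj_K_comb[OF K_int(1) \<delta>K, of m n] by (simp add: algebra_simps)
  also have "\<dots> \<in> \<int>" by (intro Ints_add Ints_mult Ints_of_int N S T)
  finally show ?thesis by (simp add: \<nu>_def)
qed

text \<open>A quadratic form changes by \<open>k\<close> times its polar form plus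
  \<open>k * k\<close> times a value; the polar form is integral, being a combination of values of
  \<open>\<nu>\<close>.\<close>

lemma \<nu>_cong:
  assumes z: "z \<in> M" "z' \<in> M"
  shows "\<nu> (z + of_int k * z') mod k = \<nu> z mod k"
proof -
  have zK: "z \<in> K" "z' \<in> K" using z M_K by auto
  have "real_of_int (\<nu> (z + of_int k * z')) = of_int (\<nu> z + k * (\<nu> (z + z') - \<nu> z - \<nu> z') + k * (k * \<nu> z'))"
    using \<nu>_eq[OF z(1)] \<nu>_eq[OF z(2)] \<nu>_eq[OF M_add[OF z]] \<nu>_eq[OF M_add[OF z(1) M_int[OF z(2), of k]]]
      cj_K_comb[OF zK, of k] K_add[OF zK]
    by (simp add: algebra_simps)
  then have "\<nu> (z + of_int k * z') = \<nu> z + k * (\<nu> (z + z') - \<nu> z - \<nu> z') + k * (k * \<nu> z')"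
    by (simp only: of_int_eq_iff)
  then show ?thesis by simp
qed

text \<open>Multiplication by \<open>\<eta>\<close> preserves the lattice and hence its covolume,
  and the norm is positive.\<close>

lemma norm_\<eta>: "\<eta> * cj \<eta> = 1"
proof -
  have K: "e 0 \<in> K" "e (Suc 0) \<in> K" "\<eta> * e 0 \<in> K" "\<eta> * e (Suc 0) \<in> K"
    by (intro e_K K_closed \<eta>_K)+
  have "zlat (e 0) (e (Suc 0)) = zlat (\<eta> * e 0) (\<eta> * e (Suc 0))"
    using \<eta>_M unfolding M_basis[of 0] zlat_scale by simp
  then have "\<bar>disc (e 0) (e (Suc 0))\<bar> = \<bar>disc (\<eta> * e 0) (\<eta> * e (Suc 0))\<bar>"
    by (intro disc_basis_change K)
  also have "disc (\<eta> * e 0) (\<eta> * e (Suc 0)) = (\<eta> * cj \<eta>) * disc (e 0) (e (Suc 0))"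
    using K_mult[OF \<eta>_K K(1)] K_mult[OF \<eta>_K K(2)] by (simp add: disc_def algebra_simps)
  finally have "\<bar>\<eta> * cj \<eta>\<bar> = 1" using disc_M by (simp add: abs_mult)
  moreover have "\<eta> * cj \<eta> > 0" using \<eta>_pos \<eta>_slope by simp
  ultimately show ?thesis by simp
qed

lemma \<nu>_\<eta>: "z \<in> M \<Longrightarrow> \<nu> (\<eta> * z) = \<nu> z"
proof -
  assume z: "z \<in> M"
  have "\<eta> * z * cj (\<eta> * z) = (\<eta> * cj \<eta>) * (z * cj z)"
    using K_mult[OF \<eta>_K M_K[OF z]] by simp
  then show ?thesis by (simp only: \<nu>_def norm_\<eta> mult_1_left)
qed

end

subsection \<open>The partial Hecke series as a sum over cones\<close>

lemma dirichlet_character_cong: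
  assumes chi: "dirichlet_character q chi" and "m mod int q = n mod int q"
  shows "chi m = chi n"
proof -
  have step: "chi (m + int q) = chi m" for m using chi by (simp add: dirichlet_character_def)
  have nat: "chi (m + int k * int q) = chi m" for m k
  proof (induction k)
    case (Suc k)
    then show ?case using step[of "m + int k * int q"] by (simp add: algebra_simps)
  qed simp
  have int: "chi (m + k * int q) = chi m" for m k
    using nat[of m "nat k"] nat[of "m + k * int q" "nat (-k)"] by (cases "k \<ge> 0") auto
  have "m = n + (m div int q - n div int q) * int q"
    unfolding left_diff_distrib
    using assms(2) div_mult_mod_eq[of m "int q"] div_mult_mod_eq[of n "int q"] by linarith
  then show ?thesis using int[of n "m div int q - n div int q"] by simp
qed

context hecke_lattice
begin

lemma Nb_pos: "Nb > 0"
proof -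
  obtain o1 o2 where o: "o1 \<in> K" "o2 \<in> K" "disc o1 o2 \<noteq> 0" "OK = zlat o1 o2" using O_basis .
  show ?thesis
  proof (rule ideal_basis[OF b_ideal])
    fix h1 h2 assume d: "disc h1 h2 \<noteq> 0"
      and n: "\<And>o1 o2. o1 \<in> K \<Longrightarrow> o2 \<in> K \<Longrightarrow> OK = zlat o1 o2 \<Longrightarrow> real (ideal_norm D b) * \<bar>disc o1 o2\<bar> = \<bar>disc h1 h2\<bar>"
    have "ideal_norm D b \<noteq> 0"
    proof
      assume "ideal_norm D b = 0"
      then show False using n[OF o(1,2,4)] d by simp
    qed
    then show "Nb > 0" by (simp add: Nb_def)
  qed
qed

definition qA :: "nat \<Rightarrow> nat \<Rightarrow> real" where "qA i j = u i j * cj (u i j)"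

definition qB :: "nat \<Rightarrow> nat \<Rightarrow> real" where
  "qB i j = u i j * cj (u i (Suc j)) + u i (Suc j) * cj (u i j)"

text \<open>The limit in \<open>cone_zeta_continuation\<close> for the norm form of the cone with
  generators \<open>u i j\<close> and \<open>u i (Suc j)\<close>.\<close>

definition cone_val :: "nat \<Rightarrow> nat \<Rightarrow> real \<Rightarrow> real \<Rightarrow> real" where
  "cone_val i j x y = (x - 1/2) * (y - 1/2) + qB i j / (4 * qA i (Suc j)) * (x\<^sup>2 - x + 1/6)
     + qB i j / (4 * qA i j) * (y\<^sup>2 - y + 1/6)"

definition qf :: "nat \<Rightarrow> nat \<Rightarrow> real \<Rightarrow> real \<Rightarrow> real" where
  "qf i j X Y = qA i j * X\<^sup>2 + qB i j * X * Y + qA i (Suc j) * Y\<^sup>2"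

lemma posquad_cone: "j < N i \<Longrightarrow> posquad (qA i j) (qB i j) (qA i (Suc j))"
  using u_pos[of j i] u_pos[of "Suc j" i] cj_u_pos[of i j] cj_u_pos[of i "Suc j"]
  by unfold_locales (auto simp: qA_def qB_def add_pos_pos)

lemma norm_cone_comb:
  "(real k * u i j + real l * u i (Suc j)) * cj (real k * u i j + real l * u i (Suc j)) = qf i j (real k) (real l)"
  unfolding cj_comb qf_def qA_def qB_def by (simp add: power2_eq_square algebra_simps)

lemma cone_continuation:
  fixes x y :: real
  assumes j: "j < N i" and x: "0 < x" "x \<le> 1" and y: "0 \<le> y" "y \<le> 1"
  shows "\<exists>Z. Z meromorphic_on {s. Re s > - real R'} \<and> Z holomorphic_on {s. Re s > 1} \<and>
    (\<forall>s. Re s > 1 \<longrightarrow> ((\<lambda>(m, n). complex_of_real (qf i j (real m + x) (real n + y)) powr (-s)) has_sum Z s) UNIV) \<and>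
    (Z \<longlongrightarrow> of_real (cone_val i j x y)) (at 0)"
proof -
  interpret P: posquad "qA i j" "qB i j" "qA i (Suc j)" by (rule posquad_cone[OF j])
  have Q: "P.Qf = qf i j" by (intro ext) (simp add: P.Qf_def qf_def)
  obtain Z where Z: "Z meromorphic_on {s. Re s > - real R'}" "Z holomorphic_on {s. Re s > 1}"
    "\<And>s. Re s > 1 \<Longrightarrow> ((\<lambda>(m, n). complex_of_real (P.Qf (real m + x) (real n + y)) powr (-s)) has_sum Z s) UNIV"
    "(Z \<longlongrightarrow> of_real ((x - 1/2) * (y - 1/2) + qB i j / (4 * qA i (Suc j)) * (x\<^sup>2 - x + 1/6) + qB i j / (4 * qA i j) * (y\<^sup>2 - y + 1/6))) (at 0)"
    by (rule P.cone_zeta_continuation[OF x y, of R']) (rule that)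
  show ?thesis
  proof (intro exI[of _ Z] conjI allI impI)
    show "((\<lambda>(m, n). complex_of_real (qf i j (real m + x) (real n + y)) powr (-s)) has_sum Z s) UNIV"
      if "Re s > 1" for s using Z(3)[OF that] by (simp only: Q)
  qed (use Z in \<open>simp_all only: cone_val_def\<close>)
qed

end

locale hecke_character = hecke_lattice +
  fixes q :: nat and chi :: "int \<Rightarrow> complex"
  assumes q: "q \<ge> 1" and chi: "dirichlet_character q chi"
begin

definition wt :: "real \<Rightarrow> complex" where "wt z = chi (\<nu> z)"

lemma wt_cong: "z \<in> M \<Longrightarrow> z' \<in> M \<Longrightarrow> wt (z + of_int (int q) * z') = wt z"
  unfolding wt_def by (intro dirichlet_character_cong[OF chi] \<nu>_cong)

abbreviation corner_wt :: "nat \<Rightarrow> nat \<Rightarrow> nat \<Rightarrow> nat \<Rightarrow> complex" where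
  "corner_wt i j x y \<equiv> wt (real (Suc x) * u i j + real y * u i (Suc j))"

abbreviation corner_val :: "nat \<Rightarrow> nat \<Rightarrow> nat \<Rightarrow> nat \<Rightarrow> real" where
  "corner_val i j x y \<equiv> cone_val i j (real (Suc x) / real q) (real y / real q)"

abbreviation corner_form :: "nat \<Rightarrow> nat \<Rightarrow> nat \<Rightarrow> nat \<Rightarrow> nat \<Rightarrow> nat \<Rightarrow> real" where
  "corner_form i j x y m n \<equiv> qf i j (real m + real (Suc x) / real q) (real n + real y / real q)"

text \<open>Each cone is split by the residues \<open>x\<close>, \<open>y\<close> of its coordinates
  modulo \<open>q\<close>. The first coordinate of a point of the cone is a successor, so the
  offsets are \<open>(x + 1) / q\<close>, never 0, and \<open>y / q\<close>, never 1.\<close>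

definition Fin :: "(nat \<times> nat \<times> nat \<times> nat) set" where
  "Fin = (SIGMA i:{..<p}. SIGMA j:{..<N i}. {..<q} \<times> {..<q})"

definition Lval :: complex where
  "Lval = (\<Sum>(i, j, x, y)\<in>Fin. corner_wt i j x y *
     of_real (corner_val i j x y))"

text \<open>The character sees the point only modulo \<open>q\<close>, so it is constant on a
  residue class; scaling the coordinates by \<open>q\<close> pulls \<open>q\<^sup>2\<close> out of
  the norm form.\<close>

lemma hecke_summand:
  fixes z :: complex
  assumes j: "j < N i"
  shows "norm_character D q chi (scale_ideal (cone_pt i j (q * m + x) (q * n + y)) b) *
      of_nat (ideal_norm D (scale_ideal (cone_pt i j (q * m + x) (q * n + y)) b)) powr (- z)
    = corner_wt i j x y * of_real (real Nb * (real q)\<^sup>2) powr (- z) *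
      complex_of_real (corner_form i j x y m n) powr (-z)"
    (is "norm_character D q chi (scale_ideal ?z b) * _ = _")
proof -
  have q0: "real q > 0" using q by simp
  have zM: "?z \<in> Mpos" by (rule cone_pt_Mpos[OF j])
  have uM: "real k * u i j \<in> M" for k i j using M_int[OF u_M, of "int k"] by simp
  have zeq: "?z = (real (Suc x) * u i j + real y * u i (Suc j)) + of_int (int q) * (real m * u i j + real n * u i (Suc j))"
    by (simp add: cone_pt_def algebra_simps)
  have "norm_character D q chi (scale_ideal ?z b) = wt ?z"
    using norm_character_eq[OF chi scale_integral[OF zM]] \<nu>_Mpos[OF zM] by (simp add: wt_def)
  also have "\<dots> = corner_wt i j x y"
    unfolding zeq by (intro wt_cong M_add uM)
  finally have 1: "norm_character D q chi (scale_ideal ?z b) = corner_wt i j x y" .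
  have "?z * cj ?z = qf i j (real (Suc (q * m + x))) (real (q * n + y))"
    unfolding cone_pt_def by (rule norm_cone_comb)
  also have "\<dots> = qf i j (real q * (real m + real (Suc x) / real q)) (real q * (real n + real y / real q))"
  proof -
    have "real (Suc (q * m + x)) = real q * (real m + real (Suc x) / real q)"
      "real (q * n + y) = real q * (real n + real y / real q)"
      using q0 by (simp_all add: field_simps)
    then show ?thesis by (simp only:)
  qed
  also have "\<dots> = (real q)\<^sup>2 * (corner_form i j x y m n)"
    by (simp only: qf_def power2_eq_square) (simp only: algebra_simps)
  finally have nz: "?z * cj ?z = (real q)\<^sup>2 * (corner_form i j x y m n)" .
  define Q where "Q = (corner_form i j x y m n)"
  have n: "real (ideal_norm D (scale_ideal ?z b)) = (real Nb * (real q)\<^sup>2) * Q"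
    unfolding ideal_norm_scale[OF zM] nz Q_def by simp
  have "?z * cj ?z > 0" using zM by (simp add: Mpos_def)
  then have Q0: "Q > 0" unfolding nz Q_def[symmetric] using q0 by (simp add: zero_less_mult_iff)
  have "(of_nat (ideal_norm D (scale_ideal ?z b)) :: complex) = of_real (real (ideal_norm D (scale_ideal ?z b)))"
    by (simp only: of_real_of_nat_eq)
  also have "\<dots> = of_real (real Nb * (real q)\<^sup>2) * of_real Q" unfolding n by (rule of_real_mult)
  finally have 2: "(of_nat (ideal_norm D (scale_ideal ?z b)) :: complex) powr (-z)
      = of_real (real Nb * (real q)\<^sup>2) powr (-z) * of_real Q powr (-z)"
    using Q0 by (simp only: powr_times_real Reals_of_real Re_complex_of_real less_imp_le
      mult_nonneg_nonneg of_nat_0_le_iff zero_le_power2)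
  show ?thesis unfolding 1 2 Q_def[symmetric] by (simp only: mult.assoc)
qed

lemma hecke_series_eq:
  fixes z :: complex
  assumes z: "Re z > 1"
    and Z: "\<And>i j x y. (i, j, x, y) \<in> Fin \<Longrightarrow>
      ((\<lambda>(m, n). complex_of_real (corner_form i j x y m n) powr (-z))
        has_sum Z i j x y) UNIV"
  shows "hecke_series D z (norm_character D q chi) b = of_real (real Nb * (real q)\<^sup>2) powr (- z) *
     (\<Sum>(i, j, x, y)\<in>Fin. corner_wt i j x y * Z i j x y)"
proof -
  define F where "F J = norm_character D q chi J * of_nat (ideal_norm D J) powr (- z)" for J
  define G where "G = (\<lambda>(i, j, m, n). F (scale_ideal (cone_pt i j m n) b))"
  define S where "S = (\<lambda>(i, j, x, y). corner_wt i j x y * of_real (real Nb * (real q)\<^sup>2) powr (- z) * Z i j x y)"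
  define B where "B = (\<lambda>(i, j, x, y). {(i', j', m, n). i' = i \<and> j' = j \<and> m mod q = x \<and> n mod q = y} :: (nat \<times> nat \<times> nat \<times> nat) set)"
  have fin: "finite Fin" unfolding Fin_def by auto
  have q0: "q > 0" using q by simp
  have "(G has_sum S k) (B k)" if k: "k \<in> Fin" for k
  proof -
    obtain i j x y where ij: "k = (i, j, x, y)" by (cases k)
    have r: "j < N i" "x < q" "y < q" using k by (auto simp: Fin_def ij)
    have bij: "bij_betw (\<lambda>(m, n). (i, j, q * m + x, q * n + y)) UNIV (B k)"
      by (rule bij_betwI[where g = "\<lambda>(i, j, m, n). (m div q, n div q)"])
        (use r q0 in \<open>auto simp: B_def ij mult.commute\<close>)
    have "((\<lambda>mn. corner_wt i j x y * of_real (real Nb * (real q)\<^sup>2) powr (- z) *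
       (case mn of (m, n) \<Rightarrow> complex_of_real (corner_form i j x y m n) powr (-z))) has_sum S k) UNIV"
      unfolding S_def ij prod.case using k ij by (intro has_sum_cmult_right Z) auto
    moreover have "corner_wt i j x y * of_real (real Nb * (real q)\<^sup>2) powr (- z) *
       (case mn of (m, n) \<Rightarrow> complex_of_real (corner_form i j x y m n) powr (-z))
       = G ((\<lambda>(m, n). (i, j, q * m + x, q * n + y)) mn)" for mn
      by (cases mn) (simp only: G_def F_def prod.case hecke_summand[OF r(1)])
    ultimately have "((\<lambda>mn. G ((\<lambda>(m, n). (i, j, q * m + x, q * n + y)) mn)) has_sum S k) UNIV"
      by simp
    then show ?thesis using has_sum_reindex_bij_betw[OF bij] by blast
  qed
  then have "(G has_sum sum S Fin) (\<Union>k\<in>Fin. B k)"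
    by (intro sum_has_sum fin) (auto simp: B_def)
  also have "(\<Union>k\<in>Fin. B k) = \<Omega>"
    using q0 by (auto simp: Fin_def B_def \<Omega>_def)
  finally have "(G has_sum sum S Fin) \<Omega>" .
  moreover have "G = (\<lambda>k. F ((\<lambda>(i, j, m, n). scale_ideal (cone_pt i j m n) b) k))"
    by (auto simp: G_def fun_eq_iff)
  ultimately have "(F has_sum sum S Fin) (narrow_class D b)"
    using has_sum_reindex_bij_betw[OF narrow_class_bij, of F "sum S Fin"] by simp
  then have "hecke_series D z (norm_character D q chi) b = sum S Fin"
    unfolding hecke_series_def F_def by (rule infsumI)
  then show ?thesis
    by (simp add: S_def sum_distrib_left case_prod_unfold mult_ac)
qed

text \<open>The series is a power of \<open>Nb * q\<^sup>2\<close> times a finite combination of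
  cone zeta functions. This power is 1 at 0, so the norm of \<open>b\<close> drops out of the
  value.\<close>

theorem partial_hecke_L_eq: "partial_hecke_L D 0 (norm_character D q chi) b = Lval"
  unfolding partial_hecke_L_def
proof (rule meromorphic_continuation_value)
  fix R' :: nat
  define C where "C = complex_of_real (real Nb * (real q)\<^sup>2)"
  have Cpos: "real Nb * (real q)\<^sup>2 > 0" using Nb_pos q by simp
  then have C0: "C \<noteq> 0" unfolding C_def by (simp only: of_real_eq_0_iff)
  have Cn: "C \<notin> \<real>\<^sub>\<le>\<^sub>0" unfolding C_def nonpos_Reals_of_real_iff using Cpos by linarith
  have fin: "finite Fin" unfolding Fin_def by auto
  have q0: "real q > 0" using q by simp
  define good where "good = (\<lambda>(i, j, x, y) Z. Z meromorphic_on {s. Re s > - real R'} \<and> Z holomorphic_on {s. Re s > 1} \<and>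
    (\<forall>s. Re s > 1 \<longrightarrow> ((\<lambda>(m, n). complex_of_real (corner_form i j x y m n) powr (-s)) has_sum Z s) UNIV) \<and>
    (Z \<longlongrightarrow> of_real (corner_val i j x y)) (at 0))"
  have "\<forall>k\<in>Fin. \<exists>Z. good k Z"
  proof
    fix k assume k: "k \<in> Fin"
    obtain i j x y where ij: "k = (i, j, x, y)" by (cases k)
    have r: "j < N i" "x < q" "y < q" using k by (auto simp: Fin_def ij)
    show "\<exists>Z. good k Z"
      unfolding good_def ij prod.case
      by (rule cone_continuation[OF r(1)]) (use r q0 in \<open>auto simp: field_simps\<close>)
  qed
  from bchoice[OF this] obtain Z where Z: "\<forall>k\<in>Fin. good k (Z k)" ..
  define v where "v = (\<lambda>(i, j, x, y). corner_wt i j x y)"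
  define g where "g s = C powr (-s) * (\<Sum>k\<in>Fin. v k * Z k s)" for s
  have good: "Z k meromorphic_on {s. Re s > - real R'}" "Z k holomorphic_on {s. Re s > 1}"
    "(Z k \<longlongrightarrow> (case k of (i, j, x, y) \<Rightarrow> of_real (corner_val i j x y))) (at 0)"
    if "k \<in> Fin" for k
    using bspec[OF Z that] by (cases k; simp add: good_def)+
  have "g meromorphic_on {s. Re s > - real R'}"
  proof -
    have "(\<lambda>s. C powr (-s)) meromorphic_on {s. Re s > - real R'}"
      using Cn C0 by (intro analytic_on_imp_meromorphic_on analytic_intros) auto
    then show ?thesis unfolding g_def
      by (intro meromorphic_on_mult meromorphic_on_sum meromorphic_on_const good)
  qed
  moreover have "g holomorphic_on {s. Re s > 1}"
    unfolding g_def by (intro holomorphic_intros good)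
  moreover have "g s = hecke_series D s (norm_character D q chi) b" if "Re s > 1" for s
  proof -
    have "hecke_series D s (norm_character D q chi) b = C powr (- s) *
     (\<Sum>(i, j, x, y)\<in>Fin. corner_wt i j x y * Z (i, j, x, y) s)"
      unfolding C_def
    proof (rule hecke_series_eq[OF that])
      fix i j x y assume "(i, j, x, y) \<in> Fin"
      then have "good (i, j, x, y) (Z (i, j, x, y))" using Z by blast
      then show "((\<lambda>(m, n). complex_of_real (corner_form i j x y m n) powr (-s))
        has_sum Z (i, j, x, y) s) UNIV" using that by (simp only: good_def prod.case)
    qed
    then show ?thesis by (simp add: g_def v_def case_prod_unfold)
  qed
  moreover have "(g \<longlongrightarrow> C powr (- 0) * (\<Sum>k\<in>Fin. v k * (case k of (i, j, x, y) \<Rightarrow> of_real (corner_val i j x y)))) (at 0)"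
    unfolding g_def
  proof (intro tendsto_mult tendsto_sum tendsto_const good)
    show "((\<lambda>s. C powr (- s)) \<longlongrightarrow> C powr (- 0)) (at 0)"
      by (rule isContD, intro continuous_intros) (use C0 Cn in auto)
  qed
  moreover have "C powr (- 0) * (\<Sum>k\<in>Fin. v k * (case k of (i, j, x, y) \<Rightarrow> of_real (corner_val i j x y))) = Lval"
    using C0 by (simp add: Lval_def v_def case_prod_unfold)
  ultimately show "\<exists>g. g meromorphic_on {s. Re s > - real R'} \<and> g holomorphic_on {s. Re s > 1} \<and>
      (\<forall>s. Re s > 1 \<longrightarrow> g s = hecke_series D s (norm_character D q chi) b) \<and> (g \<longlongrightarrow> Lval) (at 0)"
    by (intro exI[of _ g]) simp
qed

end

subsection \<open>Telescoping the value at 0\<close>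

lemma mod_lin2: "(\<alpha> * (A mod k) + \<beta> * (B mod k)) mod k = (\<alpha> * A + \<beta> * B) mod (k :: int)"
proof -
  have "(\<alpha> * (A mod k) + \<beta> * (B mod k)) mod k = ((\<alpha> * (A mod k)) mod k + (\<beta> * (B mod k)) mod k) mod k"
    by (simp only: mod_add_eq)
  then show ?thesis by (simp only: mod_mult_right_eq mod_add_eq)
qed

lemma mod_lin1: "(A + \<beta> * (B mod k)) mod k = (A + \<beta> * B) mod (k :: int)"
proof -
  have "(A + \<beta> * (B mod k)) mod k = (A + (\<beta> * (B mod k)) mod k) mod k" by (simp only: mod_add_right_eq)
  then show ?thesis by (simp only: mod_mult_right_eq mod_add_right_eq)
qed

context hecke_character
begin

abbreviation IQ :: "int set" where "IQ \<equiv> {0..<int q}"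

definition b2 :: "real \<Rightarrow> real" where "b2 x = x\<^sup>2 - x + 1/6"

text \<open>The coordinates of a point in the cone basis \<open>u i j, u i (j + 1)\<close> are \<open>1 - tr (j + 1) / q\<close> and
  \<open>tr j / q\<close> modulo 1, if \<open>X / q\<close>, \<open>Y / q\<close> are those in the basis \<open>e (2 i), e (2 i + 1)\<close>.\<close>

definition tr :: "nat \<Rightarrow> int \<Rightarrow> int \<Rightarrow> int" where "tr j X Y = (- Y - int j * X) mod int q"

abbreviation trq :: "nat \<Rightarrow> int \<Rightarrow> int \<Rightarrow> real" where
  "trq j X Y \<equiv> of_int (tr j X Y) / real q"

text \<open>Weights in a basis that is common to all cones of the block \<open>i\<close>, so that
  the sum over \<open>j\<close> can be taken for a fixed weight.\<close>

definition wti :: "nat \<Rightarrow> int \<Rightarrow> int \<Rightarrow> complex" where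
  "wti i X Y = wt (of_int X * e (2 * i) + of_int Y * e (2 * i + 1))"

lemma wt_lin_cong:
  assumes "z \<in> M" "z' \<in> M"
  shows "wt (of_int X * z + of_int Y * z') = wt (of_int (X mod int q) * z + of_int (Y mod int q) * z')"
proof -
  have "of_int X * z + of_int Y * z' = (of_int (X mod int q) * z + of_int (Y mod int q) * z')
      + of_int (int q) * (of_int (X div int q) * z + of_int (Y div int q) * z')"
  proof -
    have "real_of_int X = of_int (int q * (X div int q) + X mod int q)"
      "real_of_int Y = of_int (int q * (Y div int q) + Y mod int q)" by simp_all
    then show ?thesis by (simp only: of_int_add of_int_mult) (simp only: algebra_simps)
  qed
  then show ?thesis using assms by (simp only: wt_cong M_add M_int)
qed

lemma wti_mod: "wti i X Y = wti i (X mod int q) (Y mod int q)"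
  unfolding wti_def by (rule wt_lin_cong) (intro e_M)+

lemma tr_mod: "tr j (X mod int q) (Y mod int q) = tr j X Y"
  using mod_lin2[of "-1" Y "int q" "- int j" X] by (simp add: tr_def)

text \<open>In the basis \<open>e (2 * i)\<close>, \<open>e (2 * i + 1)\<close> the corner has the
  coordinates \<open>X = x + 1 + y\<close> and \<open>Y = - y - j * X\<close>. This is invertible
  modulo \<open>q\<close>: \<open>y\<close> is \<open>tr j\<close> and \<open>x\<close> is
  \<open>q - 1 - tr (j + 1)\<close>.\<close>

lemma sum_cone_reindex:
  "(\<Sum>(x, y)\<in>{..<q} \<times> {..<q}. corner_wt i j x y *
      of_real (f (real (Suc x) / real q) (real y / real q)))
   = (\<Sum>(X, Y)\<in>IQ \<times> IQ. wti i X Y *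
      of_real (f (1 - trq (Suc j) X Y) (trq j X Y)))"
proof -
  have q0: "int q > 0" using q by simp
  define jf where "jf = (\<lambda>(x, y). ((int x + 1 + int y) mod int q, (- int y - int j * (int x + 1 + int y)) mod int q))"
  define gf where "gf = (\<lambda>(X, Y). (nat (int q - 1 - tr (Suc j) X Y), nat (tr j X Y)))"
  define G where "G = (\<lambda>(x, y). corner_wt i j x y *
      of_real (f (real (Suc x) / real q) (real y / real q)))"
  define H where "H = (\<lambda>(X, Y). wti i X Y *
      of_real (f (1 - trq (Suc j) X Y) (trq j X Y)))"
  have 1: "gf (jf (x, y)) = (x, y)" "jf (x, y) \<in> IQ \<times> IQ" "H (jf (x, y)) = G (x, y)"
    if xy: "x < q" "y < q" for x y
  proof -
    define A where "A = int x + 1 + int y"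
    define B where "B = - int y - int j * A"
    have jf: "jf (x, y) = (A mod int q, B mod int q)" by (simp add: jf_def A_def B_def)
    have t1: "tr j (A mod int q) (B mod int q) = int y"
    proof -
      have "tr j (A mod int q) (B mod int q) = (- B - int j * A) mod int q"
        unfolding tr_mod by (simp add: tr_def)
      then show ?thesis using xy by (simp add: B_def)
    qed
    have t2: "tr (Suc j) (A mod int q) (B mod int q) = int q - 1 - int x"
    proof -
      have "tr (Suc j) (A mod int q) (B mod int q) = (- B - int (Suc j) * A) mod int q"
        unfolding tr_mod by (simp only: tr_def)
      also have "- B - int (Suc j) * A = (int q - 1 - int x) + int q * (-1)" by (simp add: B_def A_def algebra_simps)
      also have "\<dots> mod int q = (int q - 1 - int x) mod int q" by (rule mod_mult_self2)
      also have "\<dots> = int q - 1 - int x" using xy by (intro mod_pos_pos_trivial) auto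
      finally show ?thesis .
    qed
    show "gf (jf (x, y)) = (x, y)" unfolding jf gf_def prod.case t1 t2 by simp
    show "jf (x, y) \<in> IQ \<times> IQ" unfolding jf using q0 by simp
    have "real (Suc x) * u i j + real y * u i (Suc j) = of_int A * e (2 * i) + of_int B * e (2 * i + 1)"
      unfolding A_def B_def u_def by (simp add: algebra_simps)
    then have "corner_wt i j x y = wti i A B" by (simp only: wti_def)
    also have "\<dots> = wti i (A mod int q) (B mod int q)" by (rule wti_mod)
    finally have w: "wti i (A mod int q) (B mod int q) = corner_wt i j x y" ..
    have "1 - of_int (tr (Suc j) (A mod int q) (B mod int q)) / real q = real (Suc x) / real q"
      unfolding t2 using q by (simp add: field_simps)
    then show "H (jf (x, y)) = G (x, y)" unfolding jf H_def G_def prod.case t1 w by simp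
  qed
  have 2: "jf (gf (X, Y)) = (X, Y)" "gf (X, Y) \<in> {..<q} \<times> {..<q}" if XY: "X \<in> IQ" "Y \<in> IQ" for X Y
  proof -
    have r: "0 \<le> tr k X Y" "tr k X Y < int q" for k using q0 by (simp_all add: tr_def)
    show "gf (X, Y) \<in> {..<q} \<times> {..<q}" using r[of j] r[of "Suc j"] by (auto simp: gf_def)
    define x where "x = int q - 1 - tr (Suc j) X Y"
    define y where "y = tr j X Y"
    have "(x + 1 + y) mod int q = (tr j X Y - tr (Suc j) X Y + int q) mod int q" by (simp add: x_def y_def algebra_simps)
    also have "\<dots> = (tr j X Y - tr (Suc j) X Y) mod int q" by simp
    also have "\<dots> = ((- Y - int j * X) - (- Y - int (Suc j) * X)) mod int q"
      unfolding tr_def by (rule mod_diff_eq)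
    also have "\<dots> = X" using XY by (simp add: algebra_simps)
    finally have 1: "(x + 1 + y) mod int q = X" .
    have "(- y - int j * (x + 1 + y)) mod int q = (- y + (- int j) * ((x + 1 + y) mod int q)) mod int q"
      unfolding mod_lin1 by simp
    also have "\<dots> = ((- int j) * X + (- 1) * ((- Y - int j * X) mod int q)) mod int q"
      unfolding 1 unfolding y_def tr_def by (simp add: add.commute)
    also have "\<dots> = Y" unfolding mod_lin1 using XY by simp
    finally have 2: "(- y - int j * (x + 1 + y)) mod int q = Y" .
    have "gf (X, Y) = (nat x, nat y)" "int (nat x) = x" "int (nat y) = y"
      using r[of j] r[of "Suc j"] by (auto simp: gf_def x_def y_def)
    then show "jf (gf (X, Y)) = (X, Y)" using 1 2 by (simp only: jf_def prod.case)
  qed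
  have "sum G ({..<q} \<times> {..<q}) = sum H (IQ \<times> IQ)"
  proof (rule sum.reindex_bij_witness[where i = gf and j = jf])
    fix xy assume "xy \<in> {..<q} \<times> {..<q}"
    then show "gf (jf xy) = xy" "jf xy \<in> IQ \<times> IQ" "H (jf xy) = G xy" using 1 by (cases xy; simp)+
  next
    fix XY assume "XY \<in> IQ \<times> IQ"
    then show "jf (gf XY) = XY" "gf XY \<in> {..<q} \<times> {..<q}" using 2 by (cases XY; simp)+
  qed
  then show ?thesis by (simp only: G_def H_def)
qed

text \<open>The trace of \<open>e (2 * i + 1) / u i j\<close>. As \<open>u i j - u i (j + 1)\<close>
  is \<open>e (2 * i + 1)\<close>, the quotient of \<open>qB i j\<close> by
  \<open>qA i (j + 1)\<close> is \<open>2 + \<tau> i (j + 1)\<close> and that by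
  \<open>qA i j\<close> is \<open>2 - \<tau> i j\<close>.\<close>

definition \<tau> :: "nat \<Rightarrow> nat \<Rightarrow> real" where
  "\<tau> i j = e (2 * i + 1) / u i j + cj (e (2 * i + 1)) / cj (u i j)"

lemma tr_step:
  assumes "X \<in> IQ"
  shows "tr j X Y - tr (Suc j) X Y = X \<or> tr j X Y - tr (Suc j) X Y = X - int q"
proof -
  define r where "r = tr j X Y"
  have r: "0 \<le> r" "r < int q" using q by (simp_all add: r_def tr_def)
  have "tr (Suc j) X Y = (- Y - int j * X - X) mod int q" by (simp add: tr_def algebra_simps)
  also have "\<dots> = (r - X) mod int q" unfolding r_def tr_def by (simp only: mod_diff_left_eq)
  finally have e: "tr (Suc j) X Y = (r - X) mod int q" .
  show ?thesis
  proof (cases "r \<ge> X")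
    case True
    then have "(r - X) mod int q = r - X" using r assms by (intro mod_pos_pos_trivial) auto
    then show ?thesis using e by (simp add: r_def[symmetric])
  next
    case False
    have "(r - X) mod int q = (r - X + int q * 1) mod int q" by simp
    also have "\<dots> = r - X + int q" using False r assms by (subst mod_pos_pos_trivial) auto
    finally show ?thesis using e by (simp add: r_def[symmetric])
  qed
qed

text \<open>With \<open>d = trq j - trq (j + 1) \<in> {X / q, X / q - 1}\<close>, the square \<open>d\<^sup>2\<close> is affine in \<open>d\<close>;
  this makes the sum over \<open>j\<close> telescope.\<close>

lemma cone_val_step:
  assumes j: "j < N i" and X: "X \<in> IQ"
  shows "cone_val i j (1 - trq (Suc j) X Y) (trq j X Y)
    = (of_int X / real q - 1/2) * (trq j X Y - trq (Suc j) X Y)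
      - b2 (of_int X / real q) / 2
      + (\<tau> i (Suc j) * b2 (trq (Suc j) X Y) - \<tau> i j * b2 (trq j X Y)) / 4"
proof -
  define x0 where "x0 = of_int X / real q"
  define v where "v = trq j X Y"
  define v' where "v' = trq (Suc j) X Y"
  have q0: "real q > 0" using q by simp
  have vv: "v - v' = x0 \<or> v - v' = x0 - 1"
  proof -
    have v: "v - v' = of_int (tr j X Y - tr (Suc j) X Y) / real q" by (simp add: v_def v'_def diff_divide_distrib)
    from tr_step[OF X, of j Y] show ?thesis
    proof
      assume "tr j X Y - tr (Suc j) X Y = X"
      then show ?thesis unfolding v x0_def by simp
    next
      assume *: "tr j X Y - tr (Suc j) X Y = X - int q"
      have "v - v' = x0 - 1" unfolding v * x0_def using q0 by (simp add: diff_divide_distrib)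
      then show ?thesis ..
    qed
  qed
  have sq: "(v - v')\<^sup>2 = (v - v') * (2 * x0 - 1) + x0 - x0\<^sup>2"
    using vv
  proof
    assume "v - v' = x0"
    then show ?thesis by (simp add: power2_eq_square algebra_simps)
  next
    assume "v - v' = x0 - 1"
    then show ?thesis by (simp only:) (simp add: power2_eq_square algebra_simps)
  qed
  have up: "u i j > 0" "u i (Suc j) > 0" "cj (u i j) > 0" "cj (u i (Suc j)) > 0"
    using j u_pos cj_u_pos by auto
  have u1: "u i j = u i (Suc j) + e (2 * i + 1)" by (simp add: u_def algebra_simps)
  have u2: "cj (u i j) = cj (u i (Suc j)) + cj (e (2 * i + 1))"
    unfolding u1 using K_add[OF u_K e_K] by blast
  have B1: "qB i j / (4 * qA i (Suc j)) = (2 + \<tau> i (Suc j)) / 4"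
  proof -
    have "qB i j / qA i (Suc j) = u i j / u i (Suc j) + cj (u i j) / cj (u i (Suc j))"
      unfolding qA_def qB_def using up by (simp add: field_simps)
    also have "\<dots> = 2 + \<tau> i (Suc j)" unfolding u2 unfolding u1 \<tau>_def using up by (simp add: field_simps)
    finally show ?thesis by simp
  qed
  have u1': "u i (Suc j) = u i j - e (2 * i + 1)" using u1 by simp
  have u2': "cj (u i (Suc j)) = cj (u i j) - cj (e (2 * i + 1))" using u2 by simp
  have B2: "qB i j / (4 * qA i j) = (2 - \<tau> i j) / 4"
  proof -
    have "qB i j / qA i j = cj (u i (Suc j)) / cj (u i j) + u i (Suc j) / u i j"
      unfolding qA_def qB_def using up by (simp add: field_simps)
    also have "\<dots> = 2 - \<tau> i j" unfolding u2' unfolding u1' \<tau>_def using up by (simp add: field_simps)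
    finally show ?thesis by simp
  qed
  have "cone_val i j (1 - v') v = ((v - v')\<^sup>2 / 2 - 1/12) + (\<tau> i (Suc j) * b2 v' - \<tau> i j * b2 v) / 4"
    unfolding cone_val_def B1 B2 b2_def by (simp add: power2_eq_square field_simps)
  also have "(v - v')\<^sup>2 / 2 - 1/12 = (x0 - 1/2) * (v - v') - b2 x0 / 2"
    unfolding sq b2_def by (simp add: field_simps)
  finally show ?thesis by (simp only: x0_def v_def v'_def)
qed

lemma cone_val_sum:
  assumes X: "X \<in> IQ" and n: "n \<le> N i"
  shows "(\<Sum>j<n. cone_val i j (1 - trq (Suc j) X Y) (trq j X Y))
    = (of_int X / real q - 1/2) * (trq 0 X Y - trq n X Y)
      - real n * b2 (of_int X / real q) / 2
      + (\<tau> i n * b2 (trq n X Y) - \<tau> i 0 * b2 (trq 0 X Y)) / 4"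
  using n
proof (induction n)
  case (Suc n)
  then have "n < N i" by simp
  from cone_val_step[OF this X, of Y] Suc show ?case
    by (simp add: distrib_left distrib_right left_diff_distrib right_diff_distrib add_divide_distrib diff_divide_distrib)
qed simp

section \<open>Cancellation of the terms at even vectors\<close>

definition TW :: "nat \<Rightarrow> real" where "TW i = W (2 * i) + t (2 * i)"

text \<open>\<open>e (2 * i + 1) / e (2 * i)\<close> is the fractional part of
  \<open>W (2 * i)\<close>. The subtracted multiple of \<open>a (2 * i)\<close> is the source of the
  even partial quotients in the final formula.\<close>

lemma \<tau>_0: "\<tau> i 0 = TW i - 2 * of_int (a (2 * i))"
proof -
  have "e (2 * i + 1) / e (2 * i) = W (2 * i) - of_int (a (2 * i))"
    using e_pos[of "2 * i"] by (simp add: e.simps(2))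
  moreover have "cj (e (2 * i + 1)) / cj (e (2 * i)) = t (2 * i) - of_int (a (2 * i))"
    unfolding cj_e using c_pos[of "2 * i"] by (simp add: c_Suc)
  ultimately show ?thesis by (simp add: \<tau>_def u_0 TW_def)
qed

lemma \<tau>_N: "\<tau> i (N i) = TW (Suc i)"
proof -
  have W: "e (2 * i + 1) = W (2 * Suc i) * e (2 * Suc i)" using e_W[of "2 * i + 1"] by simp
  have "cj (e (2 * i + 1)) = t (2 * Suc i) * cj (e (2 * Suc i))"
    unfolding W t_def using K_mult[OF W_K e_K] by blast
  moreover have "cj (e (2 * Suc i)) \<noteq> 0" unfolding cj_e using c_pos[of "2 * Suc i"] by simp
  moreover have "e (2 * Suc i) \<noteq> 0" using e_pos[of "2 * Suc i"] by simp
  ultimately show ?thesis unfolding \<tau>_def u_N TW_def using W by simp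
qed

definition SB :: "nat \<Rightarrow> complex" where
  "SB i = (\<Sum>(X, Y)\<in>IQ \<times> IQ. wti i X Y * of_real (b2 (trq 0 X Y)))"

text \<open>Passing to the basis \<open>e (2 * i + 2)\<close>, \<open>e (2 * i + 3)\<close> permutes
  the residue pairs and turns \<open>tr (N i)\<close> into \<open>tr 0\<close>, because the new
  second coordinate is \<open>Y + N i * X\<close>.\<close>

lemma SB_Suc: "(\<Sum>(X, Y)\<in>IQ \<times> IQ. wti i X Y * of_real (b2 (trq (N i) X Y))) = SB (Suc i)"
proof -
  have q0: "int q > 0" using q by simp
  define \<alpha> where "\<alpha> = a (2 * i + 2)"
  define \<beta> where "\<beta> = int (N i)"
  define jf where "jf = (\<lambda>(X, Y). ((X + \<alpha> * (Y + \<beta> * X)) mod int q, (Y + \<beta> * X) mod int q))"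
  define gf where "gf = (\<lambda>(X, Y). ((X - \<alpha> * Y) mod int q, (Y - \<beta> * (X - \<alpha> * Y)) mod int q))"
  define G where "G = (\<lambda>(X, Y). wti i X Y * of_real (b2 (trq (N i) X Y)))"
  define H where "H = (\<lambda>(X, Y). wti (Suc i) X Y * of_real (b2 (trq 0 X Y)))"
  have 1: "gf (jf (X, Y)) = (X, Y)" "jf (X, Y) \<in> IQ \<times> IQ" "H (jf (X, Y)) = G (X, Y)"
    if XY: "X \<in> IQ" "Y \<in> IQ" for X Y
  proof -
    define B where "B = Y + \<beta> * X"
    define A where "A = X + \<alpha> * B"
    define T where "T = A mod int q - \<alpha> * (B mod int q)"
    have jf: "jf (X, Y) = (A mod int q, B mod int q)" by (simp add: jf_def A_def B_def)
    have m: "T mod int q = X"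
      using mod_lin2[of 1 A "int q" "- \<alpha>" B] XY by (simp add: A_def T_def)
    have "(B mod int q - \<beta> * T) mod int q = (B mod int q + (- \<beta>) * (T mod int q)) mod int q"
      unfolding mod_lin1 by simp
    also have "\<dots> = (B mod int q - \<beta> * X) mod int q" unfolding m by simp
    also have "\<dots> = (B - \<beta> * X) mod int q" by (rule mod_diff_left_eq)
    also have "\<dots> = Y" using XY by (simp add: B_def)
    finally show "gf (jf (X, Y)) = (X, Y)" using m unfolding jf gf_def prod.case T_def by simp
    show "jf (X, Y) \<in> IQ \<times> IQ" unfolding jf using q0 by simp
    have e1: "e (2 * i) = e (2 * Suc i) + of_int \<beta> * e (2 * i + 1)" using e_rec2[of i] by (simp add: \<beta>_def)
    have e2: "e (2 * i + 1) = e (2 * Suc i + 1) + of_int \<alpha> * e (2 * Suc i)"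
      using e_rec[of "2 * i + 1"] by (simp add: \<alpha>_def)
    have "of_int X * e (2 * i) + of_int Y * e (2 * i + 1) = of_int X * e (2 * Suc i) + of_int B * e (2 * i + 1)"
      unfolding e1 B_def by (simp add: algebra_simps)
    also have "\<dots> = of_int A * e (2 * Suc i) + of_int B * e (2 * Suc i + 1)"
      unfolding e2 A_def by (simp add: algebra_simps)
    finally have "wti i X Y = wti (Suc i) A B" by (simp only: wti_def)
    also have "\<dots> = wti (Suc i) (A mod int q) (B mod int q)" by (rule wti_mod)
    finally have w: "wti (Suc i) (A mod int q) (B mod int q) = wti i X Y" ..
    have "tr 0 (A mod int q) (B mod int q) = tr (N i) X Y"
      unfolding tr_mod by (simp add: tr_def B_def \<beta>_def)
    then show "H (jf (X, Y)) = G (X, Y)" unfolding jf H_def G_def prod.case w by simp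
  qed
  have 2: "jf (gf (X, Y)) = (X, Y)" "gf (X, Y) \<in> IQ \<times> IQ" if XY: "X \<in> IQ" "Y \<in> IQ" for X Y
  proof -
    define A where "A = X - \<alpha> * Y"
    define T where "T = (Y - \<beta> * A) mod int q + \<beta> * (A mod int q)"
    have gf: "gf (X, Y) = (A mod int q, (Y - \<beta> * A) mod int q)" by (simp add: gf_def A_def)
    have m: "T mod int q = Y"
      using mod_lin2[of 1 "Y - \<beta> * A" "int q" \<beta> A] XY by (simp add: T_def)
    have "(A mod int q + \<alpha> * T) mod int q = (A mod int q + \<alpha> * (T mod int q)) mod int q"
      unfolding mod_lin1 ..
    also have "\<dots> = (A + \<alpha> * Y) mod int q" unfolding m by (rule mod_add_left_eq)
    also have "\<dots> = X" using XY by (simp add: A_def)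
    finally show "jf (gf (X, Y)) = (X, Y)" using m unfolding gf jf_def prod.case T_def by simp
    show "gf (X, Y) \<in> IQ \<times> IQ" unfolding gf using q0 by simp
  qed
  have "sum G (IQ \<times> IQ) = sum H (IQ \<times> IQ)"
  proof (rule sum.reindex_bij_witness[where i = gf and j = jf])
    fix XY assume "XY \<in> IQ \<times> IQ"
    then show "gf (jf XY) = XY" "jf XY \<in> IQ \<times> IQ" "H (jf XY) = G XY" using 1 by (cases XY; simp)+
  next
    fix XY assume "XY \<in> IQ \<times> IQ"
    then show "jf (gf XY) = XY" "gf XY \<in> IQ \<times> IQ" using 2 by (cases XY; simp)+
  qed
  then show ?thesis by (simp only: G_def H_def SB_def)
qed

lemma wti_p: "wti p X Y = wti 0 X Y"
proof -
  have e1: "e (2 * p) = \<eta> * e 0" "e (2 * p + 1) = \<eta> * e (Suc 0)"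
    using e_len[of 0] e_len[of "Suc 0"] len_eqs(1) by (simp_all add: e.simps(2))
  have "of_int X * e (2 * p) + of_int Y * e (2 * p + 1) = \<eta> * (of_int X * e 0 + of_int Y * e (Suc 0))"
    unfolding e1 by (simp add: algebra_simps)
  then show ?thesis
    unfolding wti_def wt_def using \<nu>_\<eta>[OF M_add[OF M_int[OF e_M[of 0]] M_int[OF e_M[of "Suc 0"]]], of X Y]
    by simp
qed

lemma SB_p: "SB p = SB 0"
  unfolding SB_def by (simp add: wti_p)

lemma TW_p: "TW p = TW 0"
  using W_len[of 0] len_eqs(1) by (simp add: TW_def t_def)

text \<open>In block \<open>i\<close> the trace terms add up to a quarter of
  \<open>TW (Suc i) * SB (Suc i) - TW i * SB i\<close>. This telescopes over the blocks to 0, since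
  multiplication by \<open>\<eta>\<close> returns both factors to their initial values.\<close>

theorem Lval_eq:
  "Lval = (\<Sum>i<p. \<Sum>(X, Y)\<in>IQ \<times> IQ. wti i X Y * of_real (
      (of_int X / real q - 1/2) * (trq 0 X Y - trq (N i) X Y)
      - real (N i) * b2 (of_int X / real q) / 2 + of_int (a (2 * i)) * b2 (trq 0 X Y) / 2))"
proof -
  define m where "m i X Y = (of_int X / real q - 1/2) * (trq 0 X Y - trq (N i) X Y)
      - real (N i) * b2 (of_int X / real q) / 2 + of_int (a (2 * i)) * b2 (trq 0 X Y) / 2" for i X Y
  have blk: "(\<Sum>j<N i. \<Sum>(x, y)\<in>{..<q} \<times> {..<q}. corner_wt i j x y *
      of_real (corner_val i j x y))
    = (\<Sum>(X, Y)\<in>IQ \<times> IQ. wti i X Y * of_real (m i X Y))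
      + (of_real (TW (Suc i)) * SB (Suc i) - of_real (TW i) * SB i) / 4" for i
  proof -
    have "(\<Sum>j<N i. \<Sum>(x, y)\<in>{..<q} \<times> {..<q}. corner_wt i j x y *
        of_real (corner_val i j x y))
      = (\<Sum>j<N i. \<Sum>XY\<in>IQ \<times> IQ. wti i (fst XY) (snd XY) *
      of_real (cone_val i j (1 - trq (Suc j) (fst XY) (snd XY)) (trq j (fst XY) (snd XY))))"
      unfolding sum_cone_reindex by (simp only: case_prod_unfold)
    also have "\<dots> = (\<Sum>XY\<in>IQ \<times> IQ. wti i (fst XY) (snd XY) *
      of_real (\<Sum>j<N i. cone_val i j (1 - trq (Suc j) (fst XY) (snd XY)) (trq j (fst XY) (snd XY))))"
      by (subst sum.swap) (simp add: sum_distrib_left)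
    also have "\<dots> = (\<Sum>XY\<in>IQ \<times> IQ. wti i (fst XY) (snd XY) * of_real (m i (fst XY) (snd XY))
       + (of_real (TW (Suc i)) * (wti i (fst XY) (snd XY) * of_real (b2 (trq (N i) (fst XY) (snd XY))))
          - of_real (TW i) * (wti i (fst XY) (snd XY) * of_real (b2 (trq 0 (fst XY) (snd XY))))) / 4)"
    proof (rule sum.cong[OF refl])
      fix XY assume "XY \<in> IQ \<times> IQ"
      then have X: "fst XY \<in> IQ" by auto
      have "(\<Sum>j<N i. cone_val i j (1 - trq (Suc j) (fst XY) (snd XY)) (trq j (fst XY) (snd XY)))
        = m i (fst XY) (snd XY) + (TW (Suc i) * b2 (trq (N i) (fst XY) (snd XY))
           - TW i * b2 (trq 0 (fst XY) (snd XY))) / 4"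
        unfolding cone_val_sum[OF X order_refl] \<tau>_0 \<tau>_N m_def by (simp add: field_simps)
      then show "wti i (fst XY) (snd XY) *
          of_real (\<Sum>j<N i. cone_val i j (1 - trq (Suc j) (fst XY) (snd XY)) (trq j (fst XY) (snd XY)))
        = wti i (fst XY) (snd XY) * of_real (m i (fst XY) (snd XY))
       + (of_real (TW (Suc i)) * (wti i (fst XY) (snd XY) * of_real (b2 (trq (N i) (fst XY) (snd XY))))
          - of_real (TW i) * (wti i (fst XY) (snd XY) * of_real (b2 (trq 0 (fst XY) (snd XY))))) / 4"
        by (simp only: of_real_add of_real_diff of_real_mult of_real_divide of_real_numeral)
          (simp add: field_simps)
    qed
    also have "\<dots> = (\<Sum>XY\<in>IQ \<times> IQ. wti i (fst XY) (snd XY) * of_real (m i (fst XY) (snd XY)))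
      + (of_real (TW (Suc i)) * (\<Sum>XY\<in>IQ \<times> IQ. wti i (fst XY) (snd XY) * of_real (b2 (trq (N i) (fst XY) (snd XY))))
         - of_real (TW i) * (\<Sum>XY\<in>IQ \<times> IQ. wti i (fst XY) (snd XY) * of_real (b2 (trq 0 (fst XY) (snd XY))))) / 4"
      by (simp only: sum.distrib sum_divide_distrib[symmetric] sum_subtractf sum_distrib_left[symmetric])
    finally show ?thesis
      using SB_Suc[of i] SB_def[of i] by (simp only: case_prod_unfold)
  qed
  have "Lval = (\<Sum>i<p. \<Sum>j<N i. \<Sum>(x, y)\<in>{..<q} \<times> {..<q}. corner_wt i j x y *
      of_real (corner_val i j x y))"
  proof -
    define g where "g i j x y = corner_wt i j x y *
      of_real (corner_val i j x y)" for i j x y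
    have "Lval = (\<Sum>i<p. \<Sum>k\<in>(SIGMA j:{..<N i}. {..<q} \<times> {..<q}). case k of (j, x, y) \<Rightarrow> g i j x y)"
      unfolding Lval_def Fin_def g_def[symmetric] by (rule sum.Sigma[symmetric]) auto
    also have "\<dots> = (\<Sum>i<p. \<Sum>j<N i. \<Sum>k\<in>{..<q} \<times> {..<q}. case k of (x, y) \<Rightarrow> g i j x y)"
      by (intro sum.cong refl sum.Sigma[symmetric]) auto
    finally show ?thesis by (simp only: g_def)
  qed
  also have "\<dots> = (\<Sum>i<p. \<Sum>(X, Y)\<in>IQ \<times> IQ. wti i X Y * of_real (m i X Y))
      + (\<Sum>i<p. of_real (TW (Suc i)) * SB (Suc i) - of_real (TW i) * SB i) / 4"
    unfolding blk by (simp only: sum.distrib sum_divide_distrib[symmetric])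
  also have "(\<Sum>i<p. of_real (TW (Suc i)) * SB (Suc i) - of_real (TW i) * SB i) = of_real (TW p) * SB p - of_real (TW 0) * SB 0"
    by (rule sum_lessThan_telescope)
  finally show ?thesis by (simp add: SB_p TW_p m_def)
qed

end

subsection \<open>Dependence on the partial quotients\<close>

text \<open>\<open>lattice_coord A k\<close> are the coordinates with respect to \<open>1, \<delta>\<close> of the \<open>k\<close>-th vector
  \<open>e k\<close> for the partial quotients \<open>A\<close>.\<close>

fun lattice_coord :: "(nat \<Rightarrow> int) \<Rightarrow> nat \<Rightarrow> int \<times> int" where
  "lattice_coord A 0 = (1, 0)"
| "lattice_coord A (Suc 0) = (- 1 - A 0, 1)"
| "lattice_coord A (Suc (Suc k)) = (fst (lattice_coord A k) - A (Suc k) * fst (lattice_coord A (Suc k)),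
     snd (lattice_coord A k) - A (Suc k) * snd (lattice_coord A (Suc k)))"

lemma lattice_coord_cong:
  assumes "\<And>k. A k mod m = A' k mod m"
  shows "fst (lattice_coord A k) mod m = fst (lattice_coord A' k) mod m \<and>
    snd (lattice_coord A k) mod m = snd (lattice_coord A' k) mod m"
proof (induction k rule: induct_nat_012)
  case 1
  have "(- 1 - A 0) mod m = (- 1 - A' 0) mod m" by (intro mod_diff_cong refl assms)
  then show ?case by simp
next
  case (ge2 k)
  then show ?case by (auto intro!: mod_diff_cong mod_mult_cong assms)
qed simp

text \<open>The residue class of 0 is treated apart, since \<open>r\<close> is prescribed only for
  other pairs; there the norm is 0 modulo \<open>q\<close>. Writing \<open>chi 0\<close> also covers
  \<open>q = 1\<close>, where this value is 1.\<close>

definition residue_weight :: "nat \<Rightarrow> (int \<Rightarrow> complex) \<Rightarrow> (nat \<Rightarrow> nat \<Rightarrow> nat) \<Rightarrow> int \<Rightarrow> int \<Rightarrow> complex" where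
  "residue_weight q chi r C D = (let c = nat (C mod int q); d = nat (D mod int q)
     in if (c, d) = (0, 0) then chi 0 else chi (int (r c d)))"

definition cone_weight ::
    "nat \<Rightarrow> (int \<Rightarrow> complex) \<Rightarrow> (nat \<Rightarrow> nat \<Rightarrow> nat) \<Rightarrow> (nat \<Rightarrow> int) \<Rightarrow> nat \<Rightarrow> int \<Rightarrow> int \<Rightarrow> complex" where
  "cone_weight q chi r A i X Y = residue_weight q chi r
     (X * fst (lattice_coord A (2 * i)) + Y * fst (lattice_coord A (2 * i + 1)))
     (X * snd (lattice_coord A (2 * i)) + Y * snd (lattice_coord A (2 * i + 1)))"

lemma cone_weight_cong:
  assumes "\<And>k. A k mod int q = A' k mod int q"
  shows "cone_weight q chi r A i X Y = cone_weight q chi r A' i X Y"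
proof -
  have "(X * fst (lattice_coord A (2 * i)) + Y * fst (lattice_coord A (2 * i + 1))) mod int q
      = (X * fst (lattice_coord A' (2 * i)) + Y * fst (lattice_coord A' (2 * i + 1))) mod int q"
    "(X * snd (lattice_coord A (2 * i)) + Y * snd (lattice_coord A (2 * i + 1))) mod int q
      = (X * snd (lattice_coord A' (2 * i)) + Y * snd (lattice_coord A' (2 * i + 1))) mod int q"
    using lattice_coord_cong[of A "int q" A', OF assms] by (intro mod_add_cong mod_mult_cong refl; blast)+
  then show ?thesis by (simp only: cone_weight_def residue_weight_def)
qed

text \<open>\<open>scaled_b2 q X\<close> is \<open>6q\<^sup>2 B\<^sub>2(X/q)\<close>, with \<open>B\<^sub>2\<close> the second Bernoulli polynomial.\<close>

definition scaled_b2 :: "nat \<Rightarrow> int \<Rightarrow> int" where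
  "scaled_b2 q X = 6 * X\<^sup>2 - 6 * int q * X + (int q)\<^sup>2"

text \<open>This is \<open>12 * q ^ 2\<close> times the product of the first summand in
  \<open>Lval_eq\<close>; it depends on the partial quotient only modulo \<open>q\<close>.\<close>

definition mixed_term :: "nat \<Rightarrow> int \<Rightarrow> int \<Rightarrow> int \<Rightarrow> int" where
  "mixed_term q \<alpha> X Y = (12 * X - 6 * int q) * ((- Y) mod int q - (- Y - \<alpha> * X) mod int q)"

context hecke_character
begin

lemma e_coord: "e k = of_int (fst (lattice_coord a k)) * 1 + of_int (snd (lattice_coord a k)) * (w + 1)"
proof (induction k rule: induct_nat_012)
  case 1
  show ?case by (simp add: e.simps(2))
next
  case (ge2 k)
  have "e (Suc (Suc k)) = e k - of_int (a (Suc k)) * e (Suc k)" using e_rec[of k] by simp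
  then show ?case unfolding ge2 by (simp add: algebra_simps)
qed simp

text \<open>Both embeddings of \<open>w + 1\<close> are positive, as the conjugate of
  \<open>w\<close> exceeds -1. So nonzero combinations of 1 and \<open>w + 1\<close> with natural
  coefficients are totally positive, and their weights are given by ideal norms.\<close>

lemma wt_coord:
  assumes r: "\<And>x y. x < q \<Longrightarrow> y < q \<Longrightarrow> (x, y) \<noteq> (0, 0) \<Longrightarrow>
      ideal_norm D (scale_ideal (real x + real y * (w + 1)) b) mod q = r x y"
  shows "wt (of_int X * 1 + of_int Y * (w + 1)) = residue_weight q chi r X Y"
proof -
  define x where "x = nat (X mod int q)"
  define y where "y = nat (Y mod int q)"
  have q0: "int q > 0" using q by simp
  have xy: "int x = X mod int q" "int y = Y mod int q" "x < q" "y < q"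
    using q0 by (simp_all add: x_def y_def nat_less_iff)
  have \<delta>: "w + 1 \<in> M" "1 \<in> M" by (intro M_add w_M one_M)+
  have "wt (of_int X * 1 + of_int Y * (w + 1)) = wt (of_int (int x) * 1 + of_int (int y) * (w + 1))"
    unfolding xy(1,2) by (rule wt_lin_cong[OF \<delta>(2,1)])
  also have "\<dots> = wt (real x + real y * (w + 1))" by simp
  also have "\<dots> = residue_weight q chi r X Y"
  proof (cases "(x, y) = (0, 0)")
    case True
    then have "wt (real x + real y * (w + 1)) = chi 0" by (simp add: wt_def \<nu>_def)
    then show ?thesis using True by (simp add: residue_weight_def x_def[symmetric] y_def[symmetric])
  next
    case False
    have cjd: "cj (real x + real y * (w + 1)) = real x + real y * (t 0 + 1)"
      using cj_K_comb[OF K_int(2) K_closed(1)[OF wK K_int(4)], of x "int y"] K_add[OF wK K_int(4)] t0 by simp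
    have "real x + real y * (w + 1) > 0 \<and> real x + real y * (t 0 + 1) > 0"
    proof (cases "y = 0")
      case True
      then show ?thesis using False by simp
    next
      case y: False
      have "real y * (w + 1) > 0" "real y * (t 0 + 1) > 0"
        using y W_gt_1[of 0] t_bounds(1)[of 0] by simp_all
      then show ?thesis by (simp add: add_nonneg_pos)
    qed
    moreover have "real x + real y * (w + 1) \<in> M"
      using M_add[OF M_int[OF \<delta>(2), of "int x"] M_int[OF \<delta>(1), of "int y"]] by simp
    ultimately have "real x + real y * (w + 1) \<in> Mpos" by (simp add: Mpos_def cjd)
    then have "wt (real x + real y * (w + 1)) = chi (int (ideal_norm D (scale_ideal (real x + real y * (w + 1)) b)))"
      by (simp add: wt_def \<nu>_Mpos)
    also have "\<dots> = chi (int (r x y))"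
      by (rule dirichlet_character_cong[OF chi]) (simp add: r[OF xy(3,4) False, symmetric] zmod_int)
    finally show ?thesis using False by (auto simp: residue_weight_def x_def[symmetric] y_def[symmetric] Let_def)
  qed
  finally show ?thesis .
qed

lemma wti_eq:
  assumes r: "\<And>x y. x < q \<Longrightarrow> y < q \<Longrightarrow> (x, y) \<noteq> (0, 0) \<Longrightarrow>
      ideal_norm D (scale_ideal (real x + real y * (w + 1)) b) mod q = r x y"
  shows "wti i X Y = cone_weight q chi r a i X Y"
proof -
  have "of_int X * e (2 * i) + of_int Y * e (2 * i + 1)
    = of_int (X * fst (lattice_coord a (2 * i)) + Y * fst (lattice_coord a (2 * i + 1))) * 1
      + of_int (X * snd (lattice_coord a (2 * i)) + Y * snd (lattice_coord a (2 * i + 1))) * (w + 1)"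
    unfolding e_coord by (simp add: algebra_simps)
  then have "wti i X Y = wt (of_int (X * fst (lattice_coord a (2 * i)) + Y * fst (lattice_coord a (2 * i + 1))) * 1
      + of_int (X * snd (lattice_coord a (2 * i)) + Y * snd (lattice_coord a (2 * i + 1))) * (w + 1))"
    by (simp only: wti_def)
  also have "\<dots> = cone_weight q chi r a i X Y" unfolding cone_weight_def by (rule wt_coord[OF r])
  finally show ?thesis .
qed

text \<open>\<open>Lval_eq\<close> over the common denominator \<open>12 * q ^ 2\<close>: Bernoulli
  values at fractions have the denominator \<open>6 * q ^ 2\<close> and enter with a factor one
  half.\<close>

theorem partial_hecke_L_formula:
  assumes r: "\<And>x y. x < q \<Longrightarrow> y < q \<Longrightarrow> (x, y) \<noteq> (0, 0) \<Longrightarrow>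
      ideal_norm D (scale_ideal (real x + real y * (w + 1)) b) mod q = r x y"
  shows "partial_hecke_L D 0 (norm_character D q chi) b =
    (\<Sum>i<p. \<Sum>(X, Y)\<in>IQ \<times> IQ. cone_weight q chi r a i X Y *
      of_int (mixed_term q (a (2 * i + 1)) X Y - a (2 * i + 1) * scaled_b2 q X
        + a (2 * i) * scaled_b2 q ((- Y) mod int q))) / (12 * of_nat q ^ 2)"
proof -
  have q0: "real q > 0" using q by simp
  have b2: "b2 (of_int X / real q) = of_int (scaled_b2 q X) / (6 * real q ^ 2)" for X
    using q0 by (simp add: b2_def scaled_b2_def power2_eq_square field_simps)
  have "(of_int X / real q - 1/2) * (trq 0 X Y - trq (N i) X Y)
      - real (N i) * b2 (of_int X / real q) / 2 + of_int (a (2 * i)) * b2 (trq 0 X Y) / 2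
    = of_int (mixed_term q (a (2 * i + 1)) X Y - a (2 * i + 1) * scaled_b2 q X
        + a (2 * i) * scaled_b2 q ((- Y) mod int q)) / (12 * real q ^ 2)" for i X Y
  proof -
    have t: "tr 0 X Y = (- Y) mod int q" "tr (N i) X Y = (- Y - a (2 * i + 1) * X) mod int q"
      using a_pos[of "2 * i + 1"] by (simp_all add: tr_def N_def)
    have "(of_int X / real q - 1/2) * (trq 0 X Y - trq (N i) X Y)
       = of_int (mixed_term q (a (2 * i + 1)) X Y) / (12 * real q ^ 2)"
      unfolding t mixed_term_def using q0 by (simp add: power2_eq_square field_simps)
    moreover have "real (N i) * b2 (of_int X / real q) / 2 = of_int (a (2 * i + 1) * scaled_b2 q X) / (12 * real q ^ 2)"
      unfolding b2 N_real by simp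
    moreover have "of_int (a (2 * i)) * b2 (trq 0 X Y) / 2
       = of_int (a (2 * i) * scaled_b2 q ((- Y) mod int q)) / (12 * real q ^ 2)"
      unfolding b2 t by simp
    ultimately show ?thesis by (simp only: of_int_add of_int_diff add_divide_distrib diff_divide_distrib)
  qed
  note m = this
  have wti: "wti i X Y = cone_weight q chi r a i X Y" for i X Y by (rule wti_eq) (rule r)
  have "Lval = (\<Sum>i<p. \<Sum>(X, Y)\<in>IQ \<times> IQ. cone_weight q chi r a i X Y *
      of_int (mixed_term q (a (2 * i + 1)) X Y - a (2 * i + 1) * scaled_b2 q X
        + a (2 * i) * scaled_b2 q ((- Y) mod int q)) / (12 * of_nat q ^ 2))"
    unfolding Lval_eq m wti by (intro sum.cong refl) (simp add: case_prod_unfold)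
  then show ?thesis
    unfolding partial_hecke_L_eq by (simp only: sum_divide_distrib case_prod_unfold)
qed

end

text \<open>The locale asks for irrationality of \<open>\<delta> - 1\<close>. It holds because the
  inverse ideal contains the square root of \<open>D\<close>, which is then an integer combination
  of 1 and \<open>\<delta>\<close>.\<close>

lemma (in quad_radicand) hecke_characterI:
  assumes per: "has_periodic_cfrac (\<delta> - 1) s a0" and I: "integral_ideal D b"
    and inv: "inverse_ideal D b = unit_lattice \<delta>" and q: "q \<ge> 1" and chi: "dirichlet_character q chi"
  shows "hecke_character D (\<delta> - 1) s a0 b q chi"
proof -
  note i = integral_ideal_unpack[OF I]
  have "\<delta> \<in> unit_lattice \<delta>" unfolding unit_lattice_def by (force intro: exI[of _ 0] exI[of _ 1])
  then have \<delta>K: "\<delta> \<in> K" using inv by (auto simp: inverse_ideal_def)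
  have "\<rho> * y \<in> OK" if "y \<in> b" for y using i(6)[OF O_rho that] i(2) by blast
  then have "\<rho> \<in> unit_lattice \<delta>" unfolding inv[symmetric] inverse_ideal_def using K_rho by (simp add: R_simps)
  then obtain m n where mn: "\<rho> = of_int m + of_int n * \<delta>" by (auto simp: unit_lattice_def)
  have irr: "\<delta> - 1 \<notin> \<rat>"
  proof
    assume "\<delta> - 1 \<in> \<rat>"
    then have "(\<delta> - 1) + 1 \<in> \<rat>" by (rule Rats_add) simp
    then have "of_int m + of_int n * \<delta> \<in> \<rat>" by (intro Rats_add Rats_mult) simp_all
    then show False using rho_irrational mn by simp
  qed
  have cf: "cf_lattice D (\<delta> - 1) s a0"
    by (intro cf_lattice.intro quad_radicand_axioms cf_lattice_axioms.intro per irr K_closed(3) \<delta>K K_int)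
  show ?thesis
    by (intro hecke_character.intro hecke_lattice.intro cf hecke_lattice_axioms.intro I
        hecke_character_axioms.intro q chi)
      (simp add: cf_lattice.M_def[OF cf] inv)
qed

lemma poly_mod_cong:
  fixes P :: "int poly"
  assumes "x mod m = y mod m"
  shows "poly P x mod m = poly P y mod m"
  using assms by (induction P) (auto intro!: mod_add_cong mod_mult_cong)

section \<open>The ring generated by the character values\<close>

lemma character_ring_closed:
  shows character_ring_one: "1 \<in> character_ring q chi"
    and character_ring_add: "x \<in> character_ring q chi \<Longrightarrow> y \<in> character_ring q chi \<Longrightarrow> x + y \<in> character_ring q chi"
    and character_ring_mult: "x \<in> character_ring q chi \<Longrightarrow> y \<in> character_ring q chi \<Longrightarrow> x * y \<in> character_ring q chi"
    and character_ring_uminus: "x \<in> character_ring q chi \<Longrightarrow> - x \<in> character_ring q chi"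
proof -
  have ai: "a_inv (ring_on (UNIV :: complex set)) x = - x" for x
    unfolding a_inv_def m_inv_def ring_on_def by (rule the_equality) (auto simp: eq_neg_iff_add_eq_0 add.commute)
  show "1 \<in> character_ring q chi"
    using generate_ring.one[of "ring_on (UNIV :: complex set)"] by (simp add: character_ring_def ring_on_def)
  show "x + y \<in> character_ring q chi" if "x \<in> character_ring q chi" "y \<in> character_ring q chi" for x y
    using generate_ring.eng_add[OF that[unfolded character_ring_def]] by (simp add: character_ring_def ring_on_def)
  show "x * y \<in> character_ring q chi" if "x \<in> character_ring q chi" "y \<in> character_ring q chi" for x y
    using generate_ring.eng_mult[OF that[unfolded character_ring_def]] by (simp add: character_ring_def ring_on_def)
  show "- x \<in> character_ring q chi" if "x \<in> character_ring q chi" for x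
    using generate_ring.a_inv[OF that[unfolded character_ring_def]] by (simp add: character_ring_def ai)
qed

lemma character_ring_of_int: "of_int k \<in> character_ring q chi"
proof -
  have z: "0 \<in> character_ring q chi"
    using character_ring_add[OF character_ring_one character_ring_uminus[OF character_ring_one]] by simp
  have n: "of_nat n \<in> character_ring q chi" for n
    by (induction n) (use z character_ring_add[OF character_ring_one] in auto)
  show ?thesis using n[of "nat k"] character_ring_uminus[OF n[of "nat (-k)"]] by (cases "k \<ge> 0") auto
qed

lemma character_ring_sum: "(\<And>i. i \<in> A \<Longrightarrow> f i \<in> character_ring q chi) \<Longrightarrow> sum f A \<in> character_ring q chi"
  using character_ring_of_int[of 0 q chi]
  by (induction A rule: infinite_finite_induct) (auto intro: character_ring_add)

lemma character_ring_chi: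
  assumes "q \<ge> 1" "dirichlet_character q chi"
  shows "chi m \<in> character_ring q chi"
proof -
  \<comment> \<open>The representative is taken in \<open>1, ..., q\<close> instead of
    \<open>0, ..., q - 1\<close>, matching the generators of the ring.\<close>
  define k where "k = (m - 1) mod int q + 1"
  have "chi m = chi k"
    by (rule dirichlet_character_cong[OF assms(2)]) (simp add: k_def mod_add_left_eq)
  moreover have "0 \<le> (m - 1) mod int q" "(m - 1) mod int q < int q" using assms(1) by simp_all
  then have "k \<in> {1..int q}" unfolding k_def atLeastAtMost_iff by linarith
  then have "chi k \<in> character_ring q chi" unfolding character_ring_def by (intro generate_ring.incl imageI)
  ultimately show ?thesis by simp
qed

theorem corollary2p5:
  fixes q s d :: nat
    and a :: "nat \<Rightarrow> int poly"
    and f :: "nat \<Rightarrow> nat"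
    and b :: "nat \<Rightarrow> real set"
    and \<delta> :: "nat \<Rightarrow> real"
    and chi :: "int \<Rightarrow> complex"
  assumes "q \<ge> 1" and "s \<ge> 1"
    and "\<forall>i<s. degree (a i) \<le> d"
    and "\<forall>n. f n > 1 \<and> squarefree (f n)"
    and "\<forall>n. integral_ideal (f n) (b n) \<and> coprime_to (f n) q (b n)"
    and "\<forall>n. inverse_ideal (f n) (b n) = unit_lattice (\<delta> n)"
    and "\<forall>n. has_periodic_cfrac (\<delta> n - 1) s (\<lambda>i. poly (a i) (int n))"
    and "\<exists>\<rho> :: nat \<Rightarrow> nat \<Rightarrow> nat \<Rightarrow> nat. \<forall>n C D.
           C < q \<and> D < q \<and> (C, D) \<noteq> (0, 0) \<longrightarrow>
             ideal_norm (f n) (scale_ideal (real C + real D * \<delta> n) (b n)) mod q = \<rho> C D (n mod q)"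
    and "dirichlet_character q chi"
  shows "\<exists>c. quasi_polynomial d q c
               (\<lambda>n. partial_hecke_L (f n) 0 (norm_character (f n) q chi) (b n)) \<and>
             (\<forall>i\<le>d. \<forall>n. \<exists>z \<in> character_ring q chi. c i n = z / (12 * of_nat q ^ (i + 2)))"
proof -
  obtain \<rho> :: "nat \<Rightarrow> nat \<Rightarrow> nat \<Rightarrow> nat" where \<rho>: "\<And>n C D. C < q \<Longrightarrow> D < q \<Longrightarrow> (C, D) \<noteq> (0, 0) \<Longrightarrow>
      ideal_norm (f n) (scale_ideal (real C + real D * \<delta> n) (b n)) mod q = \<rho> C D (n mod q)"
    using assms(8) by blast
  define A where "A n k = poly (a (k mod s)) (int n)" for n k
  define p where "p = (if even s then s else 2 * s) div 2"
  define wgt where "wgt n = cone_weight q chi (\<lambda>C D. \<rho> C D (n mod q)) (A n)" for n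
  define I where "I = {0..<int q} \<times> {0..<int q}"
  \<comment> \<open>The coefficient of the \<open>k\<close>-th power of \<open>n\<close>. Partial
    quotients contribute their polynomial coefficients; the mixed term is merely periodic in
    \<open>n\<close> and goes entirely into the constant coefficient.\<close>
  define cf where "cf k n i X Y = (if k = 0 then mixed_term q (A n (2 * i + 1)) X Y else 0)
     - coeff (a ((2 * i + 1) mod s)) k * scaled_b2 q X
     + coeff (a ((2 * i) mod s)) k * scaled_b2 q ((- Y) mod int q)" for k n i X Y
  define S where "S k n = (\<Sum>i<p. \<Sum>(X, Y)\<in>I. wgt n i X Y * of_int (cf k n i X Y))" for k n
  have L: "partial_hecke_L (f n) 0 (norm_character (f n) q chi) (b n) =
    (\<Sum>i<p. \<Sum>(X, Y)\<in>I. wgt n i X Y *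
      of_int (mixed_term q (A n (2 * i + 1)) X Y - A n (2 * i + 1) * scaled_b2 q X
        + A n (2 * i) * scaled_b2 q ((- Y) mod int q))) / (12 * of_nat q ^ 2)" for n
  proof -
    interpret Q: quad_radicand "f n" using assms(4) by unfold_locales auto
    interpret H: hecke_character "f n" "\<delta> n - 1" s "\<lambda>i. poly (a i) (int n)" "b n" q chi
      by (rule Q.hecke_characterI) (use assms in auto)
    have Ha: "H.a = A n" by (simp add: fun_eq_iff H.a_def A_def)
    have Hp: "H.p = p" by (simp add: H.p_def H.len_def p_def)
    show ?thesis
      using H.partial_hecke_L_formula[of "\<lambda>C D. \<rho> C D (n mod q)"] \<rho>[where n = n]
      unfolding Ha Hp wgt_def I_def by simp
  qed
  have A_poly: "A n k = (\<Sum>j\<le>d. coeff (a (k mod s)) j * int n ^ j)" for n k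
  proof -
    have "degree (a (k mod s)) \<le> d" using assms(2,3) by simp
    then show ?thesis unfolding A_def poly_altdef
      by (intro sum.mono_neutral_left) (auto simp: coeff_eq_0)
  qed
  have cf_sum: "(\<Sum>k\<le>d. cf k n i X Y * int n ^ k) =
      mixed_term q (A n (2 * i + 1)) X Y - A n (2 * i + 1) * scaled_b2 q X
        + A n (2 * i) * scaled_b2 q ((- Y) mod int q)" for n i X Y
  proof -
    have "(\<Sum>k\<le>d. (if k = 0 then mixed_term q (A n (2 * i + 1)) X Y else 0) * int n ^ k)
      = (\<Sum>k\<le>d. if k = 0 then mixed_term q (A n (2 * i + 1)) X Y else 0)"
      by (intro sum.cong) auto
    then have 0: "(\<Sum>k\<le>d. (if k = 0 then mixed_term q (A n (2 * i + 1)) X Y else 0) * int n ^ k)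
      = mixed_term q (A n (2 * i + 1)) X Y" by simp
    have "(\<Sum>k\<le>d. cf k n i X Y * int n ^ k) = (\<Sum>k\<le>d. (if k = 0 then mixed_term q (A n (2 * i + 1)) X Y else 0) * int n ^ k
        - (coeff (a ((2 * i + 1) mod s)) k * int n ^ k) * scaled_b2 q X
        + (coeff (a ((2 * i) mod s)) k * int n ^ k) * scaled_b2 q ((- Y) mod int q))"
      by (intro sum.cong refl) (simp add: cf_def algebra_simps)
    also have "\<dots> = mixed_term q (A n (2 * i + 1)) X Y - A n (2 * i + 1) * scaled_b2 q X
        + A n (2 * i) * scaled_b2 q ((- Y) mod int q)"
      unfolding sum.distrib sum_subtractf 0 unfolding A_poly sum_distrib_right ..
    finally show ?thesis .
  qed
  have sumS: "partial_hecke_L (f n) 0 (norm_character (f n) q chi) (b n)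
      = (\<Sum>k\<le>d. S k n / (12 * of_nat q ^ 2) * of_nat n ^ k)" for n
  proof -
    have "(\<Sum>k\<le>d. S k n * of_nat n ^ k)
      = (\<Sum>i<p. \<Sum>XY\<in>I. \<Sum>k\<le>d. wgt n i (fst XY) (snd XY) * of_int (cf k n i (fst XY) (snd XY) * int n ^ k))"
      unfolding S_def case_prod_unfold sum_distrib_right
      by (subst sum.swap, intro sum.cong refl, subst sum.swap, intro sum.cong refl) simp
    also have "\<dots> = (\<Sum>i<p. \<Sum>(X, Y)\<in>I. wgt n i X Y *
      of_int (mixed_term q (A n (2 * i + 1)) X Y - A n (2 * i + 1) * scaled_b2 q X
        + A n (2 * i) * scaled_b2 q ((- Y) mod int q)))"
      unfolding case_prod_unfold cf_sum[symmetric] of_int_sum sum_distrib_left ..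
    finally have "(\<Sum>k\<le>d. S k n * of_nat n ^ k) / (12 * of_nat q ^ 2)
      = partial_hecke_L (f n) 0 (norm_character (f n) q chi) (b n)" unfolding L by simp
    then show ?thesis by (simp add: sum_divide_distrib)
  qed
  \<comment> \<open>Integer polynomials take congruent values at \<open>n\<close> and
    \<open>n + q\<close>, and the weights and mixed terms see the partial quotients only modulo
    \<open>q\<close>.\<close>
  have per: "S k (n + q) = S k n" for k n
  proof -
    have A_cong: "A (n + q) j mod int q = A n j mod int q" for j
      unfolding A_def by (rule poly_mod_cong) simp
    have "wgt (n + q) = wgt n"
      unfolding wgt_def fun_eq_iff by (simp add: cone_weight_cong[OF A_cong])
    moreover have "cf k (n + q) = cf k n"
    proof -
      have "mixed_term q (A (n + q) j) X Y = mixed_term q (A n j) X Y" for j X Y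
        unfolding mixed_term_def
        by (subst mod_diff_cong[OF refl mod_mult_cong[OF A_cong refl]]) (rule refl)
      then show ?thesis by (simp add: fun_eq_iff cf_def)
    qed
    ultimately show ?thesis by (simp add: S_def)
  qed
  have ring: "S k n \<in> character_ring q chi" for k n
  proof -
    have "wgt n i X Y \<in> character_ring q chi" for i X Y
      unfolding wgt_def cone_weight_def residue_weight_def Let_def
      using character_ring_chi[OF assms(1,9)] by simp
    then show ?thesis unfolding S_def case_prod_unfold
      by (intro character_ring_sum character_ring_mult character_ring_of_int)
  qed
  show ?thesis
  proof (intro exI[of _ "\<lambda>k n. S k n / (12 * of_nat q ^ 2)"] conjI allI impI)
    show "quasi_polynomial d q (\<lambda>k n. S k n / (12 * of_nat q ^ 2))
        (\<lambda>n. partial_hecke_L (f n) 0 (norm_character (f n) q chi) (b n))"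
      unfolding quasi_polynomial_def by (auto simp: per sumS)
    fix i n
    \<comment> \<open>The denominator obtained is \<open>12 * q ^ 2\<close> for every
      \<open>i\<close>; the fraction is expanded by \<open>q ^ i\<close>.\<close>
    have "S i n / (12 * of_nat q ^ 2) = (of_int (int q ^ i) * S i n) / (12 * of_nat q ^ (i + 2))"
      using assms(1) by (simp add: power_add power2_eq_square field_simps)
    moreover have "of_int (int q ^ i) * S i n \<in> character_ring q chi"
      by (intro character_ring_mult character_ring_of_int ring)
    ultimately show "\<exists>z\<in>character_ring q chi. S i n / (12 * of_nat q ^ 2) = z / (12 * of_nat q ^ (i + 2))" by blast
  qed
qed

end
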